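(* Let $k$ be a field and let $G$ be a non-trivial finite group which is semi-faithful over $k$. Then $\operatorname{covdim}_k G=\operatorname{edim}_k G$ if and only if $Z(G,k)$ is non-trivial. Otherwise $\operatorname{covdim}_k G=\operatorname{edim}_k G+1$.
   Context: $k$ is an arbitrary field; representations are finite dimensional over $k$. $G$ is semi-faithful (over $k$) if it admits a completely reducible faithful representation over $k$. For a vector space $V$ over $k$, $\mathbb{A}(V)$ is the associated affine space. A covariant of $G$ is a $G$-equivariant $k$-rational map $\phi\colon\mathbb{A}(V)\dashrightarrow\mathbb{A}(W)$ with $V,W$ representations of $G$ over $k$. It is faithful if the image of the generic point of $\mathbb{A}(V)$ has trivial stabilizer in $G$. $\dim\phi$ is the dimension of the closure of the image of $\phi$. The essential dimension $\operatorname{edim}_k G$ is the minimum of $\dim\phi$ over all faithful covariants over $k$; the covariant dimension $\operatorname{covdim}_k G$ is the minimum of $\dim\phi$ over all faithful covariants over $k$ which are regular (i.e. morphisms $\mathbb{A}(V)\to\mathbb{A}(W)$). The $k$-center of $G$ is $Z(G,k)=\{g\in Z(G): k$ contains a primitive root of unity of order $\operatorname{ord} g\}$. *)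

theory Defs
  imports
    "Jordan_Normal_Form.VS_Connect"
    "HOL-Algebra.Multiplicative_Group"
    "HOL-Library.Poly_Mapping"
    "HOL-Library.Extended_Nat"
    "HOL-Computational_Algebra.Fraction_Field"
begin

section \<open>Representations\<close>

text \<open>A finite-dimensional representation is a homomorphism to \<open>GL n k\<close>, acting on column
  vectors. Every finite-dimensional vector space is isomorphic to some \<open>k\<^sup>n\<close>; \<open>n = 0\<close> is allowed.\<close>

definition representation ::
    "('g, 'b) monoid_scheme \<Rightarrow> nat \<Rightarrow> ('g \<Rightarrow> 'k::field mat) \<Rightarrow> bool" where
  "representation G n \<rho> \<longleftrightarrow> \<rho> \<in> hom G (units_of (ring_mat TYPE('k) n ()))"

definition faithful_rep :: "('g, 'b) monoid_scheme \<Rightarrow> ('g \<Rightarrow> 'k::field mat) \<Rightarrow> bool" where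
  "faithful_rep G \<rho> \<longleftrightarrow> inj_on \<rho> (carrier G)"

definition invariant_subspace ::
    "('g, 'b) monoid_scheme \<Rightarrow> nat \<Rightarrow> ('g \<Rightarrow> 'k::field mat) \<Rightarrow> 'k vec set \<Rightarrow> bool" where
  "invariant_subspace G n \<rho> U \<longleftrightarrow>
     VectorSpace.subspace class_ring U (module_vec TYPE('k) n) \<and>
     (\<forall>g\<in>carrier G. \<forall>u\<in>U. \<rho> g *\<^sub>v u \<in> U)"

definition completely_reducible ::
    "('g, 'b) monoid_scheme \<Rightarrow> nat \<Rightarrow> ('g \<Rightarrow> 'k::field mat) \<Rightarrow> bool" where
  "completely_reducible G n \<rho> \<longleftrightarrow>
     (\<forall>U. invariant_subspace G n \<rho> U \<longrightarrow>
        (\<exists>U'. invariant_subspace G n \<rho> U' \<and> U \<inter> U' = {0\<^sub>v n} \<and>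
              (\<forall>v\<in>carrier_vec n. \<exists>u\<in>U. \<exists>u'\<in>U'. v = u + u')))"

definition semi_faithful :: "'k::field itself \<Rightarrow> ('g, 'b) monoid_scheme \<Rightarrow> bool" where
  "semi_faithful _ G \<longleftrightarrow>
     (\<exists>n (\<rho> :: 'g \<Rightarrow> 'k mat).
        representation G n \<rho> \<and> completely_reducible G n \<rho> \<and> faithful_rep G \<rho>)"


section \<open>Polynomials and rational functions in finitely many variables\<close>

text \<open>The rings \<open>k[x\<^sub>0,\<dots>,x\<^bsub>n-1\<^esub>]\<close> for all \<open>n\<close> live inside one polynomial ring in countably many
  variables, and likewise for their fraction fields.\<close>

type_synonym 'k mpoly = "(nat \<Rightarrow>\<^sub>0 nat) \<Rightarrow>\<^sub>0 'k"
type_synonym 'k ratfun = "'k mpoly fract"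

definition polys :: "nat \<Rightarrow> 'k::field mpoly set" where
  "polys n = {p. \<forall>\<mu>\<in>Poly_Mapping.keys p. Poly_Mapping.keys \<mu> \<subseteq> {..<n}}"

definition poly_ring :: "nat \<Rightarrow> 'k::field mpoly ring" where
  "poly_ring n = \<lparr>carrier = polys n, mult = (*), one = 1, zero = 0, add = (+)\<rparr>"

definition ratfuns :: "nat \<Rightarrow> 'k::field ratfun set" where
  "ratfuns n = {Fract a b | a b. a \<in> polys n \<and> b \<in> polys n \<and> b \<noteq> 0}"

definition const_rf :: "'k::field \<Rightarrow> 'k ratfun" where
  "const_rf c = Fract (Poly_Mapping.single 0 c) 1"

definition var_rf :: "nat \<Rightarrow> 'k::field ratfun" where
  "var_rf i = Fract (Poly_Mapping.single (Poly_Mapping.single i 1) 1) 1"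

definition poly_eval :: "'k::field ratfun vec \<Rightarrow> 'k mpoly \<Rightarrow> 'k ratfun" where
  "poly_eval a p =
     (\<Sum>\<mu>\<in>Poly_Mapping.keys p.
        const_rf (Poly_Mapping.lookup p \<mu>) *
        (\<Prod>i\<in>Poly_Mapping.keys \<mu>. (a $ i) ^ Poly_Mapping.lookup \<mu> i))"

text \<open>The value is independent of the chosen fraction; it is specified only if some fraction
  representing \<open>r\<close> has a denominator not vanishing at \<open>a\<close>. This is always the case for the
  invertible linear substitutions below.\<close>

definition ratfun_eval :: "'k::field ratfun vec \<Rightarrow> 'k ratfun \<Rightarrow> 'k ratfun" where
  "ratfun_eval a r =
     (THE s. \<exists>p q. r = Fract p q \<and> q \<noteq> 0 \<and> poly_eval a q \<noteq> 0 \<and>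
                   s = poly_eval a p / poly_eval a q)"


section \<open>Affine space, rational maps, and the dimension of the image\<close>

definition affine_space :: "nat \<Rightarrow> 'k::field mpoly set set" where
  "affine_space n = {P. primeideal P (poly_ring n)}"

definition zariski_closure :: "nat \<Rightarrow> 'k::field mpoly set set \<Rightarrow> 'k mpoly set set" where
  "zariski_closure n S = {P \<in> affine_space n. \<Inter>S \<subseteq> P}"

text \<open>Krull dimension of a closed subset of affine space. Its irreducible closed subsets are the
  closures of its points, so that chains of these are chains of prime ideals.\<close>

definition krull_dim :: "'k::field mpoly set set \<Rightarrow> enat" where
  "krull_dim Z =
     (SUP r \<in> {r. \<exists>c. (\<forall>i\<le>r. c i \<in> Z) \<and> (\<forall>i<r. c i \<subset> c (Suc i))}. enat r)"

definition local_ring :: "nat \<Rightarrow> 'k::field mpoly set \<Rightarrow> 'k ratfun set" where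
  "local_ring n P = {Fract a b | a b. a \<in> polys n \<and> b \<in> polys n - P}"

definition local_max_ideal :: "nat \<Rightarrow> 'k::field mpoly set \<Rightarrow> 'k ratfun set" where
  "local_max_ideal n P = {Fract a b | a b. a \<in> P \<and> b \<in> polys n - P}"

text \<open>A rational map between affine spaces of dimensions \<open>n\<close> and \<open>m\<close> is an \<open>m\<close>-tuple of rational
  functions in \<open>n\<close> variables. The same tuple is the image of the generic point, as a point of the
  target with coordinates in the function field of the source.\<close>

definition rational_map :: "nat \<Rightarrow> nat \<Rightarrow> 'k::field ratfun vec \<Rightarrow> bool" where
  "rational_map n m f \<longleftrightarrow> f \<in> carrier_vec m \<and> (\<forall>i<m. f $ i \<in> ratfuns n)"

definition regular_map :: "nat \<Rightarrow> nat \<Rightarrow> 'k::field ratfun vec \<Rightarrow> bool" where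
  "regular_map n m f \<longleftrightarrow> f \<in> carrier_vec m \<and> (\<forall>i<m. f $ i \<in> {Fract a 1 | a. a \<in> polys n})"

text \<open>A point lies in the domain of definition iff all components are in its local ring; its image
  is then the preimage of the maximal ideal under the induced map from \<open>k[y\<^sub>0,\<dots>,y\<^bsub>m-1\<^esub>]\<close>.\<close>

definition map_image :: "nat \<Rightarrow> nat \<Rightarrow> 'k::field ratfun vec \<Rightarrow> 'k mpoly set set" where
  "map_image n m f =
     {{p \<in> polys m. poly_eval f p \<in> local_max_ideal n P} | P.
        P \<in> affine_space n \<and> (\<forall>i<m. f $ i \<in> local_ring n P)}"

definition map_dim :: "nat \<Rightarrow> nat \<Rightarrow> 'k::field ratfun vec \<Rightarrow> enat" where
  "map_dim n m f = krull_dim (zariski_closure m (map_image n m f))"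


section \<open>Covariants\<close>

abbreviation const_mat :: "'k::field mat \<Rightarrow> 'k ratfun mat" where
  "const_mat \<equiv> map_mat const_rf"

text \<open>Equivariance \<open>f (\<rho> g x) = \<sigma> g (f x)\<close> is stated at the generic vector \<open>x = (x\<^sub>0,\<dots>,x\<^bsub>n-1\<^esub>)\<close>.\<close>

definition covariant ::
    "('g, 'b) monoid_scheme \<Rightarrow> nat \<Rightarrow> ('g \<Rightarrow> 'k::field mat) \<Rightarrow> nat \<Rightarrow> ('g \<Rightarrow> 'k mat) \<Rightarrow>
     'k ratfun vec \<Rightarrow> bool" where
  "covariant G n \<rho> m \<sigma> f \<longleftrightarrow>
     representation G n \<rho> \<and> representation G m \<sigma> \<and> rational_map n m f \<and>
     (\<forall>g\<in>carrier G.
        map_vec (ratfun_eval (const_mat (\<rho> g) *\<^sub>v vec n var_rf)) f = const_mat (\<sigma> g) *\<^sub>v f)"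

text \<open>The stabilizer is that of the image of the generic point viewed as a point over the function
  field (the underlying scheme point is always fixed by \<open>G\<close>).\<close>

definition faithful_covariant ::
    "('g, 'b) monoid_scheme \<Rightarrow> nat \<Rightarrow> ('g \<Rightarrow> 'k::field mat) \<Rightarrow> nat \<Rightarrow> ('g \<Rightarrow> 'k mat) \<Rightarrow>
     'k ratfun vec \<Rightarrow> bool" where
  "faithful_covariant G n \<rho> m \<sigma> f \<longleftrightarrow>
     covariant G n \<rho> m \<sigma> f \<and> {g \<in> carrier G. const_mat (\<sigma> g) *\<^sub>v f = f} = {\<one>\<^bsub>G\<^esub>}"

text \<open>An infimum of a nonempty set of extended naturals is attained, and a finite group has a
  faithful covariant (the identity of its regular representation).\<close>

definition edim :: "'k::field itself \<Rightarrow> ('g, 'b) monoid_scheme \<Rightarrow> enat" where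
  "edim _ G = Inf {map_dim n m f | n (\<rho> :: 'g \<Rightarrow> 'k mat) m \<sigma> f.
     faithful_covariant G n \<rho> m \<sigma> f}"

definition covdim :: "'k::field itself \<Rightarrow> ('g, 'b) monoid_scheme \<Rightarrow> enat" where
  "covdim _ G = Inf {map_dim n m f | n (\<rho> :: 'g \<Rightarrow> 'k mat) m \<sigma> f.
     faithful_covariant G n \<rho> m \<sigma> f \<and> regular_map n m f}"


section \<open>The k-center\<close>

definition primitive_root_of_unity :: "nat \<Rightarrow> 'k::field \<Rightarrow> bool" where
  "primitive_root_of_unity d \<zeta> \<longleftrightarrow> 0 < d \<and> \<zeta> ^ d = 1 \<and> (\<forall>j. 0 < j \<and> j < d \<longrightarrow> \<zeta> ^ j \<noteq> 1)"

definition k_center :: "'k::field itself \<Rightarrow> ('g, 'b) monoid_scheme \<Rightarrow> 'g set" where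
  "k_center _ G =
     {z \<in> carrier G. (\<forall>x\<in>carrier G. z \<otimes>\<^bsub>G\<^esub> x = x \<otimes>\<^bsub>G\<^esub> z) \<and>
        (\<exists>\<zeta> :: 'k. primitive_root_of_unity (group.ord G z) \<zeta>)}"

end

theory Submission
  imports Defs "HOL-Algebra.Finite_Extensions" "HOL-Algebra.Algebraic_Closure_Type"
begin

text \<open>The dimension of the image of a rational map is the transcendence degree of its components.

  Let \<open>\<sigma>\<close> be faithful and completely reducible. For \<open>h \<noteq> 1\<close> the vectors fixed by the normal closure of
  \<open>h\<close> have an invariant complement, and any nonzero covariant \<open>\<psi>\<^sub>h\<close> into it is moved by \<open>h\<close>. Independence
  of characters yields such \<open>\<psi>\<^sub>h\<close> with entries in the algebra generated by a given faithful covariant, or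
  in any other \<open>G\<close>-stable algebra of rational functions on which \<open>G\<close> acts faithfully. So all faithful
  covariants may be taken of the form \<open>(\<psi>\<^sub>h)\<^sub>h\<close>, and for a grading of the polynomial ring that
  commutes with \<open>G\<close> each \<open>\<psi>\<^sub>h\<close> may be replaced by its leading form.

  Multiplication by an invariant denominator makes a covariant regular and raises its dimension by at
  most one. If some homogeneous \<open>\<psi>\<^sub>h\<close> has nonzero degree, then one may arrange that all degrees are
  positive and multiply each \<open>\<psi>\<^sub>h\<close> by the power of the denominator given by its degree, which preserves
  the homogeneous relations and costs nothing. An element \<open>z \<noteq> 1\<close> of \<open>Z(G,k)\<close> provides a grading by the
  eigenspaces of \<open>z\<close>, in which \<open>\<psi>\<^sub>z\<close> cannot have degree zero as it is moved by \<open>z\<close>.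

  Conversely, for a regular covariant and the standard grading the leading forms have positive degree.
  If \<open>G\<close> is not faithful on the elements of degree zero algebraic over the entries, some \<open>g\<close> of prime order
  multiplies each \<open>\<psi>\<^sub>h\<close> by a scalar, which is a root of unity in \<open>k\<close>; then all commutators with \<open>g\<close> are
  trivial and \<open>g\<close> is in \<open>Z(G,k)\<close>. Otherwise there is a covariant with entries of degree zero, and its
  dimension is smaller.\<close>

hide_const (open) UnivPoly.coeff UnivPoly.monom Polynomial_Divisibility.poly_ring

section \<open>Algebraic dependence in a field\<close>

text \<open>A leading form of a faithful covariant need not be faithful, so the degeneration cannot
  be applied to one map as a whole. The components \<open>\<psi> h\<close> repair this: a nonzero
  covariant into the complement belonging to \<open>h\<close> is automatically moved by
  \<open>h\<close>, so every later step only has to keep each component equivariant and nonzero.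
  Complete reducibility enters here, since only an invariant complement carries an equivariant
  projection. The field may be finite and its characteristic may divide the order of the group.
  Hence covariants are built from independence of characters and not by averaging, specialisations
  use powers of a variable or points of the algebraic closure, and central elements are replaced by
  powers of prime order \<open>p\<close>: a \<open>p\<close>-th root of unity other than 1 forces
  \<open>p\<close> to be nonzero in the field, and then averaging over that cyclic group is
  possible. The summand 1 arises twice. An invariant denominator is one additional function, which
  bounds the difference from above; a nonzero homogeneous entry of nonzero degree is transcendental
  over functions of degree 0, which bounds it from below.\<close>

inductive_set rgen :: "'a::comm_ring_1 set \<Rightarrow> 'a set" for S where
  one: "1 \<in> rgen S"
| base: "x \<in> S \<Longrightarrow> x \<in> rgen S"
| minus: "x \<in> rgen S \<Longrightarrow> - x \<in> rgen S"
| add: "x \<in> rgen S \<Longrightarrow> y \<in> rgen S \<Longrightarrow> x + y \<in> rgen S"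
| mult: "x \<in> rgen S \<Longrightarrow> y \<in> rgen S \<Longrightarrow> x * y \<in> rgen S"

lemma rgen_zero: "0 \<in> rgen S"
  using rgen.add[OF rgen.one rgen.minus[OF rgen.one]] by simp

lemma rgen_sum: "(\<And>i. i \<in> I \<Longrightarrow> f i \<in> rgen S) \<Longrightarrow> sum f I \<in> rgen S"
  by (induction I rule: infinite_finite_induct) (auto intro: rgen_zero rgen.add)

lemma rgen_prod: "(\<And>i. i \<in> I \<Longrightarrow> f i \<in> rgen S) \<Longrightarrow> prod f I \<in> rgen S"
  by (induction I rule: infinite_finite_induct) (auto intro: rgen.one rgen.mult)

lemma rgen_power: "x \<in> rgen S \<Longrightarrow> x ^ n \<in> rgen S"
  by (induction n) (auto intro: rgen.one rgen.mult)

lemma rgen_least: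
  assumes "S \<subseteq> R" "1 \<in> R" "\<And>x. x \<in> R \<Longrightarrow> - x \<in> R"
    "\<And>x y. x \<in> R \<Longrightarrow> y \<in> R \<Longrightarrow> x + y \<in> R" "\<And>x y. x \<in> R \<Longrightarrow> y \<in> R \<Longrightarrow> x * y \<in> R"
  shows "rgen S \<subseteq> R"
proof
  fix x assume "x \<in> rgen S" then show "x \<in> R"
    by induction (use assms in auto)
qed

lemma rgen_mono: "S \<subseteq> T \<Longrightarrow> rgen S \<subseteq> rgen T"
  by (rule rgen_least) (auto intro: rgen.intros)

text \<open>The algebraic closure, inside the ambient field, of the subfield generated by
  \<open>S\<close>. Coefficients in the generated ring suffice after clearing denominators, and
  unlike quotients they can be moved along arbitrary ring homomorphisms and specialisations.\<close>

definition acl :: "'a::field set \<Rightarrow> 'a set" where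
  "acl S = {x. \<exists>p. p \<noteq> 0 \<and> (\<forall>i. coeff p i \<in> rgen S) \<and> poly p x = 0}"

definition fgen :: "'a::field set \<Rightarrow> 'a set" where
  "fgen S = {a / b | a b. a \<in> rgen S \<and> b \<in> rgen S \<and> b \<noteq> 0}"

lemma fgenI: "a \<in> rgen S \<Longrightarrow> b \<in> rgen S \<Longrightarrow> b \<noteq> 0 \<Longrightarrow> a / b \<in> fgen S"
  by (auto simp: fgen_def)

lemma rgen_fgen: "rgen S \<subseteq> fgen S"
proof
  fix x assume "x \<in> rgen S" then show "x \<in> fgen S"
    using fgenI[of x S 1] by (simp add: rgen.one)
qed

lemma fgen_add: assumes "x \<in> fgen S" "y \<in> fgen S" shows "x + y \<in> fgen S"
proof -
  obtain a b c d where "x = a / b" "y = c / d" and ab: "a \<in> rgen S" "b \<in> rgen S" "b \<noteq> 0"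
      "c \<in> rgen S" "d \<in> rgen S" "d \<noteq> 0"
    using assms by (auto simp: fgen_def)
  then have "x + y = (a * d + c * b) / (b * d)" by (simp add: field_simps)
  then show ?thesis using ab by (auto intro!: fgenI rgen.add rgen.mult)
qed

lemma fgen_mult: assumes "x \<in> fgen S" "y \<in> fgen S" shows "x * y \<in> fgen S"
proof -
  obtain a b c d where "x = a / b" "y = c / d" and ab: "a \<in> rgen S" "b \<in> rgen S" "b \<noteq> 0"
      "c \<in> rgen S" "d \<in> rgen S" "d \<noteq> 0"
    using assms by (auto simp: fgen_def)
  then have "x * y = (a * c) / (b * d)" by (simp add: field_simps)
  then show ?thesis using ab by (auto intro!: fgenI rgen.mult)
qed

lemma fgen_uminus: assumes "x \<in> fgen S" shows "- x \<in> fgen S"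
proof -
  obtain a b where "x = a / b" "a \<in> rgen S" "b \<in> rgen S" "b \<noteq> 0"
    using assms by (auto simp: fgen_def)
  then show ?thesis using fgenI[of "- a" S b] by (auto intro: rgen.minus)
qed

lemma fgen_inverse: assumes "x \<in> fgen S" shows "inverse x \<in> fgen S"
proof -
  obtain a b where *: "x = a / b" "a \<in> rgen S" "b \<in> rgen S" "b \<noteq> 0"
    using assms by (auto simp: fgen_def)
  then show ?thesis
    using fgenI[of b S a] rgen_fgen[of S] rgen_zero[of S] by (cases "a = 0") auto
qed

section \<open>Comparison with algebraic elements over a subfield\<close>

lemma subfield_class_ringI:
  assumes "1 \<in> K" "\<And>x. x \<in> K \<Longrightarrow> - x \<in> K" "\<And>x y. x \<in> K \<Longrightarrow> y \<in> K \<Longrightarrow> x + y \<in> K"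
    "\<And>x y. x \<in> K \<Longrightarrow> y \<in> K \<Longrightarrow> x * y \<in> K" "\<And>x. x \<in> K \<Longrightarrow> inverse x \<in> K"
  shows "subfield K (class_ring :: 'a::field ring)"
proof (rule field.subfieldI'[OF class_field.field_axioms])
  show "subring K (class_ring :: 'a ring)"
    by (rule ring.subringI[OF class_ring.ring_axioms]) (use assms in \<open>auto simp: class_ring_simps\<close>)
  show "inv\<^bsub>class_ring\<^esub> k \<in> K" if "k \<in> K - {\<zero>\<^bsub>class_ring\<^esub>}" for k
    using that assms(5)[of k] by (simp add: class_ring_simps)
qed

lemma subfield_fgen: "subfield (fgen S) (class_ring :: 'a::field ring)"
  using rgen_fgen[of S] rgen.one[of S]
  by (intro subfield_class_ringI) (auto intro: fgen_add fgen_mult fgen_inverse fgen_uminus)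

lemma eval_class_ring: "ring.eval class_ring p x = poly (Poly (rev p)) (x::'a::field)"
proof (induction p)
  case (Cons a p)
  then show ?case
    by (simp add: ring.eval.simps[OF class_ring.ring_axioms] Poly_append poly_monom class_ring_simps mult.commute)
qed (simp add: ring.eval.simps[OF class_ring.ring_axioms] class_ring_simps)

text \<open>Bridge to the list polynomials of \<open>univ_poly\<close>, which store the leading
  coefficient first, hence \<open>rev\<close>. It gives access to the facts on algebraic elements
  and finite extensions of carrier-based fields.\<close>

lemma algebraic_over_iff:
  assumes "subfield K (class_ring :: 'a::field ring)"
  shows "ring.algebraic class_ring K (x::'a) \<longleftrightarrow>
    (\<exists>p. p \<noteq> 0 \<and> (\<forall>i. coeff p i \<in> K) \<and> poly p x = 0)"
proof
  have sr: "subring K (class_ring :: 'a ring)" using assms by (rule subfieldE)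
  have zK: "0 \<in> K" using subringE(2)[OF sr] by (simp add: class_ring_simps)
  {
    assume "ring.algebraic class_ring K x"
        then obtain p where p: "p \<in> carrier (univ_poly class_ring K)" "p \<noteq> []" "ring.eval class_ring p x = 0"
      using domain.algebraicE[OF class_field.domain_axioms sr, of x] by (auto simp: class_ring_simps over_def)
    then have lc: "hd p \<noteq> 0" and cK: "set p \<subseteq> K"
      by (auto simp: univ_poly_def polynomial_def class_ring_simps)
    have "Poly (rev p) \<noteq> 0"
    proof
      assume "Poly (rev p) = 0"
      then have "coeff (Poly (rev p)) (length p - 1) = 0" by simp
      then show False using lc p(2)
        by (simp add: coeff_Poly_eq nth_default_def rev_nth hd_conv_nth split: if_splits)
    qed
    moreover have "coeff (Poly (rev p)) i \<in> K" for i
      using cK zK by (auto simp: coeff_Poly_eq nth_default_def rev_nth)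
    ultimately show "\<exists>p. p \<noteq> 0 \<and> (\<forall>i. coeff p i \<in> K) \<and> poly p x = 0"
      using p(3) by (intro exI[of _ "Poly (rev p)"]) (simp add: eval_class_ring)
  }
  assume "\<exists>p. p \<noteq> 0 \<and> (\<forall>i. coeff p i \<in> K) \<and> poly p x = 0"
  then obtain p where p: "p \<noteq> 0" "\<And>i. coeff p i \<in> K" "poly p x = 0" by blast
  have "rev (coeffs p) \<in> carrier (univ_poly class_ring K)"
    using p(1,2)
    by (auto simp: univ_poly_def polynomial_def hd_rev last_coeffs_eq_coeff_degree class_ring_simps
        coeffs_def)
  moreover have "ring.eval class_ring (rev (coeffs p)) x = 0" "rev (coeffs p) \<noteq> []"
    using p by (simp_all add: eval_class_ring)
  ultimately show "ring.algebraic class_ring K x"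
    using ring.algebraicI[OF class_ring.ring_axioms, of "rev (coeffs p)" K x]
    by (simp add: over_def class_ring_simps)
qed

lemma fgen_clear_denominators:
  assumes "finite I" "\<And>i. i \<in> I \<Longrightarrow> f i \<in> fgen S"
  shows "\<exists>d. d \<in> rgen S \<and> d \<noteq> 0 \<and> (\<forall>i\<in>I. d * f i \<in> rgen S)"
  using assms
proof (induction I)
  case empty
  show ?case by (rule exI[of _ 1]) (simp add: rgen.one)
next
  case (insert j I)
  then obtain d where d: "d \<in> rgen S" "d \<noteq> 0" "\<forall>i\<in>I. d * f i \<in> rgen S" by auto
  obtain a b where ab: "f j = a / b" "a \<in> rgen S" "b \<in> rgen S" "b \<noteq> 0"
    using insert.prems[of j] by (auto simp: fgen_def)
  have "d * b * f i \<in> rgen S" if "i \<in> insert j I" for i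
  proof (cases "i = j")
    case True
    then have "d * b * f i = d * a" using ab by simp
    then show ?thesis using d(1) ab(2) by (simp only: rgen.mult)
  next
    case False
    then have "d * b * f i = b * (d * f i)" by simp
    then show ?thesis using d ab False that rgen.mult[of b S "d * f i"] by (metis insertE)
  qed
  then show ?case using d ab by (intro exI[of _ "d * b"]) (auto intro: rgen.mult)
qed

lemma acl_iff_algebraic: "x \<in> acl S \<longleftrightarrow> ring.algebraic class_ring (fgen S) (x::'a::field)"
proof -
  have "\<exists>q. q \<noteq> 0 \<and> (\<forall>i. coeff q i \<in> rgen S) \<and> poly q x = 0"
    if p: "p \<noteq> 0" "\<forall>i. coeff p i \<in> fgen S" "poly p x = 0" for p
  proof -
    obtain d where d: "d \<in> rgen S" "d \<noteq> 0" "\<forall>i\<in>{..Polynomial.degree p}. d * coeff p i \<in> rgen S"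
      using fgen_clear_denominators[of "{..Polynomial.degree p}" "coeff p" S] p(2) by auto
    have "d * coeff p i \<in> rgen S" for i
      using d(3) by (cases "i \<le> Polynomial.degree p") (auto simp: coeff_eq_0 rgen_zero)
    then show ?thesis using p d by (intro exI[of _ "Polynomial.smult d p"]) auto
  qed
  then show ?thesis
    unfolding algebraic_over_iff[OF subfield_fgen] acl_def using rgen_fgen[of S] by blast
qed

lemma acl_mono: "S \<subseteq> T \<Longrightarrow> acl S \<subseteq> acl T"
  unfolding acl_def using rgen_mono[of S T] by blast

lemma rgen_acl: "rgen S \<subseteq> acl S"
proof
  fix x assume "x \<in> rgen S"
  then show "x \<in> acl S" unfolding acl_def
    by (auto intro!: exI[of _ "[:- x, 1:]"] rgen.minus rgen.one rgen_zero
        simp: coeff_pCons split: nat.split)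
qed

lemma acl_base: "S \<subseteq> acl S"
  using rgen_acl rgen.base by blast

lemma acl_subfield: "subfield (acl S) (class_ring :: 'a::field ring)"
proof -
  have "acl S = {x \<in> carrier class_ring. ring.algebraic class_ring (fgen S) x}"
    by (auto simp: acl_iff_algebraic)
  then show ?thesis
    using field.subfield_of_algebraics[OF class_field.field_axioms subfield_fgen[of S]] by (simp add: over_def)
qed

lemma acl_closed:
  shows acl_uminus: "x \<in> acl S \<Longrightarrow> - x \<in> acl S"
    and acl_add: "x \<in> acl S \<Longrightarrow> y \<in> acl S \<Longrightarrow> x + y \<in> acl S"
    and acl_mult: "x \<in> acl S \<Longrightarrow> y \<in> acl S \<Longrightarrow> x * y \<in> acl S"
    and acl_inverse: "x \<in> acl S \<Longrightarrow> inverse x \<in> acl S"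
proof -
  note sr = subfieldE(1)[OF acl_subfield[of S]]
  show "x \<in> acl S \<Longrightarrow> - x \<in> acl S" using subringE(5)[OF sr] by (simp add: class_ring_simps)
  show "x \<in> acl S \<Longrightarrow> y \<in> acl S \<Longrightarrow> x + y \<in> acl S" using subringE(7)[OF sr] by (simp add: class_ring_simps)
  show "x \<in> acl S \<Longrightarrow> y \<in> acl S \<Longrightarrow> x * y \<in> acl S" using subringE(6)[OF sr] by (simp add: class_ring_simps)
  show "x \<in> acl S \<Longrightarrow> inverse x \<in> acl S"
    using ring.subfield_m_inv(1)[OF class_ring.ring_axioms acl_subfield[of S], of x]
    by (cases "x = 0") (auto simp: class_ring_simps)
qed

lemma acl_divide: "x \<in> acl S \<Longrightarrow> y \<in> acl S \<Longrightarrow> x / y \<in> acl S"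
  by (simp add: divide_inverse acl_mult acl_inverse)

lemma rgen_subset_acl: assumes "T \<subseteq> acl S" shows "rgen T \<subseteq> acl S"
  by (rule rgen_least) (use assms rgen_acl[of S] rgen.one[of S] in \<open>auto intro: acl_closed\<close>)

text \<open>A root of a polynomial over \<open>rgen T\<close> lies in a tower of two finite
  extensions: \<open>fgen S\<close> is first enlarged by the finitely many coefficients, each
  algebraic over it, and then by the root. Elements of a finite extension are algebraic.\<close>

lemma acl_idem: assumes "T \<subseteq> acl S" shows "acl T \<subseteq> acl (S::'a::field set)"
proof
  let ?R = "class_ring :: 'a ring"
  let ?K = "fgen S"
  fix x assume "x \<in> acl T"
  then obtain p where p: "p \<noteq> 0" "\<forall>i. coeff p i \<in> rgen T" "poly p x = 0"
    unfolding acl_def by blast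
  define cs where "cs = coeffs p"
  define E where "E = ring.finite_extension class_ring ?K cs"
  have "set cs \<subseteq> rgen T" using p(2) by (auto simp: cs_def coeffs_def)
  then have alg: "(ring.algebraic class_ring over ?K) c" if "c \<in> set cs" for c
    using that rgen_subset_acl[OF assms] by (auto simp: acl_iff_algebraic over_def)
  have sK: "subfield ?K ?R" by (rule subfield_fgen)
  have sE: "subfield E ?R"
    unfolding E_def using domain.finite_extension_is_subfield[OF class_field.domain_axioms sK _ alg, of cs] by simp
  have fE: "ring.finite_dimension class_ring ?K E"
    unfolding E_def using domain.finite_extension_finite_dimension(1)[OF class_field.domain_axioms sK _ alg, of cs] by simp
  have csE: "set cs \<subseteq> E"
    unfolding E_def using domain.finite_extension_mem[OF class_field.domain_axioms subfieldE(1)[OF sK], of cs] by simp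
  have zE: "0 \<in> E" using subringE(2)[OF subfieldE(1)[OF sE]] by (simp add: class_ring_simps)
  have "coeff p i \<in> E" for i
    using csE zE p(1)
    by (cases "i \<le> Polynomial.degree p") (auto simp: cs_def coeffs_def coeff_eq_0 le_less)
  then have xE: "ring.algebraic class_ring E x"
    using p by (auto simp: algebraic_over_iff[OF sE])
  have fF: "ring.finite_dimension class_ring E (ring.simple_extension class_ring E x)"
    using domain.finite_dimension_simple_extension[OF class_field.domain_axioms sE, of x] xE by (simp add: over_def)
  have "ring.finite_dimension class_ring ?K (ring.simple_extension class_ring E x)"
    using ring.telescopic_base_dim(1)[OF class_ring.ring_axioms sK sE fE fF] .
  moreover have "subring (ring.simple_extension class_ring E x) ?R"
    using domain.simple_extension_is_subring[OF class_field.domain_axioms subfieldE(1)[OF sE], of x] by simp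
  moreover have "x \<in> ring.simple_extension class_ring E x"
    using ring.simple_extension_mem[OF class_ring.ring_axioms subfieldE(1)[OF sE], of x] by simp
  ultimately show "x \<in> acl S"
    unfolding acl_iff_algebraic using ring.finite_dimension_imp_algebraic[OF class_ring.ring_axioms sK] by (simp add: over_def)
qed

lemma aclI: "p \<noteq> 0 \<Longrightarrow> (\<And>i. coeff p i \<in> rgen S) \<Longrightarrow> poly p x = 0 \<Longrightarrow> x \<in> acl S"
  by (auto simp: acl_def)

lemma aclE:
  assumes "x \<in> acl S"
  obtains p where "p \<noteq> 0" "\<And>i. coeff p i \<in> rgen S" "poly p x = 0"
  using assms by (auto simp: acl_def)

lemma coeff_sum_monom: "finite I \<Longrightarrow> coeff (\<Sum>i\<in>I. monom (f i) i) j = (if j \<in> I then f j else 0)"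
  by (simp add: coeff_sum if_distrib cong: if_cong)

lemma poly_altdef_le:
  fixes x :: "'a::comm_semiring_1"
  shows "Polynomial.degree p \<le> m \<Longrightarrow> poly p x = (\<Sum>i\<le>m. coeff p i * x ^ i)"
  unfolding poly_altdef by (rule sum.mono_neutral_left) (auto simp: coeff_eq_0)

section \<open>Exchange property and independent lists\<close>

lemma rgen_insert:
  assumes "a \<in> rgen (insert x S)"
  shows "\<exists>P. (\<forall>i. coeff P i \<in> rgen S) \<and> poly P x = a"
  using assms
proof induction
  case one
  show ?case by (rule exI[of _ 1]) (auto simp: coeff_1 rgen_zero rgen.one)
next
  case (base y)
  then show ?case
    by (intro exI[of _ "if y = x then [:0, 1:] else [:y:]"])
       (auto simp: coeff_pCons rgen_zero intro: rgen.intros split: nat.split)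
next
  case (minus y)
  then obtain P where "\<forall>i. coeff P i \<in> rgen S" "poly P x = y" by blast
  then show ?case by (intro exI[of _ "- P"]) (auto intro: rgen.minus)
next
  case (add y z)
  then obtain P Q where "\<forall>i. coeff P i \<in> rgen S" "poly P x = y" "\<forall>i. coeff Q i \<in> rgen S" "poly Q x = z"
    by blast
  then show ?case by (intro exI[of _ "P + Q"]) (auto intro: rgen.add)
next
  case (mult y z)
  then obtain P Q where "\<forall>i. coeff P i \<in> rgen S" "poly P x = y" "\<forall>i. coeff Q i \<in> rgen S" "poly Q x = z"
    by blast
  then show ?case by (intro exI[of _ "P * Q"]) (auto simp: coeff_mult intro: rgen_sum rgen.mult)
qed

text \<open>The coefficients of an equation for \<open>y\<close> are polynomials in
  \<open>x\<close>, so the equation is a polynomial in two variables over \<open>rgen S\<close>.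
  Rearranged by powers of \<open>x\<close> it becomes an equation for \<open>x\<close>, and it stays
  nontrivial because \<open>y\<close> is transcendental over \<open>S\<close>.\<close>

lemma acl_exchange:
  assumes y: "y \<in> acl (insert x S)" and ny: "y \<notin> acl S"
  shows "x \<in> acl (insert y S)"
proof -
  obtain p where p: "p \<noteq> 0" "\<And>i. coeff p i \<in> rgen (insert x S)" "poly p y = 0"
    using aclE[OF y] by blast
  have "\<forall>i. \<exists>P. (\<forall>j. coeff P j \<in> rgen S) \<and> poly P x = coeff p i"
    using rgen_insert p(2) by blast
  then obtain P where P: "\<And>i j. coeff (P i) j \<in> rgen S" "\<And>i. poly (P i) x = coeff p i"
    by metis
  define n where "n = Polynomial.degree p"
  define m where "m = Max ((\<lambda>i. Polynomial.degree (P i)) ` {..n})"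
  have m: "Polynomial.degree (P i) \<le> m" if "i \<le> n" for i
    unfolding m_def using that by (intro Max_ge) auto
  \<comment> \<open>\<open>r j\<close> evaluated at \<open>y\<close> is the coefficient of the
    \<open>j\<close>-th power of \<open>x\<close>.\<close>
  define r where "r j = (\<Sum>i\<le>n. monom (coeff (P i) j) i)" for j
  define q where "q = (\<Sum>j\<le>m. monom (poly (r j) y) j)"
  have rS: "coeff (r j) i \<in> rgen S" for i j
    by (auto simp: r_def coeff_sum_monom P(1) rgen_zero)
  have "poly q x = (\<Sum>j\<le>m. \<Sum>i\<le>n. coeff (P i) j * y ^ i * x ^ j)"
    by (simp add: q_def r_def poly_sum poly_monom sum_distrib_right)
  also have "\<dots> = (\<Sum>i\<le>n. \<Sum>j\<le>m. coeff (P i) j * y ^ i * x ^ j)"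
    by (rule sum.swap)
  also have "\<dots> = (\<Sum>i\<le>n. coeff p i * y ^ i)"
  proof (rule sum.cong)
    fix i assume "i \<in> {..n}"
    then have "poly (P i) x = (\<Sum>j\<le>m. coeff (P i) j * x ^ j)"
      using m[of i] by (intro poly_altdef_le) simp
    then have "coeff p i = (\<Sum>j\<le>m. coeff (P i) j * x ^ j)" by (simp add: P(2))
    then show "(\<Sum>j\<le>m. coeff (P i) j * y ^ i * x ^ j) = coeff p i * y ^ i"
      by (simp add: sum_distrib_left mult_ac)
  qed simp
  also have "\<dots> = 0" using p(3) by (simp add: n_def poly_altdef)
  finally have qx: "poly q x = 0" .
  have "q \<noteq> 0"
  proof
    assume "q = 0"
    have "r j = 0" if "j \<le> m" for j
    proof (rule ccontr)
      assume "r j \<noteq> 0"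
      moreover have "poly (r j) y = coeff q j" using that by (simp add: q_def coeff_sum_monom)
      ultimately show False using ny aclI[of "r j" S y] rS \<open>q = 0\<close> by simp
    qed
    then have "coeff (P n) j = 0" for j
    proof (cases "j \<le> m")
      case True
      then have "coeff (r j) n = 0" using \<open>\<And>j. j \<le> m \<Longrightarrow> r j = 0\<close> by simp
      then show ?thesis by (simp add: r_def coeff_sum_monom)
    qed (use m[of n] in \<open>auto intro: coeff_eq_0\<close>)
    then have "P n = 0" by (simp add: poly_eq_iff)
    then show False using P(2)[of n] p(1) by (simp add: n_def)
  qed
  moreover have "coeff q j \<in> rgen (insert y S)" for j
  proof -
    have "poly (r j) y \<in> rgen (insert y S)" for j
      unfolding poly_altdef using rS[of j] rgen_mono[of S "insert y S"]
      by (intro rgen_sum rgen.mult rgen_power) (auto intro: rgen.base)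
    then show ?thesis by (auto simp: q_def coeff_sum_monom rgen_zero)
  qed
  ultimately show ?thesis using qx by (rule aclI)
qed

text \<open>Each entry is transcendental over \<open>C\<close> and the entries after it, which
  excludes repetitions; so the length of a list counts its elements, and a new element is put in
  front.\<close>

fun alg_indep :: "'a::field set \<Rightarrow> 'a list \<Rightarrow> bool" where
  "alg_indep C [] \<longleftrightarrow> True"
| "alg_indep C (v # vs) \<longleftrightarrow> v \<notin> acl (C \<union> set vs) \<and> alg_indep C vs"

text \<open>The elements of \<open>D\<close> are added to \<open>S\<close> one at a time. At the
  first step at which \<open>v\<close> becomes algebraic, the element just added can be exchanged
  with \<open>v\<close>.\<close>

lemma acl_finite_exchange:
  assumes "finite D" "v \<in> acl (S \<union> D)" "v \<notin> acl S"
  shows "\<exists>c\<in>D. c \<in> acl (insert v (S \<union> (D - {c})))"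
  using assms
proof (induction D arbitrary: S)
  case (insert d D)
  show ?case
  proof (cases "v \<in> acl (insert d S)")
    case True
    then have "d \<in> acl (insert v S)" using acl_exchange insert.prems by blast
    then show ?thesis using acl_mono[of "insert v S" "insert v (S \<union> (insert d D - {d}))"] by blast
  next
    case False
    then obtain c where c: "c \<in> D" "c \<in> acl (insert v (insert d S \<union> (D - {c})))"
      using insert.IH[of "insert d S"] insert.prems by auto
    moreover have "insert d S \<union> (D - {c}) = S \<union> (insert d D - {c})" using c insert.hyps by auto
    ultimately show ?thesis by auto
  qed
qed simp

text \<open>Steinitz exchange: every entry of \<open>vs\<close> replaces one element of the
  generating set \<open>B\<close>, and \<open>D\<close> is what is left of it. Comparing
  cardinalities bounds the length of \<open>vs\<close>.\<close>

lemma alg_indep_steinitz: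
  assumes "alg_indep C vs" "set vs \<subseteq> acl (C \<union> B)" "finite B"
  shows "\<exists>D\<subseteq>B. length vs + card D = card B \<and> B \<subseteq> acl (C \<union> (set vs \<union> D))"
  using assms
proof (induction vs)
  case Nil
  then show ?case using acl_base[of "C \<union> B"] by (intro exI[of _ B]) simp
next
  case (Cons v vs)
  then obtain D where D: "D \<subseteq> B" "length vs + card D = card B" "B \<subseteq> acl (C \<union> (set vs \<union> D))"
    by (metis alg_indep.simps(2) insert_subset list.simps(15))
  have fD: "finite D" using D(1) Cons.prems(3) finite_subset by blast
  have CB: "C \<union> B \<subseteq> acl (C \<union> (set vs \<union> D))" using D(3) acl_base by blast
  have "v \<in> acl (C \<union> set vs \<union> D)"
    using Cons.prems(2) acl_idem[OF CB] by (metis Un_assoc list.set_intros(1) subsetD)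
  then obtain c where c: "c \<in> D" "c \<in> acl (insert v (C \<union> set vs \<union> (D - {c})))"
    using acl_finite_exchange[OF fD, of v "C \<union> set vs"] Cons.prems(1) by (metis alg_indep.simps(2))
  let ?T = "C \<union> (set (v # vs) \<union> (D - {c}))"
  have "c \<in> acl ?T" using c(2) by (simp add: Un_assoc)
  moreover have "C \<union> (set vs \<union> (D - {c})) \<subseteq> acl ?T" using acl_base[of ?T] by (rule subset_trans[rotated]) auto
  ultimately have "C \<union> (set vs \<union> D) \<subseteq> acl ?T" using c(1) by blast
  then have "B \<subseteq> acl ?T" using D(3) acl_idem by blast
  moreover have "length (v # vs) + card (D - {c}) = card B"
    using D(2) card_Suc_Diff1[OF fD c(1)] by simp
  moreover have "D - {c} \<subseteq> B" using D(1) by blast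
  ultimately show ?case by blast
qed

lemma alg_indep_length_le:
  assumes "alg_indep C vs" "set vs \<subseteq> acl (C \<union> B)" "finite B"
  shows "length vs \<le> card B"
  using alg_indep_steinitz[OF assms] by auto

lemma alg_indep_length_le':
  assumes "alg_indep C vs" "set vs \<subseteq> acl (C \<union> set ws)"
  shows "length vs \<le> length ws"
  using alg_indep_length_le[OF assms] card_length[of ws] by simp

lemma alg_indep_extend:
  assumes "finite B" "alg_indep C vs"
  shows "\<exists>ws. set ws \<subseteq> B \<and> alg_indep C (ws @ vs) \<and> B \<subseteq> acl (C \<union> set (ws @ vs))"
  using assms(1)
proof induction
  case empty
  then show ?case using assms(2) by (intro exI[of _ "[]"]) simp
next
  case (insert b B)
  then obtain ws where ws: "set ws \<subseteq> B" "alg_indep C (ws @ vs)" "B \<subseteq> acl (C \<union> set (ws @ vs))"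
    by blast
  show ?case
  proof (cases "b \<in> acl (C \<union> set (ws @ vs))")
    case True
    then show ?thesis using ws by (intro exI[of _ ws]) auto
  next
    case False
    have "insert b B \<subseteq> acl (C \<union> set ((b # ws) @ vs))"
    proof -
      have "b \<in> acl (C \<union> set ((b # ws) @ vs))"
        using acl_base[of "C \<union> set ((b # ws) @ vs)"] by (rule subsetD) simp
      moreover have "acl (C \<union> set (ws @ vs)) \<subseteq> acl (C \<union> set ((b # ws) @ vs))"
        by (intro acl_mono) auto
      ultimately show ?thesis using ws(3) by blast
    qed
    moreover have "set (b # ws) \<subseteq> insert b B" "alg_indep C ((b # ws) @ vs)"
      using ws(1,2) False by simp_all blast
    ultimately show ?thesis by blast
  qed
qed

lemma alg_indep_basis:
  assumes "finite B"
  shows "\<exists>ws. set ws \<subseteq> B \<and> alg_indep C ws \<and> B \<subseteq> acl (C \<union> set ws)"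
  using alg_indep_extend[OF assms, of C "[]"] by simp

section \<open>Evaluation of polynomials in several variables\<close>

abbreviation mC :: "'k::field \<Rightarrow> 'k mpoly" where "mC \<equiv> Poly_Mapping.single 0"

definition mX :: "nat \<Rightarrow> 'k::field mpoly" where
  "mX i = Poly_Mapping.single (Poly_Mapping.single i 1) 1"

definition mon :: "(nat \<Rightarrow> 'r::comm_ring_1) \<Rightarrow> (nat \<Rightarrow>\<^sub>0 nat) \<Rightarrow> 'r" where
  "mon a \<mu> = (\<Prod>i\<in>Poly_Mapping.keys \<mu>. a i ^ Poly_Mapping.lookup \<mu> i)"

text \<open>The coefficient map and the target ring are arbitrary: the same evaluation serves for
  substitution of polynomials, for values in rational functions, for specialisation to the algebraic
  closure of \<open>k\<close> and for regarding a polynomial as univariate.\<close>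

definition meval :: "('k::comm_ring_1 \<Rightarrow> 'r::comm_ring_1) \<Rightarrow> (nat \<Rightarrow> 'r) \<Rightarrow> 'k mpoly \<Rightarrow> 'r" where
  "meval c a p = (\<Sum>\<mu>\<in>Poly_Mapping.keys p. c (Poly_Mapping.lookup p \<mu>) * mon a \<mu>)"

lemma mon_superset:
  assumes "finite I" "Poly_Mapping.keys \<mu> \<subseteq> I"
  shows "mon a \<mu> = (\<Prod>i\<in>I. a i ^ Poly_Mapping.lookup \<mu> i)"
  unfolding mon_def using assms by (intro prod.mono_neutral_left) (auto simp: in_keys_iff)

lemma mon_zero [simp]: "mon a 0 = 1"
  by (simp add: mon_def)

lemma mon_add: "mon a (\<mu> + \<nu>) = mon a \<mu> * mon a \<nu>"
proof -
  let ?I = "Poly_Mapping.keys \<mu> \<union> Poly_Mapping.keys \<nu>"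
  have "Poly_Mapping.keys (\<mu> + \<nu>) \<subseteq> ?I" by (rule keys_add)
  then show ?thesis
    using mon_superset[of ?I "\<mu> + \<nu>" a] mon_superset[of ?I \<mu> a] mon_superset[of ?I \<nu> a]
    by (simp add: lookup_add power_add prod.distrib)
qed

lemma mon_single [simp]: "mon a (Poly_Mapping.single i n) = a i ^ n"
  by (cases "n = 0") (simp_all add: mon_def)

lemma mpoly_sum_monomials:
  "p = (\<Sum>\<mu>\<in>Poly_Mapping.keys p. Poly_Mapping.single \<mu> (Poly_Mapping.lookup p \<mu>))"
proof (rule poly_mapping_eqI)
  fix k
  show "Poly_Mapping.lookup p k =
    Poly_Mapping.lookup (\<Sum>\<mu>\<in>Poly_Mapping.keys p. Poly_Mapping.single \<mu> (Poly_Mapping.lookup p \<mu>)) k"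
    by (simp add: lookup_sum lookup_single when_def in_keys_iff)
qed

lemma mon_mX: "mon mX \<mu> = (Poly_Mapping.single \<mu> 1 :: 'k::field mpoly)"
proof -
  have pw: "mX i ^ n = (Poly_Mapping.single (Poly_Mapping.single i n) 1 :: 'k mpoly)" for i n
    by (induction n) (simp_all add: mX_def mult_single flip: single_add)
  have "(\<Prod>i\<in>I. mX i ^ f i) = (Poly_Mapping.single (\<Sum>i\<in>I. Poly_Mapping.single i (f i)) 1 :: 'k mpoly)"
    if "finite I" for I f
    using that by induction (simp_all add: pw mult_single)
  then show ?thesis
    using mpoly_sum_monomials[of \<mu>] by (simp add: mon_def)
qed

context comm_ring_hom
begin

lemma meval_superset:
  assumes "finite K" "Poly_Mapping.keys p \<subseteq> K"
  shows "meval hom a p = (\<Sum>\<mu>\<in>K. hom (Poly_Mapping.lookup p \<mu>) * mon a \<mu>)"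
  unfolding meval_def using assms by (intro sum.mono_neutral_left) (auto simp: in_keys_iff)

lemma meval_zero [simp]: "meval hom a 0 = 0"
  by (simp add: meval_def)

lemma meval_single [simp]: "meval hom a (Poly_Mapping.single \<mu> k) = hom k * mon a \<mu>"
  by (cases "k = 0") (simp_all add: meval_def)

lemma meval_one [simp]: "meval hom a 1 = 1"
  unfolding single_one[symmetric] meval_single by simp

lemma meval_add: "meval hom a (p + q) = meval hom a p + meval hom a q"
proof -
  let ?K = "Poly_Mapping.keys p \<union> Poly_Mapping.keys q"
  have "Poly_Mapping.keys (p + q) \<subseteq> ?K" by (rule keys_add)
  then show ?thesis
    using meval_superset[of ?K "p + q" a] meval_superset[of ?K p a] meval_superset[of ?K q a]
    by (simp add: lookup_add hom_add sum.distrib ring_distribs)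
qed

lemma meval_sum: "meval hom a (sum f I) = (\<Sum>i\<in>I. meval hom a (f i))"
  by (induction I rule: infinite_finite_induct) (simp_all add: meval_add)

lemma meval_mult: "meval hom a (p * q) = meval hom a p * meval hom a q"
proof -
  have "meval hom a (Poly_Mapping.single \<mu> k * Poly_Mapping.single \<nu> l) =
     meval hom a (Poly_Mapping.single \<mu> k) * meval hom a (Poly_Mapping.single \<nu> l)" for \<mu> \<nu> k l
    by (simp add: mult_single mon_add hom_mult mult_ac)
  then have "meval hom a ((\<Sum>\<mu>\<in>A. Poly_Mapping.single \<mu> (f \<mu>)) * (\<Sum>\<nu>\<in>B. Poly_Mapping.single \<nu> (g \<nu>))) =
     meval hom a (\<Sum>\<mu>\<in>A. Poly_Mapping.single \<mu> (f \<mu>)) * meval hom a (\<Sum>\<nu>\<in>B. Poly_Mapping.single \<nu> (g \<nu>))"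
    for A B f g
    by (simp only: sum_product meval_sum)
  from this[where A = "Poly_Mapping.keys p" and f = "Poly_Mapping.lookup p"
      and B = "Poly_Mapping.keys q" and g = "Poly_Mapping.lookup q"]
  show ?thesis by (simp only: mpoly_sum_monomials[symmetric])
qed

lemma comm_ring_hom_meval: "comm_ring_hom (meval hom a)"
  by unfold_locales (simp_all add: meval_add meval_mult)

end

lemma meval_mX [simp]: "comm_ring_hom c \<Longrightarrow> meval c a (mX i) = a i"
proof -
  assume "comm_ring_hom c"
  then interpret comm_ring_hom c .
  show "meval c a (mX i) = a i" by (simp add: mX_def)
qed

lemma meval_mC [simp]: "comm_ring_hom c \<Longrightarrow> meval c a (mC k) = c k"
  by (simp add: comm_ring_hom.meval_single)

lemma comm_ring_hom_mC [simp]: "comm_ring_hom (mC :: 'k::field \<Rightarrow> _)"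
  by unfold_locales (simp_all add: single_add mult_single)

interpretation mC: comm_ring_hom "mC :: 'k::field \<Rightarrow> 'k mpoly"
  by (rule comm_ring_hom_mC)

lemma meval_mC_mX [simp]: "meval mC mX p = p"
proof -
  have "meval mC mX p = (\<Sum>\<mu>\<in>Poly_Mapping.keys p. Poly_Mapping.single \<mu> (Poly_Mapping.lookup p \<mu>))"
    by (simp add: meval_def mon_mX mult_single)
  then show ?thesis by (simp only: mpoly_sum_monomials[symmetric])
qed

lemma mon_closed:
  assumes "\<And>i. i \<in> Poly_Mapping.keys \<mu> \<Longrightarrow> a i \<in> R" "1 \<in> R"
    "\<And>x y. x \<in> R \<Longrightarrow> y \<in> R \<Longrightarrow> x * y \<in> R"
  shows "mon a \<mu> \<in> R"
proof -
  have pw: "x ^ n \<in> R" if "x \<in> R" for x n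
    using that by (induction n) (simp_all add: assms(2,3))
  have pr: "prod f I \<in> R" if "\<And>i. i \<in> I \<Longrightarrow> f i \<in> R" for I :: "nat set" and f
    using that by (induction I rule: infinite_finite_induct) (simp_all add: assms(2,3))
  show ?thesis unfolding mon_def by (intro pr pw assms(1))
qed

lemma meval_closed:
  assumes p: "p \<in> polys n" and a: "\<And>i. i < n \<Longrightarrow> a i \<in> R"
    and c: "\<And>k. c k \<in> R" and one: "1 \<in> R" and zero: "0 \<in> R"
    and add: "\<And>x y. x \<in> R \<Longrightarrow> y \<in> R \<Longrightarrow> x + y \<in> R"
    and mult: "\<And>x y. x \<in> R \<Longrightarrow> y \<in> R \<Longrightarrow> x * y \<in> R"
  shows "meval c a p \<in> R"
proof -
  have sm: "sum f I \<in> R" if "\<And>i. i \<in> I \<Longrightarrow> f i \<in> R" for I :: "(nat \<Rightarrow>\<^sub>0 nat) set" and f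
    using that by (induction I rule: infinite_finite_induct) (simp_all add: zero add)
  show ?thesis
    unfolding meval_def
  proof (intro sm mult c mon_closed one)
    fix \<mu> i assume "\<mu> \<in> Poly_Mapping.keys p" "i \<in> Poly_Mapping.keys \<mu>"
    then show "a i \<in> R" using p a unfolding polys_def by blast
  qed
qed

text \<open>The identity is the evaluation \<open>meval mC mX\<close>, so
  \<open>meval_closed\<close>, applied to the set of elements with the property, becomes an
  induction rule.\<close>

lemma polys_induct [consumes 1, case_names const var add mult]:
  assumes p: "p \<in> polys n"
    and "\<And>c. P (mC c)" "\<And>i. i < n \<Longrightarrow> P (mX i)"
    and "\<And>p q. P p \<Longrightarrow> P q \<Longrightarrow> P (p + q)" "\<And>p q. P p \<Longrightarrow> P q \<Longrightarrow> P (p * q)"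
  shows "P p"
proof -
  have "P 1" "P 0" using assms(2)[of 1] assms(2)[of 0] by simp_all
  then have "meval mC mX p \<in> Collect P"
    using assms(2-) by (intro meval_closed[OF p]) simp_all
  then show ?thesis by simp
qed

lemma polys_UNIV: "\<exists>n. p \<in> polys n"
proof -
  have "finite (\<Union>\<mu>\<in>Poly_Mapping.keys p. Poly_Mapping.keys \<mu>)" by simp
  then obtain n where "(\<Union>\<mu>\<in>Poly_Mapping.keys p. Poly_Mapping.keys \<mu>) \<subseteq> {..<n}"
    using finite_nat_iff_bounded by blast
  then have "p \<in> polys n" unfolding polys_def by blast
  then show ?thesis by blast
qed

lemma mpoly_induct [case_names const var add mult]:
  assumes "\<And>c. P (mC c)" "\<And>i. P (mX i)"
    and "\<And>p q. P p \<Longrightarrow> P q \<Longrightarrow> P (p + q)" "\<And>p q. P p \<Longrightarrow> P q \<Longrightarrow> P (p * q)"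
  shows "P p"
proof -
  obtain n where "p \<in> polys n" using polys_UNIV by blast
  then show ?thesis by (induction rule: polys_induct) (use assms in auto)
qed

lemma polys_mono: "m \<le> n \<Longrightarrow> polys m \<subseteq> polys n"
  unfolding polys_def by fastforce

lemma polys_mC [simp]: "mC c \<in> polys n"
  by (auto simp: polys_def)

lemma polys_mX [simp]: "mX i \<in> polys n \<longleftrightarrow> i < n"
  by (auto simp: polys_def mX_def)

lemma polys_zero [simp]: "0 \<in> polys n" and polys_one [simp]: "1 \<in> polys n"
  by (auto simp: polys_def)

lemma polys_add: "p \<in> polys n \<Longrightarrow> q \<in> polys n \<Longrightarrow> p + q \<in> polys n"
  using keys_add[of p q] unfolding polys_def by blast

lemma polys_uminus: "p \<in> polys n \<Longrightarrow> - p \<in> polys n"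
  by (simp add: polys_def)

lemma polys_mult: "p \<in> polys n \<Longrightarrow> q \<in> polys n \<Longrightarrow> p * q \<in> polys n"
proof -
  assume *: "p \<in> polys n" "q \<in> polys n"
  have "Poly_Mapping.keys \<mu> \<subseteq> {..<n}" if mu: "\<mu> \<in> Poly_Mapping.keys (p * q)" for \<mu>
  proof -
    obtain a b where "\<mu> = a + b" "a \<in> Poly_Mapping.keys p" "b \<in> Poly_Mapping.keys q"
      using mu keys_mult[of p q] by blast
    then show ?thesis using * keys_add[of a b] unfolding polys_def by blast
  qed
  then show ?thesis by (simp add: polys_def)
qed

lemma polys_sum: "(\<And>i. i \<in> I \<Longrightarrow> f i \<in> polys n) \<Longrightarrow> sum f I \<in> polys n"
  by (induction I rule: infinite_finite_induct) (auto intro: polys_add)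

lemma polys_prod: "(\<And>i. i \<in> I \<Longrightarrow> f i \<in> polys n) \<Longrightarrow> prod f I \<in> polys n"
  by (induction I rule: infinite_finite_induct) (auto intro: polys_mult)

lemma polys_power: "p \<in> polys n \<Longrightarrow> p ^ k \<in> polys n"
  by (induction k) (auto intro: polys_mult)

lemma meval_unique:
  assumes "comm_ring_hom F" "comm_ring_hom G"
    "\<And>c. F (mC c) = G (mC c)" "\<And>i. F (mX i) = G (mX i)"
  shows "F p = G p"
proof -
  interpret F: comm_ring_hom F by fact
  interpret G: comm_ring_hom G by fact
  show ?thesis
    by (induction p rule: mpoly_induct) (simp_all add: assms F.hom_add G.hom_add F.hom_mult G.hom_mult)
qed

lemma meval_unique_polys:
  assumes "comm_ring_hom F" "comm_ring_hom G" "p \<in> polys n"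
    "\<And>c. F (mC c) = G (mC c)" "\<And>i. i < n \<Longrightarrow> F (mX i) = G (mX i)"
  shows "F p = G p"
proof -
  interpret F: comm_ring_hom F by fact
  interpret G: comm_ring_hom G by fact
  show ?thesis
    using assms(3)
    by (induction rule: polys_induct) (simp_all add: assms(4,5) F.hom_add G.hom_add F.hom_mult G.hom_mult)
qed

lemma comm_ring_hom_compose:
  assumes "comm_ring_hom f" "comm_ring_hom g"
  shows "comm_ring_hom (\<lambda>x. g (f x))"
proof -
  interpret f: comm_ring_hom f by fact
  interpret g: comm_ring_hom g by fact
  show ?thesis by unfold_locales (simp_all add: f.hom_add g.hom_add f.hom_mult g.hom_mult)
qed

lemma comm_ring_hom_to_fract [simp]: "comm_ring_hom (to_fract :: 'a::idom \<Rightarrow> _)"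
  by unfold_locales (simp_all add: to_fract_add to_fract_mult)

lemma const_rf_to_fract: "const_rf c = to_fract (mC c)"
  by (simp add: const_rf_def to_fract_def)

lemma var_rf_to_fract: "var_rf i = to_fract (mX i)"
  by (simp add: var_rf_def to_fract_def mX_def)

lemma comm_ring_hom_const_rf [simp]: "comm_ring_hom (const_rf :: 'k::field \<Rightarrow> _)"
  unfolding const_rf_to_fract[abs_def]
  by (rule comm_ring_hom_compose[OF comm_ring_hom_mC comm_ring_hom_to_fract])

interpretation const_rf: field_hom "const_rf :: 'k::field \<Rightarrow> 'k ratfun"
proof -
  interpret comm_ring_hom "const_rf :: 'k \<Rightarrow> 'k ratfun" by simp
  show "field_hom (const_rf :: 'k \<Rightarrow> 'k ratfun)" ..
qed

lemma poly_eval_meval: "poly_eval a p = meval const_rf (($) a) p"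
  by (simp add: poly_eval_def meval_def mon_def)

section \<open>Rational functions and their specialisations\<close>

abbreviation consts_rf :: "'k::field ratfun set" where "consts_rf \<equiv> range const_rf"

text \<open>Extends a ring homomorphism from polynomials to the fractions in \<open>lring\<close>,
  the local ring at its kernel. \<open>ratfun_eval\<close> is the case of a substitution; the group
  action \<open>act\<close> and the specialisations below are others.\<close>

definition fext :: "('k::field mpoly \<Rightarrow> 'l::field) \<Rightarrow> 'k ratfun \<Rightarrow> 'l" where
  "fext s r = (THE v. \<exists>a b. r = Fract a b \<and> b \<noteq> 0 \<and> s b \<noteq> 0 \<and> v = s a / s b)"

definition lring :: "('k::field mpoly \<Rightarrow> 'l::field) \<Rightarrow> 'k ratfun set" where
  "lring s = {Fract a b | a b. s b \<noteq> 0}"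

lemma ratfun_eval_fext: "ratfun_eval a = fext (poly_eval a)"
  by (simp add: ratfun_eval_def fext_def fun_eq_iff)

lemma fext_Fract:
  assumes "comm_ring_hom s" "s b \<noteq> 0"
  shows "fext s (Fract a b) = s a / s b"
proof -
  interpret comm_ring_hom s by fact
  have b: "b \<noteq> 0" using assms(2) by auto
  show ?thesis
    unfolding fext_def
  proof (rule the_equality)
    fix v assume "\<exists>a' b'. Fract a b = Fract a' b' \<and> b' \<noteq> 0 \<and> s b' \<noteq> 0 \<and> v = s a' / s b'"
    then obtain a' b' where *: "Fract a b = Fract a' b'" "b' \<noteq> 0" "s b' \<noteq> 0" "v = s a' / s b'" by blast
    then have "a * b' = a' * b" using b by (simp add: eq_fract)
    then have "s a * s b' = s a' * s b" by (metis hom_mult)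
    then show "v = s a / s b" using * assms(2) by (simp add: frac_eq_eq)
  qed (use assms b in blast)
qed

lemma lring_cases:
  assumes "r \<in> lring s" "comm_ring_hom s"
  obtains a b where "r = Fract a b" "b \<noteq> 0" "s b \<noteq> 0" "fext s r = s a / s b"
proof -
  interpret comm_ring_hom s by fact
  obtain a b where "r = Fract a b" "s b \<noteq> 0" using assms(1) by (auto simp: lring_def)
  moreover from this have "b \<noteq> 0" by auto
  ultimately show ?thesis using that fext_Fract[OF assms(2)] by blast
qed

lemma
  assumes s: "comm_ring_hom s" and x: "x \<in> lring s" and y: "y \<in> lring s"
  shows lring_add: "x + y \<in> lring s" and fext_add: "fext s (x + y) = fext s x + fext s y"
    and lring_mult: "x * y \<in> lring s" and fext_mult: "fext s (x * y) = fext s x * fext s y"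
proof -
  interpret comm_ring_hom s by fact
  obtain a b where a: "x = Fract a b" "b \<noteq> 0" "s b \<noteq> 0" "fext s x = s a / s b"
    using lring_cases[OF x s] by blast
  obtain c d where c: "y = Fract c d" "d \<noteq> 0" "s d \<noteq> 0" "fext s y = s c / s d"
    using lring_cases[OF y s] by blast
  have p: "x + y = Fract (a * d + c * b) (b * d)" "x * y = Fract (a * c) (b * d)"
    using a c by simp_all
  have n: "s (b * d) \<noteq> 0" using a c by (simp add: hom_mult)
  show "x + y \<in> lring s" "x * y \<in> lring s"
    unfolding p lring_def using n by blast+
  show "fext s (x + y) = fext s x + fext s y" "fext s (x * y) = fext s x * fext s y"
    unfolding p fext_Fract[OF s n] unfolding a(4) c(4) using a(3) c(3)
    by (simp_all add: hom_mult hom_add field_simps)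
qed

lemma
  assumes s: "comm_ring_hom s" and x: "x \<in> lring s"
  shows lring_uminus: "- x \<in> lring s" and fext_uminus: "fext s (- x) = - fext s x"
proof -
  interpret comm_ring_hom s by fact
  obtain a b where a: "x = Fract a b" "b \<noteq> 0" "s b \<noteq> 0" "fext s x = s a / s b"
    using lring_cases[OF x s] by blast
  have p: "- x = Fract (- a) b" using a by simp
  show "- x \<in> lring s" unfolding p lring_def using a(3) by blast
  show "fext s (- x) = - fext s x"
    unfolding p fext_Fract[OF s a(3)] a(4) by (simp add: hom_uminus)
qed

lemma lring_to_fract: "comm_ring_hom s \<Longrightarrow> to_fract p \<in> lring s"
  and fext_to_fract: "comm_ring_hom s \<Longrightarrow> fext s (to_fract p) = s p"
proof -
  assume s: "comm_ring_hom s"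
  interpret comm_ring_hom s by fact
  show "to_fract p \<in> lring s"
    unfolding lring_def to_fract_def by (rule CollectI, rule exI[of _ p], rule exI[of _ 1]) simp
  show "fext s (to_fract p) = s p" using fext_Fract[OF s, of 1 p] by (simp add: to_fract_def)
qed

text \<open>The reason why every relation among the \<open>f i\<close> persists among their
  specialised values.\<close>

lemma fext_meval:
  assumes s: "comm_ring_hom s" and f: "\<And>i. i < m \<Longrightarrow> f i \<in> lring s" and p: "p \<in> polys m"
  shows "meval const_rf f p \<in> lring s \<and>
    fext s (meval const_rf f p) = meval (\<lambda>k. s (mC k)) (\<lambda>i. fext s (f i)) p"
proof -
  interpret sC: comm_ring_hom "\<lambda>k. s (mC k)" by (rule comm_ring_hom_compose[OF comm_ring_hom_mC s])
  note sc = sC.comm_ring_hom_axioms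
  show ?thesis
    using p
  proof (induction rule: polys_induct)
    case (const c)
    show ?case
      using lring_to_fract[OF s, of "mC c"] fext_to_fract[OF s, of "mC c"] sc
      by (simp flip: const_rf_to_fract)
  next
    case (var i)
    then show ?case using f sc by simp
  next
    case (add p q)
    then show ?case
      using s by (simp add: const_rf.meval_add sC.meval_add lring_add fext_add)
  next
    case (mult p q)
    then show ?case
      using s by (simp add: const_rf.meval_mult sC.meval_mult lring_mult fext_mult)
  qed
qed

lemma rgen_hom_image:
  assumes h: "comm_ring_hom h" and y: "y \<in> rgen (h ` S)"
  shows "\<exists>x\<in>rgen S. y = h x"
proof -
  interpret comm_ring_hom h by fact
  show ?thesis using y
  proof induction
    case one
    show ?case by (rule bexI[of _ 1]) (simp_all add: rgen.one)
  next
    case (base x) then show ?case by (auto intro: rgen.base)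
  next
    case (minus x) then show ?case by (metis hom_uminus rgen.minus)
  next
    case (add x y) then show ?case by (metis hom_add rgen.add)
  next
    case (mult x y) then show ?case by (metis hom_mult rgen.mult)
  qed
qed

lemma rgen_fext_image:
  assumes s: "comm_ring_hom s" and S: "S \<subseteq> lring s" and x: "x \<in> rgen S"
  shows "x \<in> lring s \<and> fext s x \<in> rgen (fext s ` S)"
  using x
proof induction
  case one
  interpret comm_ring_hom s by fact
  show ?case using lring_to_fract[OF s, of 1] fext_to_fract[OF s, of 1] by (simp add: rgen.one)
next
  case (base x) then show ?case using S by (auto intro: rgen.base)
next
  case (minus x) then show ?case using s by (simp add: lring_uminus fext_uminus rgen.minus)
next
  case (add x y) then show ?case using s by (simp add: lring_add fext_add rgen.add)
next
  case (mult x y) then show ?case using s by (simp add: lring_mult fext_mult rgen.mult)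
qed

lemma ratfuns_iff: "r \<in> ratfuns n \<longleftrightarrow> (\<exists>a b. a \<in> polys n \<and> b \<in> polys n \<and> b \<noteq> 0 \<and> r = Fract a b)"
  by (auto simp: ratfuns_def)

lemma ratfuns_to_fract: "p \<in> polys n \<Longrightarrow> to_fract p \<in> ratfuns n"
  unfolding ratfuns_iff to_fract_def by (rule exI[of _ p], rule exI[of _ 1]) simp

lemma ratfuns_const [simp]: "const_rf c \<in> ratfuns n"
  by (simp add: const_rf_to_fract ratfuns_to_fract)

lemma ratfuns_var [simp]: "i < n \<Longrightarrow> var_rf i \<in> ratfuns n"
  by (simp add: var_rf_to_fract ratfuns_to_fract)

lemma
  assumes x: "x \<in> ratfuns n" and y: "y \<in> ratfuns n"
  shows ratfuns_add: "x + y \<in> ratfuns n" and ratfuns_mult: "x * y \<in> ratfuns n"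
proof -
  obtain a b where a: "x = Fract a b" "b \<noteq> 0" "a \<in> polys n" "b \<in> polys n" using x by (auto simp: ratfuns_iff)
  obtain c d where c: "y = Fract c d" "d \<noteq> 0" "c \<in> polys n" "d \<in> polys n" using y by (auto simp: ratfuns_iff)
  have "x + y = Fract (a * d + c * b) (b * d)" "x * y = Fract (a * c) (b * d)"
    using a c by simp_all
  then show "x + y \<in> ratfuns n" "x * y \<in> ratfuns n"
    unfolding ratfuns_iff using a c
    by (metis polys_add polys_mult mult_eq_0_iff, metis polys_mult mult_eq_0_iff)
qed

lemma
  assumes x: "x \<in> ratfuns n"
  shows ratfuns_uminus: "- x \<in> ratfuns n" and ratfuns_inverse: "inverse x \<in> ratfuns n"
proof -
  obtain a b where a: "x = Fract a b" "b \<noteq> 0" "a \<in> polys n" "b \<in> polys n" using x by (auto simp: ratfuns_iff)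
  have "- x = Fract (- a) b" using a by simp
  then show "- x \<in> ratfuns n" unfolding ratfuns_iff using a by (metis polys_uminus)
  show "inverse x \<in> ratfuns n"
  proof (cases "a = 0")
    case True
    then show ?thesis using x a(1) by (simp add: fract_collapse)
  next
    case False
    then show ?thesis unfolding ratfuns_iff a(1) inverse_fract using a by blast
  qed
qed

lemma ratfuns_zero [simp]: "0 \<in> ratfuns n" and ratfuns_one [simp]: "1 \<in> ratfuns n"
  using ratfuns_const[of 0 n] ratfuns_const[of 1 n] by simp_all

lemma ratfuns_divide: "x \<in> ratfuns n \<Longrightarrow> y \<in> ratfuns n \<Longrightarrow> x / y \<in> ratfuns n"
  unfolding divide_inverse by (blast intro: ratfuns_mult ratfuns_inverse)

lemma ratfuns_prod: "(\<And>i. i \<in> I \<Longrightarrow> f i \<in> ratfuns n) \<Longrightarrow> prod f I \<in> ratfuns n"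
  by (induction I rule: infinite_finite_induct) (simp_all add: ratfuns_mult)

lemma ratfuns_power: "x \<in> ratfuns n \<Longrightarrow> x ^ k \<in> ratfuns n"
  by (induction k) (simp_all add: ratfuns_mult)

lemma rgen_ratfuns: "S \<subseteq> ratfuns n \<Longrightarrow> rgen S \<subseteq> ratfuns n"
  by (rule rgen_least) (auto intro: ratfuns_add ratfuns_mult ratfuns_uminus)

lemma ratfuns_subset_acl: "(ratfuns n :: 'k::field ratfun set) \<subseteq> acl (consts_rf \<union> var_rf ` {..<n})"
proof
  fix r :: "'k ratfun" assume "r \<in> ratfuns n"
  then obtain a b where ab: "a \<in> polys n" "b \<in> polys n" "b \<noteq> 0" "r = Fract a b" by (auto simp: ratfuns_iff)
  have "to_fract p \<in> acl (consts_rf \<union> var_rf ` {..<n})" if "p \<in> polys n" for p :: "'k mpoly"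
    using that
  proof (induction rule: polys_induct)
    case (const c) then show ?case
      using acl_base[of "consts_rf \<union> var_rf ` {..<n}"] by (auto simp flip: const_rf_to_fract)
  next
    case (var i) then show ?case
      using acl_base[of "consts_rf \<union> var_rf ` {..<n}"] by (auto simp flip: var_rf_to_fract)
  qed (simp_all add: to_fract_add to_fract_mult acl_add acl_mult)
  then show "r \<in> acl (consts_rf \<union> var_rf ` {..<n})"
    using ab by (simp add: Fract_conv_to_fract acl_divide)
qed

lemma common_denominator:
  assumes "finite F" "F \<subseteq> ratfuns n"
  shows "\<exists>b. b \<in> polys n \<and> b \<noteq> 0 \<and> (\<forall>r\<in>F. \<exists>a\<in>polys n. r = Fract a b)"
  using assms
proof induction
  case empty
  then show ?case by (intro exI[of _ 1]) simp
next
  case (insert r F)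
  then obtain b where b: "b \<in> polys n" "b \<noteq> 0" "\<forall>r\<in>F. \<exists>a\<in>polys n. r = Fract a b" by blast
  obtain c d where cd: "r = Fract c d" "c \<in> polys n" "d \<in> polys n" "d \<noteq> 0"
    using insert.prems by (auto simp: ratfuns_iff)
  have "\<exists>a\<in>polys n. q = Fract a (b * d)" if q: "q \<in> insert r F" for q
  proof (cases "q = r")
    case True
    then have "q = Fract (b * c) (b * d)" using cd b(2) by (simp add: eq_fract)
    then show ?thesis using polys_mult[OF b(1) cd(2)] by blast
  next
    case False
    then obtain a where "a \<in> polys n" "q = Fract a b" using q b(3) by blast
    then have "q = Fract (a * d) (b * d)" "a * d \<in> polys n"
      using cd b(2) by (simp_all add: eq_fract polys_mult)
    then show ?thesis by blast
  qed
  then show ?case using b cd by (intro exI[of _ "b * d"]) (auto intro: polys_mult)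
qed

section \<open>Independence of the variables\<close>

lemma comm_ring_hom_map_poly:
  assumes "comm_ring_hom h"
  shows "comm_ring_hom (map_poly h)"
proof -
  interpret h: comm_ring_hom h by fact
  show ?thesis
    by unfold_locales
       (simp_all add: poly_eq_iff coeff_map_poly coeff_mult h.hom_add h.hom_mult h.hom_sum)
qed

lemma comm_ring_hom_poly [simp]: "comm_ring_hom (\<lambda>p. poly p x)"
  by unfold_locales simp_all

lemma comm_ring_hom_pCons: "comm_ring_hom h \<Longrightarrow> comm_ring_hom (\<lambda>k. [:h k:])"
proof -
  assume "comm_ring_hom h"
  then interpret comm_ring_hom h .
  show ?thesis by unfold_locales (simp_all add: hom_add hom_mult one_pCons)
qed

text \<open>The polynomial ring regarded as univariate in \<open>x_j\<close>. The coefficients stay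
  in the ring of all variables, so evaluating at \<open>mX j\<close> gives back the
  polynomial.\<close>

definition single_out :: "nat \<Rightarrow> 'k::field mpoly \<Rightarrow> 'k mpoly poly" where
  "single_out j = meval (\<lambda>k. [:mC k:]) (\<lambda>i. if i = j then [:0, 1:] else [:mX i:])"

lemma comm_ring_hom_single_out [simp]: "comm_ring_hom (single_out j)"
  unfolding single_out_def
  by (intro comm_ring_hom.comm_ring_hom_meval comm_ring_hom_pCons comm_ring_hom_mC)

lemma single_out_mC [simp]: "single_out j (mC k) = [:mC k:]"
  and single_out_mX: "single_out j (mX i) = (if i = j then [:0, 1:] else [:mX i:])"
  unfolding single_out_def by (simp_all add: comm_ring_hom_pCons)

lemma poly_single_out: "poly (single_out j p) w = meval mC (\<lambda>i. if i = j then w else mX i) p"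
  by (rule meval_unique[of "\<lambda>p. poly (single_out j p) w"])
     (simp_all add: comm_ring_hom_compose[OF comm_ring_hom_single_out comm_ring_hom_poly]
        single_out_mX mC.comm_ring_hom_meval)

lemma single_out_eq_0_iff: "single_out j (p :: 'a::field mpoly) = 0 \<longleftrightarrow> p = 0"
proof
  have "(\<lambda>i. if i = j then mX j else mX i) = (mX :: nat \<Rightarrow> 'a mpoly)" by auto
  then have "poly (single_out j p) (mX j) = p" unfolding poly_single_out by simp
  then show "single_out j p = 0 \<Longrightarrow> p = 0" by auto
next
  interpret comm_ring_hom "single_out j :: 'a mpoly \<Rightarrow> _" by simp
  show "p = 0 \<Longrightarrow> single_out j p = 0" by simp
qed

text \<open>Coefficients that involve only the other variables become constant under
  \<open>single_out j\<close>, while \<open>x_j\<close> becomes the indeterminate. An equation for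
  \<open>x_j\<close> over them therefore has vanishing leading coefficient.\<close>

lemma var_rf_not_acl: "(var_rf j :: 'k::field ratfun) \<notin> acl (consts_rf \<union> var_rf ` (- {j}))"
proof
  assume "(var_rf j :: 'k ratfun) \<in> acl (consts_rf \<union> var_rf ` (- {j}))"
  then obtain p where p: "p \<noteq> 0" "\<And>i. coeff p i \<in> rgen (consts_rf \<union> var_rf ` (- {j}))"
      "poly p (var_rf j :: 'k ratfun) = 0"
    by (auto elim: aclE)
  interpret so: comm_ring_hom "single_out j :: 'k mpoly \<Rightarrow> _" by simp
  let ?S = "range mC \<union> mX ` (- {j}) :: 'k mpoly set"
  have S: "consts_rf \<union> var_rf ` (- {j}) = to_fract ` ?S"
    by (auto simp: const_rf_to_fract var_rf_to_fract image_iff)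
  have "\<forall>i. \<exists>q\<in>rgen ?S. coeff p i = to_fract q"
    using rgen_hom_image[OF comm_ring_hom_to_fract] p(2) unfolding S by blast
  then obtain q where q: "\<And>i. q i \<in> rgen ?S" "\<And>i. coeff p i = to_fract (q i)" by metis
  have so: "single_out j r = [:r:]" if "r \<in> rgen ?S" for r
    using that
    by induction (auto simp: single_out_mX so.hom_add so.hom_mult so.hom_uminus one_pCons split: if_splits)
  let ?n = "Polynomial.degree p"
  interpret tf: comm_ring_hom "to_fract :: 'k mpoly \<Rightarrow> _" by simp
  have "to_fract (\<Sum>i\<le>?n. q i * mX j ^ i) = poly p (var_rf j)"
    by (simp add: poly_altdef q(2) var_rf_to_fract tf.hom_sum tf.hom_mult tf.hom_power)
  then have "(\<Sum>i\<le>?n. q i * mX j ^ i) = 0" using p(3) by (simp only: to_fract_eq_0_iff)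
  then have "0 = single_out j (\<Sum>i\<le>?n. q i * mX j ^ i)" by simp
  also have "\<dots> = (\<Sum>i\<le>?n. monom (q i) i)"
    by (simp add: so.hom_sum so.hom_mult so.hom_power so[OF q(1)] single_out_mX)
       (simp add: monom_altdef)
  finally have "coeff (\<Sum>i\<le>?n. monom (q i) i) ?n = 0" by (metis coeff_0)
  then have "q ?n = 0" by (simp add: coeff_sum_monom)
  then show False using p(1) q(2)[of ?n] by simp
qed

lemma alg_indep_vars: "distinct js \<Longrightarrow> alg_indep consts_rf (map var_rf js)"
proof (induction js)
  case (Cons j js)
  have "acl (consts_rf \<union> var_rf ` set js) \<subseteq> acl (consts_rf \<union> var_rf ` (- {j}))"
    using Cons.prems by (intro acl_mono) auto
  then show ?case using Cons var_rf_not_acl[of j] by auto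
qed simp

section \<open>Krull dimension of the image and transcendence degree\<close>

lemma poly_ring_simps [simp]:
  "carrier (poly_ring n) = polys n" "p \<otimes>\<^bsub>poly_ring n\<^esub> q = p * q" "\<one>\<^bsub>poly_ring n\<^esub> = 1"
  "\<zero>\<^bsub>poly_ring n\<^esub> = 0" "p \<oplus>\<^bsub>poly_ring n\<^esub> q = p + q"
  by (simp_all add: poly_ring_def)

lemma cring_poly_ring: "cring (poly_ring n :: 'k::field mpoly ring)"
proof (rule cringI)
  show "abelian_group (poly_ring n :: 'k mpoly ring)"
  proof (rule abelian_groupI)
    fix x :: "'k mpoly" assume "x \<in> carrier (poly_ring n)"
    then show "\<exists>y\<in>carrier (poly_ring n). y \<oplus>\<^bsub>poly_ring n\<^esub> x = \<zero>\<^bsub>poly_ring n\<^esub>"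
      by (intro bexI[of _ "- x"]) (simp_all add: polys_uminus)
  qed (simp_all add: polys_add ac_simps)
  show "comm_monoid (poly_ring n :: 'k mpoly ring)"
    by (rule comm_monoidI) (simp_all add: polys_mult ac_simps)
qed (simp add: ring_distribs)

lemma a_inv_poly_ring:
  assumes "p \<in> polys n" shows "\<ominus>\<^bsub>poly_ring n\<^esub> p = - p"
proof -
  interpret cring "poly_ring n :: 'a mpoly ring" by (rule cring_poly_ring)
  show ?thesis using assms by (intro minus_equality) (simp_all add: polys_uminus)
qed

lemma primeideal_poly_ringI:
  fixes P :: "'k::field mpoly set"
  assumes sub: "P \<subseteq> polys n" and zero: "0 \<in> P" and one: "1 \<notin> P"
    and add: "\<And>a b. a \<in> P \<Longrightarrow> b \<in> P \<Longrightarrow> a + b \<in> P"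
    and mult: "\<And>a x. a \<in> P \<Longrightarrow> x \<in> polys n \<Longrightarrow> x * a \<in> P"
    and prime: "\<And>a b. a \<in> polys n \<Longrightarrow> b \<in> polys n \<Longrightarrow> a * b \<in> P \<Longrightarrow> a \<in> P \<or> b \<in> P"
  shows "primeideal P (poly_ring n)"
proof -
  interpret cring "poly_ring n :: 'k mpoly ring" by (rule cring_poly_ring)
  have "ideal P (poly_ring n)"
  proof (rule idealI)
    show "subgroup P (add_monoid (poly_ring n))"
    proof (rule add.subgroupI)
      show "\<ominus>\<^bsub>poly_ring n\<^esub> a \<in> P" if "a \<in> P" for a
        using mult[OF that polys_uminus[OF polys_one]] that sub by (auto simp: a_inv_poly_ring)
    qed (use assms in auto)
  qed (use mult ring_axioms in \<open>auto simp: mult.commute\<close>)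
  then show ?thesis
    by (rule primeidealI[OF _ cring_poly_ring]) (use one prime in auto)
qed

lemma primeideal_poly_ringD:
  fixes P :: "'k::field mpoly set"
  assumes "primeideal P (poly_ring n)"
  shows "P \<subseteq> polys n" "0 \<in> P" "1 \<notin> P" "\<And>a b. a \<in> P \<Longrightarrow> b \<in> P \<Longrightarrow> a + b \<in> P"
    "\<And>a. a \<in> P \<Longrightarrow> - a \<in> P"
    "\<And>a x. a \<in> P \<Longrightarrow> x \<in> polys n \<Longrightarrow> x * a \<in> P"
    "\<And>a b. a \<in> polys n \<Longrightarrow> b \<in> polys n \<Longrightarrow> a * b \<in> P \<Longrightarrow> a \<in> P \<or> b \<in> P"
proof -
  interpret primeideal P "poly_ring n" by fact
  show sub: "P \<subseteq> polys n" using a_subset by simp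
  show "0 \<in> P" using additive_subgroup.zero_closed[OF additive_subgroup_axioms] by simp
  show "1 \<notin> P" using I_notcarr one_imp_carrier by auto
  show "\<And>a b. a \<in> P \<Longrightarrow> b \<in> P \<Longrightarrow> a + b \<in> P" using additive_subgroup.a_closed[OF additive_subgroup_axioms] by simp
  show m: "\<And>a x. a \<in> P \<Longrightarrow> x \<in> polys n \<Longrightarrow> x * a \<in> P" using I_l_closed by simp
  show "\<And>a. a \<in> P \<Longrightarrow> - a \<in> P" using m[OF _ polys_uminus[OF polys_one]] by simp
  show "\<And>a b. a \<in> polys n \<Longrightarrow> b \<in> polys n \<Longrightarrow> a * b \<in> P \<Longrightarrow> a \<in> P \<or> b \<in> P"
    using I_prime by simp
qed

section \<open>The ideal of the closure of the image\<close>

definition hom_kernel :: "nat \<Rightarrow> ('k::field mpoly \<Rightarrow> 'r::zero) \<Rightarrow> 'k mpoly set" where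
  "hom_kernel m h = {p \<in> polys m. h p = 0}"

lemma primeideal_hom_kernel:
  fixes h :: "'k::field mpoly \<Rightarrow> 'r::idom"
  assumes "comm_ring_hom h"
  shows "primeideal (hom_kernel m h) (poly_ring m)"
proof -
  interpret comm_ring_hom h by fact
  show ?thesis
    by (rule primeideal_poly_ringI) (auto simp: hom_kernel_def hom_add hom_mult polys_add polys_mult)
qed

text \<open>The prime ideal of the closure of the image; the dimension of the image depends on it
  alone.\<close>

abbreviation relations :: "nat \<Rightarrow> (nat \<Rightarrow> 'k::field ratfun) \<Rightarrow> 'k mpoly set" where
  "relations m f \<equiv> hom_kernel m (meval const_rf f)"

definition prime_chain :: "nat \<Rightarrow> nat \<Rightarrow> (nat \<Rightarrow> 'k::field mpoly set) \<Rightarrow> bool" where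
  "prime_chain m r c \<longleftrightarrow> (\<forall>i\<le>r. primeideal (c i) (poly_ring m)) \<and> (\<forall>i<r. c i \<subset> c (Suc i))"

text \<open>The generic point, the zero ideal of the source, lies in the domain of every rational
  map, and its image is the ideal of relations. The image of any other point contains this ideal, so
  the intersection over the whole image is the ideal of relations.\<close>

lemma zariski_closure_map_image:
  assumes "rational_map n m (f :: 'k::field ratfun vec)"
  shows "zariski_closure m (map_image n m f) = {P. primeideal P (poly_ring m) \<and> relations m (($) f) \<subseteq> P}"
proof -
  have zp: "primeideal {0 :: 'k mpoly} (poly_ring n)"
    by (rule primeideal_poly_ringI) auto
  let ?I = "relations m (($) f)"
  have ev: "poly_eval f = meval const_rf (($) f)" by (simp add: poly_eval_meval fun_eq_iff)
  have reg: "\<forall>i<m. f $ i \<in> local_ring n {0}"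
    using assms by (fastforce simp: rational_map_def ratfuns_def local_ring_def)
  have "\<Inter>(map_image n m f) = ?I"
  proof
    have "{p \<in> polys m. poly_eval f p \<in> local_max_ideal n {0}} \<in> map_image n m f"
      unfolding map_image_def using zp reg by (auto simp: affine_space_def)
    moreover have "{p \<in> polys m. poly_eval f p \<in> local_max_ideal n {0}} \<subseteq> ?I"
      by (auto simp: local_max_ideal_def hom_kernel_def ev fract_collapse)
    ultimately show "\<Inter>(map_image n m f) \<subseteq> ?I" by blast
  next
    show "?I \<subseteq> \<Inter>(map_image n m f)"
    proof (rule Inter_greatest)
      fix Y assume "Y \<in> map_image n m f"
      then obtain P where P: "P \<in> affine_space n" "Y = {p \<in> polys m. poly_eval f p \<in> local_max_ideal n P}"
        by (auto simp: map_image_def)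
      then have "0 \<in> P" "1 \<notin> P" using primeideal_poly_ringD(2,3) by (auto simp: affine_space_def)
      then have "0 \<in> local_max_ideal n P"
        unfolding local_max_ideal_def by (intro CollectI exI[of _ 0] exI[of _ 1]) (simp add: fract_collapse)
      then show "?I \<subseteq> Y" using P(2) by (auto simp: hom_kernel_def ev)
    qed
  qed
  then show ?thesis by (auto simp: zariski_closure_def affine_space_def)
qed

text \<open>Modulo \<open>c\<close> only the term \<open>P 0\<close> is left, so it lies in
  \<open>B\<close> and in \<open>c\<close>, hence in \<open>I\<close> and in \<open>c'\<close>.
  After subtracting it, a factor \<open>q\<close> can be cancelled modulo the prime
  \<open>c'\<close>, and the other coefficients follow by induction.\<close>

lemma coeffs_in_prime:
  assumes c: "primeideal c (poly_ring m)" and c': "primeideal c' (poly_ring m)"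
    and q: "q \<in> c" "q \<notin> c'" and sub: "I \<subseteq> c'" "c' \<subseteq> c"
    and B: "B \<subseteq> polys m" "B \<inter> c \<subseteq> I"
  shows "(\<And>j. j \<le> n \<Longrightarrow> P j \<in> B) \<Longrightarrow> (\<Sum>j\<le>n. P j * q ^ j) \<in> c' \<Longrightarrow> j \<le> n \<Longrightarrow> P j \<in> I"
proof (induction n arbitrary: P j)
  case 0
  then show ?case using sub B by auto
next
  case (Suc n)
  note D = primeideal_poly_ringD[OF c] and D' = primeideal_poly_ringD[OF c']
  let ?t = "\<Sum>j\<le>n. P (Suc j) * q ^ j"
  have qm: "q \<in> polys m" using q D(1) by blast
  have tm: "?t \<in> polys m" using Suc.prems(1) B(1) qm by (intro polys_sum polys_mult polys_power) auto
  have eq: "(\<Sum>j\<le>Suc n. P j * q ^ j) = P 0 + ?t * q"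
    unfolding sum.atMost_Suc_shift by (simp add: sum_distrib_left sum_distrib_right mult_ac)
  have "P 0 + ?t * q \<in> c" using Suc.prems(2) sub unfolding eq by blast
  moreover have "- (?t * q) \<in> c" using D(5,6) q tm by blast
  ultimately have "P 0 + ?t * q + - (?t * q) \<in> c" by (rule D(4))
  then have P0: "P 0 \<in> I" using Suc.prems(1)[of 0] B by auto
  then have "- P 0 \<in> c'" using D'(5) sub by blast
  with Suc.prems(2) have "P 0 + ?t * q + - P 0 \<in> c'" unfolding eq by (rule D'(4))
  then have "?t * q \<in> c'" by simp
  then have "?t \<in> c'" using D'(7)[OF tm qm] q(2) by blast
  then have "P (Suc i) \<in> I" if "i \<le> n" for i
    using that Suc.prems(1) by (intro Suc.IH[of "\<lambda>j. P (Suc j)"]) auto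
  then show ?case using P0 Suc.prems(3) by (cases j) auto
qed

lemma rgen_polys: "S \<subseteq> polys m \<Longrightarrow> rgen S \<subseteq> polys m"
  by (rule rgen_least) (auto intro: polys_add polys_mult polys_uminus)

lemma rgen_range_mC: "rgen (range mC) \<subseteq> range mC"
proof (rule rgen_least)
  show "1 \<in> range mC" using rangeI[of mC 1] by simp
  fix x y :: "'a mpoly" assume "x \<in> range mC" "y \<in> range mC"
  then obtain k l where kl: "x = mC k" "y = mC l" by blast
  then show "x + y \<in> range mC" "x * y \<in> range mC"
    using rangeI[of mC "k + l"] rangeI[of mC "k * l"] by (simp_all only: mC.hom_add mC.hom_mult)
next
  fix x :: "'a mpoly" assume "x \<in> range mC"
  then show "- x \<in> range mC" by (metis (no_types) mC.hom_uminus rangeE rangeI)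
qed simp

text \<open>An element chosen from each strict step of the chain has a value transcendental over the
  values of those chosen higher up. Hence the Krull dimension is at most the transcendence
  degree.\<close>

lemma prime_chain_alg_indep:
  assumes chain: "prime_chain m r c" and c0: "c 0 = relations m f"
  shows "\<exists>vs. alg_indep consts_rf vs \<and> length vs = r \<and> set vs \<subseteq> rgen (consts_rf \<union> f ` {..<m})"
proof -
  have pc: "primeideal (c i) (poly_ring m)" if "i \<le> r" for i using chain that by (simp add: prime_chain_def)
  have ss: "c i \<subset> c (Suc i)" if "i < r" for i using chain that by (simp add: prime_chain_def)
  have mono: "c i \<subseteq> c j" if "i \<le> j" "j \<le> r" for i j
    using that
  proof (induction j rule: dec_induct)
    case (step n) then show ?case using ss[of n] by auto
  qed simp
  have "\<forall>i. \<exists>q. i < r \<longrightarrow> q \<in> c (Suc i) \<and> q \<notin> c i" using ss by blast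
  then obtain q where q: "\<And>i. i < r \<Longrightarrow> q i \<in> c (Suc i)" "\<And>i. i < r \<Longrightarrow> q i \<notin> c i" by metis
  let ?ev = "meval const_rf f"
  have qm: "q i \<in> polys m" if "i < r" for i
    using primeideal_poly_ringD(1)[OF pc[of "Suc i"]] q(1)[OF that] that by auto
  define B where "B i = rgen (range mC \<union> q ` {i..<r})" for i
  have Bm: "B i \<subseteq> polys m" for i
    unfolding B_def using qm by (intro rgen_polys) auto
  have coeffs: "P j \<in> c 0"
    if H: "B (Suc i) \<inter> c (Suc i) \<subseteq> c 0" and i: "i < r" and "\<And>j. j \<le> n \<Longrightarrow> P j \<in> B (Suc i)"
      "(\<Sum>j\<le>n. P j * q i ^ j) \<in> c i" "j \<le> n" for i n P j
    by (rule coeffs_in_prime[OF pc[of "Suc i"] pc[of i] q(1)[OF i] q(2)[OF i] mono mono Bm H])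
       (use that in auto)
  have Bs: "B i = rgen (insert (q i) (range mC \<union> q ` {Suc i..<r}))" if "i < r" for i
  proof -
    have "{i..<r} = insert i {Suc i..<r}" using that by auto
    then show ?thesis by (simp add: B_def)
  qed
  \<comment> \<open>Descent from the top of the chain: the ring generated by the constants and
    \<open>q i\<close>, ..., \<open>q (r - 1)\<close> meets \<open>c i\<close> only in relations.
    For \<open>i = r\<close> this ring consists of constants, and a nonzero constant lies in no
    prime ideal.\<close>
  have H: "B i \<inter> c i \<subseteq> c 0" if "i \<le> r" for i
    using that
  proof (induction i rule: inc_induct)
    case base
    have "B r \<subseteq> range mC" unfolding B_def using rgen_range_mC by simp
    show ?case
    proof
      fix b assume b: "b \<in> B r \<inter> c r"
      then obtain k where k: "b = mC k" using \<open>B r \<subseteq> range mC\<close> by blast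
      show "b \<in> c 0"
      proof (cases "k = 0")
        case True
        then show ?thesis using primeideal_poly_ringD(2)[OF pc[of 0]] k by simp
      next
        case False
        have "mC (inverse k) * b \<in> c r" using primeideal_poly_ringD(6)[OF pc[of r]] b by auto
        then have "1 \<in> c r" using False by (simp add: k mult_single)
        then show ?thesis using primeideal_poly_ringD(3)[OF pc[of r]] by simp
      qed
    qed
  next
    case (step i)
    show ?case
    proof
      fix b assume b: "b \<in> B i \<inter> c i"
      then obtain P where P: "\<And>j. coeff P j \<in> B (Suc i)" "poly P (q i) = b"
      proof -
        have "b \<in> rgen (insert (q i) (range mC \<union> q ` {Suc i..<r}))" using b Bs[OF \<open>i < r\<close>] by simp
        from rgen_insert[OF this] obtain P where
          "\<forall>j. coeff P j \<in> rgen (range mC \<union> q ` {Suc i..<r})" "poly P (q i) = b" by (elim exE conjE)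
        then show ?thesis using that[of P] by (simp only: B_def)
      qed
      have T: "coeff P j * q i ^ j \<in> c 0" if "j \<le> Polynomial.degree P" for j
      proof -
        have "coeff P j \<in> c 0"
          using b P that by (intro coeffs[OF step.IH \<open>i < r\<close>, of "Polynomial.degree P" "coeff P"]) (auto simp: poly_altdef)
        then show ?thesis
          using primeideal_poly_ringD(6)[OF pc[of 0] _ polys_power[OF qm[OF \<open>i < r\<close>]]] by (simp add: mult.commute)
      qed
      have S: "sum g {..n} \<in> c 0" if "\<And>j. j \<le> n \<Longrightarrow> g j \<in> c 0" for g and n :: nat
        using that
      proof (induction n)
        case (Suc n)
        have "sum g {..n} \<in> c 0" "g (Suc n) \<in> c 0" using Suc by simp_all
        then show ?case unfolding sum.atMost_Suc by (rule primeideal_poly_ringD(4)[OF pc[OF le0]])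
      qed simp
      show "b \<in> c 0" unfolding P(2)[symmetric] poly_altdef by (rule S, rule T)
    qed
  qed
  have ev: "comm_ring_hom ?ev" by (rule const_rf.comm_ring_hom_meval)
  interpret ev: comm_ring_hom ?ev by fact
  have img: "?ev ` (range mC \<union> q ` A) = consts_rf \<union> (\<lambda>i. ?ev (q i)) ` A" for A
    by (simp add: image_Un image_image)
  have indep: "alg_indep consts_rf (map (\<lambda>i. ?ev (q i)) [i..<r])" if "i \<le> r" for i
    using that
  proof (induction i rule: inc_induct)
    case (step i)
    have "?ev (q i) \<notin> acl (consts_rf \<union> (\<lambda>i. ?ev (q i)) ` {Suc i..<r})"
    proof
      assume "?ev (q i) \<in> acl (consts_rf \<union> (\<lambda>i. ?ev (q i)) ` {Suc i..<r})"
      then obtain p where p: "p \<noteq> 0" "\<And>j. coeff p j \<in> rgen (consts_rf \<union> (\<lambda>i. ?ev (q i)) ` {Suc i..<r})"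
          "poly p (?ev (q i)) = 0" by (auto elim: aclE)
      have "\<forall>j. \<exists>P\<in>B (Suc i). coeff p j = ?ev P"
        using rgen_hom_image[OF ev] p(2) unfolding B_def img[symmetric] by blast
      then obtain P where P: "\<And>j. P j \<in> B (Suc i)" "\<And>j. coeff p j = ?ev (P j)" by metis
      let ?n = "Polynomial.degree p"
      let ?w = "\<Sum>j\<le>?n. P j * q i ^ j"
      have "?w \<in> polys m" using P(1) Bm qm[OF \<open>i < r\<close>] by (intro polys_sum polys_mult polys_power) auto
      moreover have "?ev ?w = 0"
        using p(3) by (simp add: ev.hom_sum ev.hom_mult ev.hom_power poly_altdef P(2))
      ultimately have "?w \<in> c 0" by (simp add: c0 hom_kernel_def)
      then have "?w \<in> c i" using mono[of 0 i] \<open>i < r\<close> by auto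
      then have "P ?n \<in> c 0" using P(1) \<open>i < r\<close> H[of "Suc i"] by (intro coeffs[where i = i and n = ?n]) auto
      then have "coeff p ?n = 0" by (simp add: c0 hom_kernel_def P(2))
      then show False using p(1) by simp
    qed
    then show ?case using step by (simp add: upt_conv_Cons)
  qed simp
  have "?ev p \<in> rgen (consts_rf \<union> f ` {..<m})" if "p \<in> polys m" for p
    using that
    by (induction rule: polys_induct)
       (auto simp: ev.hom_add ev.hom_mult intro: rgen.base rgen.add rgen.mult)
  then show ?thesis using indep[of 0] qm
    by (intro exI[of _ "map (\<lambda>i. ?ev (q i)) [0..<r]"]) auto
qed

section \<open>Long chains of primes by specialisation\<close>

lemma infinite_alg_closure: "infinite (UNIV :: 'k::field alg_closure set)"
proof
  assume fin: "finite (UNIV :: 'k alg_closure set)"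
  \<comment> \<open>Euclid's argument: this polynomial takes the value 1 everywhere but is not
    constant, so it has no root.\<close>
  define p where "p = (\<Prod>a\<in>(UNIV :: 'k alg_closure set). [:- a, 1:]) + 1"
  have ev: "poly p x = 1" for x
    unfolding p_def by (simp add: poly_prod prod_zero[OF fin])
  have "Polynomial.degree p > 0"
  proof (rule ccontr)
    assume "\<not> Polynomial.degree p > 0"
    then obtain c where "p = [:c:]" by (metis degree_eq_zeroE neq0_conv)
    then have "p = 1" using ev[of 0] by (simp add: one_pCons)
    then have "(\<Prod>a\<in>(UNIV :: 'k alg_closure set). [:- a, 1:]) = 0" by (simp add: p_def)
    then show False using fin by simp
  qed
  then obtain x where "poly p x = 0" using alg_closed_imp_poly_has_root by blast
  then show False using ev by simp
qed

lemma comm_ring_hom_to_ac [simp]: "comm_ring_hom to_ac"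
  by unfold_locales simp_all

lemma comm_ring_hom_ident: "comm_ring_hom (\<lambda>x. x)"
  by unfold_locales simp_all

lemma nonroot_alg_closure:
  assumes b: "b \<in> polys (Suc 0)" "(b :: 'k::field mpoly) \<noteq> 0"
  shows "\<exists>c. meval to_ac (\<lambda>_. c) b \<noteq> 0"
proof -
  define t where "t = meval (\<lambda>k. [:k:]) (\<lambda>_. [:0, 1:]) b"
  have cr: "comm_ring_hom (\<lambda>k::'k. [:k:])"
    by unfold_locales (simp_all add: one_pCons)
  have "poly (map_poly mC t) (mX 0) = b"
  proof -
    have "poly (map_poly mC (meval (\<lambda>k. [:k:]) (\<lambda>_. [:0, 1:]) b)) (mX 0) = (\<lambda>p. p) b"
      by (rule meval_unique_polys[OF _ _ b(1), where F = "\<lambda>p. poly (map_poly mC (meval (\<lambda>k. [:k:]) (\<lambda>_. [:0, 1:]) p)) (mX 0)"])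
         (simp_all add: cr map_poly_pCons comm_ring_hom_compose[OF comm_ring_hom_compose[OF comm_ring_hom.comm_ring_hom_meval[OF cr] comm_ring_hom_map_poly[OF comm_ring_hom_mC]] comm_ring_hom_poly] comm_ring_hom_ident)
    then show ?thesis by (simp add: t_def)
  qed
  then have "t \<noteq> 0" using b(2) by auto
  then have "map_poly to_ac t \<noteq> 0" by (simp add: map_poly_eq_0_iff)
  then obtain c where c: "poly (map_poly to_ac t) c \<noteq> 0"
    using poly_roots_finite[of "map_poly to_ac t"] infinite_alg_closure by (metis (mono_tags, lifting) UNIV_eq_I mem_Collect_eq)
  have "poly (map_poly to_ac (meval (\<lambda>k. [:k:]) (\<lambda>_. [:0, 1:]) b)) c = meval to_ac (\<lambda>_. c) b"
    by (rule meval_unique[where F = "\<lambda>p. poly (map_poly to_ac (meval (\<lambda>k. [:k:]) (\<lambda>_. [:0, 1:]) p)) c"])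
       (simp_all add: cr map_poly_pCons comm_ring_hom.comm_ring_hom_meval comm_ring_hom_compose[OF comm_ring_hom_compose[OF comm_ring_hom.comm_ring_hom_meval[OF cr] comm_ring_hom_map_poly[OF comm_ring_hom_to_ac]] comm_ring_hom_poly])
  then show ?thesis using c unfolding t_def by auto
qed

lemma fext_zero: "comm_ring_hom s \<Longrightarrow> fext s 0 = 0"
proof -
  assume s: "comm_ring_hom s"
  then interpret comm_ring_hom s .
  show ?thesis using fext_to_fract[OF s, of 0] by simp
qed

lemma relations_subset_specialise:
  assumes s: "comm_ring_hom s" and f: "\<And>i. i < m \<Longrightarrow> f i \<in> lring s"
  shows "relations m f \<subseteq> hom_kernel m (meval (\<lambda>k. s (mC k)) (\<lambda>i. fext s (f i)))"
proof
  fix p assume p: "p \<in> relations m f"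
  then have "fext s (meval const_rf f p) = meval (\<lambda>k. s (mC k)) (\<lambda>i. fext s (f i)) p"
    using fext_meval[OF s, of m f p] f by (simp add: hom_kernel_def)
  then show "p \<in> hom_kernel m (meval (\<lambda>k. s (mC k)) (\<lambda>i. fext s (f i)))"
    using p fext_zero[OF s] by (simp add: hom_kernel_def)
qed

lemma rgen_consts_meval:
  assumes "x \<in> rgen (consts_rf \<union> f ` J)" "J \<subseteq> {..<m}"
  shows "\<exists>p. p \<in> polys m \<and> p \<in> rgen (range mC \<union> mX ` J) \<and> x = meval const_rf f p"
proof -
  have "consts_rf \<union> f ` J = meval const_rf f ` (range mC \<union> mX ` J)"
    by (simp add: image_Un image_image)
  then obtain p where p: "p \<in> rgen (range mC \<union> mX ` J)" "x = meval const_rf f p"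
    using rgen_hom_image[OF const_rf.comm_ring_hom_meval[of f]] assms(1) by metis
  moreover have "range mC \<union> mX ` J \<subseteq> polys m" using assms(2) by auto
  then have "p \<in> polys m" using p(1) rgen_polys by blast
  ultimately show ?thesis by blast
qed

text \<open>Independence of components can be read off the ideal of relations. Thus a specialisation
  that destroys independence makes this ideal strictly larger, which provides a new step of a
  chain.\<close>

lemma alg_indep_relations_cong:
  assumes rel: "relations m g = relations m f" and "set js \<subseteq> {..<m}"
    and "alg_indep consts_rf (map f js)"
  shows "alg_indep consts_rf (map g js)"
  using assms(2,3)
proof (induction js)
  case (Cons j js)
  have "g j \<notin> acl (consts_rf \<union> g ` set js)"
  proof
    assume "g j \<in> acl (consts_rf \<union> g ` set js)"
    then obtain p where p: "p \<noteq> 0" "\<And>i. coeff p i \<in> rgen (consts_rf \<union> g ` set js)" "poly p (g j) = 0"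
      by (auto elim: aclE)
    have js: "set js \<subseteq> {..<m}" and j: "j < m" using Cons.prems by auto
    obtain P where P: "\<And>i. P i \<in> polys m" "\<And>i. P i \<in> rgen (range mC \<union> mX ` set js)"
        "\<And>i. coeff p i = meval const_rf g (P i)"
      using rgen_consts_meval[OF p(2) js] by metis
    interpret G: comm_ring_hom "meval const_rf g" by (rule const_rf.comm_ring_hom_meval)
    interpret F: comm_ring_hom "meval const_rf f" by (rule const_rf.comm_ring_hom_meval)
    define n where "n = Polynomial.degree p"
    define w where "w = (\<Sum>i\<le>n. P i * mX j ^ i)"
    have "w \<in> polys m" unfolding w_def using P(1) j by (intro polys_sum polys_mult polys_power) auto
    moreover have "meval const_rf g w = 0"
      using p(3) by (simp add: w_def n_def poly_altdef P(3) G.hom_sum G.hom_mult G.hom_power)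
    ultimately have "w \<in> relations m f" using rel by (auto simp: hom_kernel_def)
    then have w: "(\<Sum>i\<le>n. meval const_rf f (P i) * f j ^ i) = 0"
      by (simp add: hom_kernel_def w_def F.hom_sum F.hom_mult F.hom_power)
    define q where "q = (\<Sum>i\<le>n. monom (meval const_rf f (P i)) i)"
    have "coeff p n \<noteq> 0" using p(1) by (simp add: n_def)
    then have "P n \<notin> relations m f" unfolding rel[symmetric] by (simp add: hom_kernel_def P(3))
    then have "coeff q n \<noteq> 0" using P(1) by (simp add: q_def coeff_sum_monom hom_kernel_def)
    then have "q \<noteq> 0" by auto
    moreover have "meval const_rf f x \<in> rgen (consts_rf \<union> f ` set js)" if "x \<in> rgen (range mC \<union> mX ` set js)" for x
      using that
      by induction (auto simp: F.hom_add F.hom_mult F.hom_uminus intro: rgen.intros)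
    then have "coeff q i \<in> rgen (consts_rf \<union> f ` set js)" for i
      using P(2) by (simp add: q_def coeff_sum_monom rgen_zero)
    moreover have "poly q (f j) = 0" using w by (simp add: q_def poly_sum poly_monom)
    ultimately have "f j \<in> acl (consts_rf \<union> f ` set js)" by (rule aclI)
    then show False using Cons.prems by simp
  qed
  then show ?case using Cons by simp
qed simp

lemma prime_chain_Cons:
  assumes "primeideal P (poly_ring m)" "prime_chain m r c" "P \<subset> c 0"
  shows "prime_chain m (Suc r) (case_nat P c)"
  using assms unfolding prime_chain_def by (auto split: nat.split simp: less_Suc_eq_0_disj)

lemma prime_chain_replace:
  assumes "primeideal P (poly_ring m)" "prime_chain m r c" "P \<subseteq> c 0"
  shows "prime_chain m r (c(0 := P))"
proof -
  have "(c(0 := P)) i \<subset> (c(0 := P)) (Suc i)" if "i < r" for i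
    using assms that unfolding prime_chain_def by (cases i) auto
  then show ?thesis using assms by (simp add: prime_chain_def)
qed

lemma prime_chain_shorten: "prime_chain m r c \<Longrightarrow> r' \<le> r \<Longrightarrow> prime_chain m r' c"
  by (auto simp: prime_chain_def)

lemma primeideal_relations: "primeideal (relations m f) (poly_ring m)"
  by (rule primeideal_hom_kernel[OF const_rf.comm_ring_hom_meval])

lemma prime_chain_single: "primeideal P (poly_ring m) \<Longrightarrow> prime_chain m 0 (\<lambda>_. P)"
  by (simp add: prime_chain_def)

text \<open>For a finite field no specialisation of the last remaining variable inside \<open>k\<close> need exist, so
  that variable is sent to an element of the algebraic closure.\<close>

lemma prime_chain_one_variable:
  fixes f :: "nat \<Rightarrow> 'k::field ratfun"
  assumes f: "\<And>i. i < m \<Longrightarrow> f i \<in> ratfuns (Suc 0)" and j: "j < m" "f j \<notin> acl consts_rf"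
  shows "\<exists>Q. primeideal Q (poly_ring m) \<and> relations m f \<subset> Q"
proof -
  obtain b where b: "b \<in> polys (Suc 0)" "b \<noteq> 0" "\<forall>r\<in>f ` {..<m}. \<exists>a\<in>polys (Suc 0). r = Fract a b"
    using common_denominator[of "f ` {..<m}" "Suc 0"] f by auto
  obtain c :: "'k alg_closure" where c: "meval to_ac (\<lambda>_. c) b \<noteq> 0"
    using nonroot_alg_closure[OF b(1,2)] by blast
  define s where "s = meval to_ac (\<lambda>_. c)"
  have s: "comm_ring_hom s" unfolding s_def by (simp add: comm_ring_hom.comm_ring_hom_meval)
  have sC: "(\<lambda>k. s (mC k)) = to_ac" by (simp add: s_def)
  have fl: "f i \<in> lring s" if "i < m" for i
    using b(3) c that unfolding lring_def s_def by fastforce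
  let ?h = "meval to_ac (\<lambda>i. fext s (f i)) :: 'k mpoly \<Rightarrow> 'k alg_closure"
  have h: "comm_ring_hom ?h" by (simp add: comm_ring_hom.comm_ring_hom_meval)
  interpret h: comm_ring_hom ?h by fact
  interpret F: comm_ring_hom "meval const_rf f" by (rule const_rf.comm_ring_hom_meval)
  \<comment> \<open>The value of \<open>f j\<close> at \<open>c\<close> is algebraic over
    \<open>k\<close>. An equation for it gives an element of the new kernel that is no relation of
    \<open>f\<close>, because \<open>f j\<close> itself is transcendental.\<close>
  obtain g where g: "g \<noteq> 0" "poly (map_poly to_ac g) (fext s (f j)) = 0"
    by (rule alg_closure_algebraic)
  define p where "p = (\<Sum>i\<le>Polynomial.degree g. mC (coeff g i) * mX j ^ i)"
  have pm: "p \<in> polys m" unfolding p_def using j by (intro polys_sum polys_mult polys_power) auto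
  have "?h p = poly (map_poly to_ac g) (fext s (f j))"
    by (simp add: p_def h.hom_sum h.hom_mult h.hom_power poly_altdef degree_map_poly coeff_map_poly)
  then have "p \<in> hom_kernel m ?h" using pm g by (simp add: hom_kernel_def)
  moreover have "p \<notin> relations m f"
  proof
    assume "p \<in> relations m f"
    then have "poly (map_poly const_rf g) (f j) = 0"
      by (simp add: hom_kernel_def p_def F.hom_sum F.hom_mult F.hom_power poly_altdef degree_map_poly coeff_map_poly)
    moreover have "map_poly const_rf g \<noteq> 0" using g by (simp add: map_poly_eq_0_iff)
    moreover have "coeff (map_poly const_rf g) i \<in> rgen consts_rf" for i
      by (simp add: coeff_map_poly rgen.base)
    ultimately show False using j(2) aclI by blast
  qed
  moreover have "relations m f \<subseteq> hom_kernel m ?h"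
    using relations_subset_specialise[OF s fl] unfolding sC by simp
  ultimately show ?thesis using primeideal_hom_kernel[OF h, of m] by blast
qed

text \<open>As a polynomial in \<open>x_n\<close> the product of \<open>D\<close> has finitely many
  roots, while the powers of \<open>x_0\<close> are infinitely many, even over a finite
  field.\<close>

lemma nonroot_power:
  fixes D :: "'k::field mpoly set"
  assumes "finite D" "0 \<notin> D" "n \<noteq> 0"
  shows "\<exists>N. \<forall>d\<in>D. meval mC (\<lambda>i. if i = n then mX 0 ^ N else mX i) d \<noteq> 0"
proof -
  let ?r = "\<Prod>D"
  have "single_out n ?r \<noteq> 0" using assms by (simp add: single_out_eq_0_iff)
  then have fin: "finite {x. poly (single_out n ?r) x = 0}" by (rule poly_roots_finite)
  have pw: "mX 0 ^ N = (Poly_Mapping.single (Poly_Mapping.single 0 N) 1 :: 'k mpoly)" for N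
    by (induction N) (simp_all add: mX_def mult_single flip: single_add)
  have "inj (\<lambda>N. mX 0 ^ N :: 'k mpoly)"
  proof (rule injI)
    fix M N assume "mX 0 ^ M = (mX 0 ^ N :: 'k mpoly)"
    from arg_cong[OF this[unfolded pw], of Poly_Mapping.keys]
    have "Poly_Mapping.single (0::nat) M = Poly_Mapping.single 0 N" by simp
    then show "M = N" by (metis lookup_single_eq)
  qed
  then have "infinite (range (\<lambda>N. mX 0 ^ N :: 'k mpoly))" by (simp add: finite_image_iff)
  then obtain N where "poly (single_out n ?r) (mX 0 ^ N) \<noteq> 0"
    using fin by (metis (mono_tags, lifting) finite_subset image_subsetI mem_Collect_eq)
  then have nz: "meval mC (\<lambda>i. if i = n then mX 0 ^ N else mX i) ?r \<noteq> 0" unfolding poly_single_out .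
  interpret M: comm_ring_hom "meval mC (\<lambda>i. if i = n then mX 0 ^ N else mX i :: 'k mpoly)"
    by (rule mC.comm_ring_hom_meval)
  show ?thesis using assms(1) nz by (auto simp: M.hom_prod)
qed

lemma alg_indep_append_le:
  assumes "alg_indep C (ws @ vs)" "set (ws @ vs) \<subseteq> acl (C \<union> B)" "finite B"
  shows "length ws + length vs \<le> card B"
  using alg_indep_length_le[OF assms] by simp

lemma ex_map_index:
  assumes "set us \<subseteq> f ` J"
  shows "\<exists>js. us = map f js \<and> set js \<subseteq> J"
  using assms
proof (induction us)
  case (Cons u us)
  then obtain js j where "us = map f js" "set js \<subseteq> J" "u = f j" "j \<in> J" by auto
  then show ?case by (intro exI[of _ "j # js"]) simp
qed simp

text \<open>Substituting a generic power of \<open>x\<^sub>0\<close> for the last variable lowers the transcendence degree by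
  at most one, since the remaining variables stay algebraic over the specialised functions and the
  specialised complementary variables.\<close>

lemma specialise_last_variable:
  fixes f :: "nat \<Rightarrow> 'k::field ratfun"
  assumes n: "n \<noteq> 0" and f: "\<And>i. i < m \<Longrightarrow> f i \<in> ratfuns (Suc n)"
    and js: "set js \<subseteq> {..<m}" and ind: "alg_indep consts_rf (map f js)"
  shows "\<exists>g ks. (\<forall>i<m. g i \<in> ratfuns n) \<and> relations m f \<subseteq> relations m g \<and>
    set ks \<subseteq> set js \<and> alg_indep consts_rf (map g ks) \<and>
    g ` set js \<subseteq> acl (consts_rf \<union> g ` set ks) \<and> length js \<le> Suc (length ks)"
proof -
  let ?C = "consts_rf :: 'k ratfun set"
  let ?V = "var_rf ` {..n} :: 'k ratfun set"
  obtain ws where ws: "set ws \<subseteq> ?V" "alg_indep ?C (ws @ map f js)" "?V \<subseteq> acl (?C \<union> set (ws @ map f js))"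
    using alg_indep_extend[OF _ ind, of ?V] by auto
  let ?T = "set (ws @ map f js)"
  have V: "?V \<subseteq> ratfuns (Suc n)" by auto
  have T: "?T \<subseteq> ratfuns (Suc n)" using ws(1) V f js by auto
  have "?T \<subseteq> acl (?C \<union> ?V)"
    using subset_trans[OF T ratfuns_subset_acl[of "Suc n"]] by (simp only: lessThan_Suc_atMost)
  then have len: "length ws + length js \<le> Suc n"
    using alg_indep_append_le[OF ws(2), of ?V] card_image_le[of "{..n}" "var_rf :: nat \<Rightarrow> 'k ratfun"] by simp
  have "\<forall>j. \<exists>p. j \<le> n \<longrightarrow> p \<noteq> 0 \<and> (\<forall>i. coeff p i \<in> rgen (?C \<union> ?T)) \<and> poly p (var_rf j) = 0"
    using ws(3) by (auto simp: acl_def)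
  then obtain p where p: "\<And>j. j \<le> n \<Longrightarrow> p j \<noteq> 0" "\<And>i j. j \<le> n \<Longrightarrow> coeff (p j) i \<in> rgen (?C \<union> ?T)"
      "\<And>j. j \<le> n \<Longrightarrow> poly (p j) (var_rf j) = 0"
    by metis
  \<comment> \<open>The equations \<open>p j\<close> have to remain nontrivial after the
    specialisation. Their leading coefficients are therefore put over the common denominator, and
    the numerators are among the polynomials that the substitution must not kill.\<close>
  define q where "q j = Polynomial.lead_coeff (p j)" for j
  have qr: "q j \<in> ratfuns (Suc n)" if "j \<le> n" for j
  proof -
    have "?C \<union> ?T \<subseteq> ratfuns (Suc n)" using T by (intro Un_least) auto
    then show ?thesis using rgen_ratfuns p(2)[OF that] unfolding q_def by blast
  qed
  define F where "F = f ` {..<m} \<union> ?V \<union> q ` {..n}"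
  have "finite F" "F \<subseteq> ratfuns (Suc n)" using f V qr by (auto simp: F_def)
  then obtain b where b: "b \<in> polys (Suc n)" "b \<noteq> 0" "\<And>r. r \<in> F \<Longrightarrow> \<exists>a\<in>polys (Suc n). r = Fract a b"
    using common_denominator[of F "Suc n"] by blast
  have "\<forall>j. \<exists>a. j \<le> n \<longrightarrow> a \<in> polys (Suc n) \<and> q j = Fract a b"
    using b(3) by (auto simp: F_def)
  then obtain a where a: "\<And>j. j \<le> n \<Longrightarrow> a j \<in> polys (Suc n)" "\<And>j. j \<le> n \<Longrightarrow> q j = Fract (a j) b"
    by metis
  have a0: "a j \<noteq> 0" if "j \<le> n" for j
  proof
    assume "a j = 0"
    then have "q j = 0" using a(2)[OF that] b(2) by (simp add: fract_collapse)
    then show False using p(1)[OF that] by (simp add: q_def)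
  qed
  obtain N where N: "\<And>d. d \<in> insert b (a ` {..n}) \<Longrightarrow> meval mC (\<lambda>i. if i = n then mX 0 ^ N else mX i) d \<noteq> 0"
    using nonroot_power[of "insert b (a ` {..n})" n] b(2) a0 n by (metis (no_types, lifting) atMost_iff finite_atMost finite_imageI finite_insert imageE insertE)
  define t where "t = meval mC (\<lambda>i. if i = n then mX 0 ^ N else mX i :: 'k mpoly)"
  define s where "s d = to_fract (t d)" for d
  have t: "comm_ring_hom t" unfolding t_def by (rule mC.comm_ring_hom_meval)
  have s: "comm_ring_hom s"
    unfolding s_def[abs_def] by (rule comm_ring_hom_compose[OF t comm_ring_hom_to_fract])
  have sb: "s b \<noteq> 0" and sa: "\<And>j. j \<le> n \<Longrightarrow> s (a j) \<noteq> 0"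
    using N by (simp_all add: s_def t_def)
  have sC: "(\<lambda>k. s (mC k)) = const_rf"
    by (simp add: s_def t_def const_rf_to_fract fun_eq_iff)
  have tp: "t d \<in> polys n" if "d \<in> polys (Suc n)" for d
    unfolding t_def
    by (rule meval_closed[OF that]) (use n in \<open>auto intro: polys_add polys_mult polys_power\<close>)
  have Fl: "F \<subseteq> lring s"
    using b(3) sb unfolding lring_def by fastforce
  have Fr: "fext s r \<in> ratfuns n" if rF: "r \<in> F" for r
  proof -
    obtain c where c: "c \<in> polys (Suc n)" "r = Fract c b" using b(3)[OF rF] by blast
    then have "fext s r = s c / s b" using fext_Fract[OF s sb] by simp
    then show ?thesis using tp[OF c(1)] tp[OF b(1)] by (simp add: s_def ratfuns_divide ratfuns_to_fract)
  qed
  define g where "g i = fext s (f i)" for i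
  have gr: "\<forall>i<m. g i \<in> ratfuns n" using Fr by (auto simp: g_def F_def)
  have fl: "f i \<in> lring s" if "i < m" for i using Fl that by (auto simp: F_def)
  have rel: "relations m f \<subseteq> relations m g"
    using relations_subset_specialise[OF s fl] unfolding sC g_def[symmetric] .
  have Cl: "?C \<subseteq> lring s" "fext s ` ?C = ?C"
    using s lring_to_fract[OF s] fext_to_fract[OF s]
    by (auto simp: const_rf_to_fract s_def t_def image_image)
  have TF: "?T \<subseteq> F" using ws(1) js by (auto simp: F_def)
  have CT: "?C \<union> ?T \<subseteq> lring s" using TF Fl Cl by blast
  have fT: "fext s ` (?C \<union> ?T) = ?C \<union> (fext s ` set ws \<union> g ` set js)"
    unfolding image_Un Cl(2) by (simp add: image_Un image_image g_def)
  have vars: "var_rf j \<in> acl (?C \<union> (fext s ` set ws \<union> g ` set js))" if "j < n" for j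
  proof -
    let ?d = "Polynomial.degree (p j)"
    have j: "j \<le> n" using that by simp
    note cf = rgen_fext_image[OF s CT p(2)[OF j]]
    let ?r = "\<Sum>i\<le>?d. monom (fext s (coeff (p j) i)) i"
    have vs: "fext s (var_rf j) = var_rf j" and vl: "var_rf j \<in> lring s"
      using fext_to_fract[OF s, of "mX j"] lring_to_fract[OF s, of "mX j"] that
      by (simp_all add: var_rf_to_fract s_def t_def)
    have pw: "var_rf j ^ i \<in> lring s \<and> fext s (var_rf j ^ i) = var_rf j ^ i" for i
    proof (induction i)
      case 0
      interpret comm_ring_hom s by fact
      show ?case using lring_to_fract[OF s, of 1] fext_to_fract[OF s, of 1] by simp
    next
      case (Suc i)
      then show ?case using vs vl s by (simp add: lring_mult fext_mult)
    qed
    have sm: "sum h {..k} \<in> lring s \<and> fext s (sum h {..k}) = (\<Sum>i\<le>k. fext s (h i))"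
      if "\<And>i. h i \<in> lring s" for h and k :: nat
      using that s by (induction k) (simp_all add: lring_add fext_add)
    have "poly ?r (var_rf j) = (\<Sum>i\<le>?d. fext s (coeff (p j) i * var_rf j ^ i))"
      using cf pw s by (simp add: poly_sum poly_monom fext_mult)
    also have "\<dots> = fext s (\<Sum>i\<le>?d. coeff (p j) i * var_rf j ^ i)"
      using sm[of "\<lambda>i. coeff (p j) i * var_rf j ^ i" ?d] cf pw s by (simp add: lring_mult)
    also have "\<dots> = 0" using p(3)[OF j] fext_zero[OF s] by (simp add: poly_altdef)
    finally have "poly ?r (var_rf j) = 0" .
    moreover have "coeff ?r ?d \<noteq> 0"
    proof -
      have "fext s (q j) = s (a j) / s b" using a(2)[OF j] fext_Fract[OF s sb] by simp
      then show ?thesis using sa[OF j] sb by (simp add: coeff_sum_monom q_def)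
    qed
    then have "?r \<noteq> 0" by (metis coeff_0)
    moreover have "coeff ?r i \<in> rgen (?C \<union> (fext s ` set ws \<union> g ` set js))" for i
      using cf[of i] unfolding fT by (simp add: coeff_sum_monom rgen_zero)
    ultimately show ?thesis using aclI by blast
  qed
  obtain us where us: "set us \<subseteq> g ` set js" "alg_indep ?C us" "g ` set js \<subseteq> acl (?C \<union> set us)"
    using alg_indep_basis[of "g ` set js" ?C] by auto
  obtain ks where ks: "us = map g ks" "set ks \<subseteq> set js" using ex_map_index[OF us(1)] by blast
  let ?B = "fext s ` set ws \<union> set us"
  have "?C \<union> (fext s ` set ws \<union> g ` set js) \<subseteq> acl (?C \<union> ?B)"
    using us(3) acl_base[of "?C \<union> ?B"] acl_mono[of "?C \<union> set us" "?C \<union> ?B"] by blast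
  then have "acl (?C \<union> (fext s ` set ws \<union> g ` set js)) \<subseteq> acl (?C \<union> ?B)" by (rule acl_idem)
  then have "set (map var_rf [0..<n]) \<subseteq> acl (?C \<union> ?B)" using vars by auto
  \<comment> \<open>The \<open>n\<close> remaining variables are algebraic over the specialised
    \<open>ws\<close> together with \<open>us\<close>, whereas \<open>len\<close> bounds the lengths
    of \<open>ws\<close> and \<open>js\<close> by \<open>n + 1\<close>. The comparison shows that at
    most one element is lost.\<close>
  then have "n \<le> card ?B"
    using alg_indep_length_le[OF alg_indep_vars[of "[0..<n]"], of ?B] by simp
  also have "\<dots> \<le> length ws + length us"
    by (metis (no_types) add_mono card_Un_le card_image_le card_length dual_order.trans finite_set)
  finally have "length js \<le> Suc (length us)" using len by simp
  then show ?thesis using gr rel us ks by (intro exI[of _ g] exI[of _ ks]) auto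
qed

text \<open>Induction on the number of variables. If specialising a variable keeps enough
  independent components, \<open>relations m f\<close> replaces the bottom of the chain obtained. If
  one is lost, the ideal of relations has grown strictly, and \<open>relations m f\<close> is put
  below that chain.\<close>

theorem prime_chain_exists:
  fixes f :: "nat \<Rightarrow> 'k::field ratfun"
  assumes "\<And>i. i < m \<Longrightarrow> f i \<in> ratfuns n" "set js \<subseteq> {..<m}" "alg_indep consts_rf (map f js)"
  shows "\<exists>c. prime_chain m (length js) c \<and> c 0 = relations m f"
  using assms
proof (induction n arbitrary: f js)
  case 0
  have "js = []"
  proof (cases js)
    case (Cons j js')
    then have "f j \<in> acl consts_rf" using 0 ratfuns_subset_acl[of 0] by auto
    then show ?thesis using 0(3) Cons acl_mono[of consts_rf "consts_rf \<union> f ` set js'"] by auto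
  qed
  then show ?case using prime_chain_single[OF primeideal_relations] by auto
next
  case (Suc n)
  show ?case
  proof (cases "n = 0")
    case True
    show ?thesis
    proof (cases js)
      case Nil
      then show ?thesis using prime_chain_single[OF primeideal_relations] by auto
    next
      case (Cons j js')
      have "set (map f js) \<subseteq> acl (consts_rf \<union> {var_rf 0})"
        using ratfuns_subset_acl[of "Suc n"] Suc.prems(1,2) True by (auto simp: lessThan_Suc)
      then have "length js \<le> 1"
        using alg_indep_length_le[OF Suc.prems(3), of "{var_rf 0}"] by simp
      then have js: "js = [j]" using Cons by simp
      then obtain Q where "primeideal Q (poly_ring m)" "relations m f \<subset> Q"
        using prime_chain_one_variable[of m f j] Suc.prems True by auto
      then show ?thesis
        using prime_chain_Cons[OF primeideal_relations prime_chain_single, of Q m f] js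
        by (intro exI[of _ "case_nat (relations m f) (\<lambda>_. Q)"]) simp
    qed
  next
    case False
    obtain g ks where g: "\<forall>i<m. g i \<in> ratfuns n" "relations m f \<subseteq> relations m g" "set ks \<subseteq> set js"
        "alg_indep consts_rf (map g ks)" "g ` set js \<subseteq> acl (consts_rf \<union> g ` set ks)"
        "length js \<le> Suc (length ks)"
      using specialise_last_variable[OF False, of m f js] Suc.prems by blast
    have "set ks \<subseteq> {..<m}" using g(3) Suc.prems(2) by blast
    then obtain c where c: "prime_chain m (length ks) c" "c 0 = relations m g"
      using Suc.IH[of g ks] g by blast
    show ?thesis
    proof (cases "length js \<le> length ks")
      case True
      then show ?thesis
        using prime_chain_replace[OF primeideal_relations prime_chain_shorten[OF c(1) True], of f] c(2) g(2)
        by (intro exI[of _ "c(0 := relations m f)"]) (simp del: fun_upd_apply, simp)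
    next
      case False
      have "relations m f \<noteq> relations m g"
      proof
        assume "relations m f = relations m g"
        then have "alg_indep consts_rf (map g js)"
          using alg_indep_relations_cong[of m g f js] Suc.prems by simp
        then have "length js \<le> length (map g ks)"
          using alg_indep_length_le'[of consts_rf "map g js" "map g ks"] g(5) by simp
        then show False using False by simp
      qed
      then have "relations m f \<subset> c 0" using g(2) c(2) by blast
      moreover have "length js = Suc (length ks)" using False g(6) by simp
      ultimately show ?thesis
        using prime_chain_Cons[OF primeideal_relations c(1), of f]
        by (intro exI[of _ "case_nat (relations m f) c"]) simp
    qed
  qed
qed

section \<open>The dimension of the image as a transcendence degree\<close>

lemma map_dim_eq:
  assumes "rational_map n m (f :: 'k::field ratfun vec)"
  shows "map_dim n m f = (SUP r \<in> {r. \<exists>c. prime_chain m r c \<and> relations m (($) f) \<subseteq> c 0}. enat r)"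
proof -
  have "{r. \<exists>c. (\<forall>i\<le>r. c i \<in> {P. primeideal P (poly_ring m) \<and> relations m (($) f) \<subseteq> P}) \<and> (\<forall>i<r. c i \<subset> c (Suc i))} =
    {r. \<exists>c. prime_chain m r c \<and> relations m (($) f) \<subseteq> c 0}" (is "{r. \<exists>c. ?P r c} = {r. \<exists>c. ?Q r c}")
  proof -
    have "?P r c \<longleftrightarrow> ?Q r c" for r c
    proof
      assume Q: "?Q r c"
      have "c 0 \<subseteq> c i" if "i \<le> r" for i
        using that
      proof (induction i)
        case (Suc i)
        then have "c i \<subset> c (Suc i)" using Q by (simp add: prime_chain_def)
        then show ?case using Suc by auto
      qed simp
      then show "?P r c" using Q by (fastforce simp: prime_chain_def)
    qed (auto simp: prime_chain_def)
    then show ?thesis by simp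
  qed
  then show ?thesis
    unfolding map_dim_def krull_dim_def zariski_closure_map_image[OF assms] by simp
qed

lemma map_dim_mono:
  fixes f f' :: "'k::field ratfun vec"
  assumes "rational_map n m f" "rational_map n' m f'" "relations m (($) f) \<subseteq> relations m (($) f')"
  shows "map_dim n' m f' \<le> map_dim n m f"
  unfolding map_dim_eq[OF assms(1)] map_dim_eq[OF assms(2)]
  by (rule SUP_subset_mono) (use assms(3) in auto)

lemma map_dim_le:
  fixes f :: "'k::field ratfun vec"
  assumes f: "rational_map n m f" and ws: "\<And>i. i < m \<Longrightarrow> f $ i \<in> acl (consts_rf \<union> set ws)"
  shows "map_dim n m f \<le> enat (length ws)"
  unfolding map_dim_eq[OF f]
proof (rule SUP_least)
  fix r assume "r \<in> {r. \<exists>c. prime_chain m r c \<and> relations m (($) f) \<subseteq> c 0}"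
  then obtain c where c: "prime_chain m r c" "relations m (($) f) \<subseteq> c 0" by blast
  have "prime_chain m r (c(0 := relations m (($) f)))"
    by (rule prime_chain_replace[OF primeideal_relations c])
  then obtain vs where vs: "alg_indep consts_rf vs" "length vs = r"
      "set vs \<subseteq> rgen (consts_rf \<union> ($) f ` {..<m})"
    using prime_chain_alg_indep[of m r "c(0 := relations m (($) f))" "($) f"] by auto
  have "consts_rf \<union> ($) f ` {..<m} \<subseteq> acl (consts_rf \<union> set ws)"
    using ws acl_base[of "consts_rf \<union> set ws"] by auto
  then have "set vs \<subseteq> acl (consts_rf \<union> set ws)" using vs(3) rgen_subset_acl by blast
  then show "enat r \<le> enat (length ws)"
    using alg_indep_length_le'[OF vs(1), of ws] vs(2) by simp
qed

lemma map_dim_ge: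
  fixes f :: "'k::field ratfun vec"
  assumes f: "rational_map n m f" and vs: "alg_indep consts_rf vs" "set vs \<subseteq> ($) f ` {..<m}"
  shows "enat (length vs) \<le> map_dim n m f"
proof -
  obtain js where js: "vs = map (($) f) js" "set js \<subseteq> {..<m}" using ex_map_index[OF vs(2)] by blast
  then obtain c where "prime_chain m (length vs) c" "c 0 = relations m (($) f)"
    using prime_chain_exists[of m "($) f" n js] f vs(1) by (auto simp: rational_map_def)
  then show ?thesis unfolding map_dim_eq[OF f] by (intro SUP_upper) auto
qed

text \<open>The two bounds for the dimension meet at a transcendence basis chosen among the
  components. In particular the dimension is finite.\<close>

lemma map_dim_basis:
  fixes f :: "'k::field ratfun vec"
  assumes f: "rational_map n m f"
  shows "\<exists>vs. alg_indep consts_rf vs \<and> set vs \<subseteq> ($) f ` {..<m} \<and>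
    ($) f ` {..<m} \<subseteq> acl (consts_rf \<union> set vs) \<and> map_dim n m f = enat (length vs)"
proof -
  obtain vs where vs: "set vs \<subseteq> ($) f ` {..<m}" "alg_indep consts_rf vs"
      "($) f ` {..<m} \<subseteq> acl (consts_rf \<union> set vs)"
    using alg_indep_basis[of "($) f ` {..<m}" consts_rf] by auto
  then show ?thesis
    using map_dim_ge[OF f vs(2,1)] map_dim_le[OF f, of vs] by (intro exI[of _ vs]) (auto intro: antisym)
qed

section \<open>Representations and linear substitutions\<close>

lemma representation_iff:
  assumes "group G"
  shows "representation G n (\<rho> :: 'g \<Rightarrow> 'k::field mat) \<longleftrightarrow>
    (\<forall>g\<in>carrier G. \<rho> g \<in> carrier_mat n n) \<and> \<rho> \<one>\<^bsub>G\<^esub> = 1\<^sub>m n \<and>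
    (\<forall>g\<in>carrier G. \<forall>h\<in>carrier G. \<rho> (g \<otimes>\<^bsub>G\<^esub> h) = \<rho> g * \<rho> h)" (is "_ \<longleftrightarrow> ?R")
proof -
  interpret G: group G by fact
  let ?M = "ring_mat TYPE('k) n ()"
  interpret M: ring ?M by (rule ring_mat)
  interpret U: group "units_of ?M" by (rule M.units_group)
  show ?thesis
  proof
    assume "representation G n \<rho>"
    then have h: "\<rho> \<in> hom G (units_of ?M)" by (simp add: representation_def)
    then have "\<rho> \<one>\<^bsub>G\<^esub> = 1\<^sub>m n"
      using hom_one[OF h G.group_axioms U.group_axioms] by (simp add: units_of_def ring_mat_simps)
    moreover have "\<rho> g \<in> carrier_mat n n" if "g \<in> carrier G" for g
      using h that by (auto simp: hom_def units_of_def Units_def ring_mat_simps)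
    ultimately show ?R using h by (simp add: hom_def units_of_def ring_mat_simps)
  next
    assume R: ?R
    have "\<rho> g \<in> Units ?M" if g: "g \<in> carrier G" for g
      unfolding Units_def
    proof (simp add: ring_mat_simps, intro conjI bexI)
      show "\<rho> g \<in> carrier_mat n n" "\<rho> (inv\<^bsub>G\<^esub> g) \<in> carrier_mat n n"
        using R g by simp_all
      have "\<rho> (inv\<^bsub>G\<^esub> g \<otimes>\<^bsub>G\<^esub> g) = \<rho> (inv\<^bsub>G\<^esub> g) * \<rho> g" "\<rho> (g \<otimes>\<^bsub>G\<^esub> inv\<^bsub>G\<^esub> g) = \<rho> g * \<rho> (inv\<^bsub>G\<^esub> g)"
        using R g by blast+
      then show "\<rho> (inv\<^bsub>G\<^esub> g) * \<rho> g = 1\<^sub>m n" "\<rho> g * \<rho> (inv\<^bsub>G\<^esub> g) = 1\<^sub>m n"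
        using R g by simp_all
    qed
    then show "representation G n \<rho>"
      using R by (simp add: representation_def hom_def units_of_def ring_mat_simps Pi_def)
  qed
qed

section \<open>Linear substitutions and the action on rational functions\<close>

definition lin_form :: "nat \<Rightarrow> 'k::field mat \<Rightarrow> nat \<Rightarrow> 'k mpoly" where
  "lin_form n A i = (if i < n then \<Sum>j<n. mC (A $$ (i, j)) * mX j else mX i)"

definition lin_subst :: "nat \<Rightarrow> 'k::field mat \<Rightarrow> 'k mpoly \<Rightarrow> 'k mpoly" where
  "lin_subst n A = meval mC (lin_form n A)"

definition rf_subst :: "nat \<Rightarrow> 'k::field mat \<Rightarrow> 'k ratfun \<Rightarrow> 'k ratfun" where
  "rf_subst n A = fext (\<lambda>p. to_fract (lin_subst n A p))"

lemma comm_ring_hom_lin_subst [simp]: "comm_ring_hom (lin_subst n A)"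
  unfolding lin_subst_def by (rule mC.comm_ring_hom_meval)

interpretation lin_subst: comm_ring_hom "lin_subst n A"
  by simp

lemma lin_subst_mC [simp]: "lin_subst n A (mC c) = mC c"
  and lin_subst_mX: "lin_subst n A (mX i) = lin_form n A i"
  by (simp_all add: lin_subst_def)

text \<open>Substitution is contravariant: replacing \<open>x\<close> by \<open>A x\<close> in
  \<open>p(B x)\<close> gives \<open>p(B A x)\<close>.\<close>

lemma lin_subst_mult:
  assumes "A \<in> carrier_mat n n" "B \<in> carrier_mat n n"
  shows "lin_subst n A (lin_subst n B p) = lin_subst n (B * A) p"
proof -
  have "lin_subst n A (lin_form n B i) = lin_form n (B * A) i" for i
  proof (cases "i < n")
    case True
    have "(\<Sum>j<n. mC (B $$ (i, j)) * (\<Sum>l<n. mC (A $$ (j, l)) * mX l)) =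
        (\<Sum>l<n. (\<Sum>j<n. mC (B $$ (i, j) * A $$ (j, l))) * mX l)"
      unfolding sum_distrib_left sum_distrib_right
      by (subst sum.swap) (simp add: mC.hom_mult mult_ac)
    also have "\<dots> = (\<Sum>l<n. mC ((B * A) $$ (i, l)) * mX l)"
      using True assms by (intro sum.cong) (simp_all add: scalar_prod_def mC.hom_sum atLeast0LessThan)
    finally show ?thesis using True
      by (simp add: lin_form_def lin_subst.hom_sum lin_subst.hom_mult lin_subst_mX)
  qed (simp add: lin_form_def lin_subst_mX)
  then have X: "lin_subst n A (lin_subst n B (mX i)) = lin_subst n (B * A) (mX i)" for i
    by (simp only: lin_subst_mX)
  show ?thesis
    by (rule meval_unique[where F = "\<lambda>p. lin_subst n A (lin_subst n B p)",
          OF comm_ring_hom_compose[OF comm_ring_hom_lin_subst comm_ring_hom_lin_subst] comm_ring_hom_lin_subst _ X])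
       (simp only: lin_subst_mC)
qed

lemma lin_subst_one: "lin_subst n (1\<^sub>m n) p = p"
proof -
  have "lin_form n (1\<^sub>m n) = (mX :: nat \<Rightarrow> 'a mpoly)"
  proof
    fix i
    show "lin_form n (1\<^sub>m n) i = (mX i :: 'a mpoly)"
    proof (cases "i < n")
      case True
      have "(\<Sum>j<n. mC (1\<^sub>m n $$ (i, j)) * mX j) = (\<Sum>j<n. if i = j then mX j else 0 :: 'a mpoly)"
        using True by (intro sum.cong) auto
      then show ?thesis using True by (simp add: lin_form_def)
    qed (simp add: lin_form_def)
  qed
  then show ?thesis by (simp add: lin_subst_def)
qed

lemma lin_subst_polys: "p \<in> polys n \<Longrightarrow> lin_subst n A p \<in> polys n"
  unfolding lin_subst_def
  by (rule meval_closed)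
     (auto simp: lin_form_def intro!: polys_sum intro: polys_add polys_mult)

locale linear_group = group G for G :: "('g, 'b) monoid_scheme" (structure) +
  fixes n :: nat and \<rho> :: "'g \<Rightarrow> 'k::field mat"
  assumes fin: "finite (carrier G)" and rep: "representation G n \<rho>"
begin

lemma rho_carrier: "g \<in> carrier G \<Longrightarrow> \<rho> g \<in> carrier_mat n n"
  and rho_one: "\<rho> \<one> = 1\<^sub>m n"
  and rho_mult: "g \<in> carrier G \<Longrightarrow> h \<in> carrier G \<Longrightarrow> \<rho> (g \<otimes> h) = \<rho> g * \<rho> h"
  using rep unfolding representation_iff[OF group_axioms] by simp_all

definition pact :: "'g \<Rightarrow> 'k mpoly \<Rightarrow> 'k mpoly" where
  "pact g = lin_subst n (\<rho> g)"

text \<open>The right action that sends \<open>r(x)\<close> to \<open>r(\<rho> g x)\<close>. With it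
  equivariance reads \<open>act g f = \<sigma> g f\<close>, without inverses.\<close>

definition act :: "'g \<Rightarrow> 'k ratfun \<Rightarrow> 'k ratfun" where
  "act g = rf_subst n (\<rho> g)"

lemma comm_ring_hom_pact [simp]: "comm_ring_hom (pact g)"
  by (simp add: pact_def)

lemma pact_mult: "g \<in> carrier G \<Longrightarrow> h \<in> carrier G \<Longrightarrow> pact g (pact h p) = pact (h \<otimes> g) p"
  by (simp add: pact_def lin_subst_mult rho_carrier rho_mult)

lemma pact_one: "pact \<one> p = p"
  by (simp add: pact_def rho_one lin_subst_one)

lemma pact_eq_0_iff: "g \<in> carrier G \<Longrightarrow> pact g p = 0 \<longleftrightarrow> p = 0"
proof -
  assume g: "g \<in> carrier G"
  interpret comm_ring_hom "pact (inv g)" by simp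
  interpret g: comm_ring_hom "pact g" by simp
  have "pact (inv g) (pact g p) = p" using g by (simp add: pact_mult pact_one)
  then show ?thesis by (metis hom_zero g.hom_zero)
qed

lemma comm_ring_hom_to_fract_pact: "comm_ring_hom (\<lambda>p. to_fract (pact g p))"
  by (rule comm_ring_hom_compose) simp_all

lemma act_fext: "act g = fext (\<lambda>p. to_fract (pact g p))"
  by (simp add: act_def rf_subst_def pact_def)

lemma act_Fract:
  assumes "g \<in> carrier G" "b \<noteq> 0"
  shows "act g (Fract a b) = Fract (pact g a) (pact g b)"
  unfolding act_fext using assms
  by (subst fext_Fract) (simp_all add: comm_ring_hom_to_fract_pact pact_eq_0_iff Fract_conv_to_fract)

lemma lring_act: "g \<in> carrier G \<Longrightarrow> x \<in> lring (\<lambda>p. to_fract (pact g p))"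
  by (cases x) (auto simp: lring_def pact_eq_0_iff)

lemma act_to_fract [simp]: "act g (to_fract p) = to_fract (pact g p)"
  unfolding act_fext by (simp add: fext_to_fract comm_ring_hom_to_fract_pact)

lemma act_const [simp]: "act g (const_rf c) = const_rf c"
  by (simp add: const_rf_to_fract) (simp add: pact_def)

lemma field_hom_act:
  assumes "g \<in> carrier G" shows "field_hom (act g)"
proof -
  note s = comm_ring_hom_to_fract_pact[of g]
  have "comm_ring_hom (act g)"
    using act_const[of g 0] act_const[of g 1]
    by unfold_locales
       (simp_all add: act_fext fext_add[OF s] fext_mult[OF s] lring_act assms)
  then interpret comm_ring_hom "act g" .
  show ?thesis ..
qed

lemma act_mult: "g \<in> carrier G \<Longrightarrow> h \<in> carrier G \<Longrightarrow> act g (act h r) = act (h \<otimes> g) r"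
proof (cases r)
  case (Fract a b)
  assume gh: "g \<in> carrier G" "h \<in> carrier G"
  have "act g (act h (Fract a b)) = Fract (pact g (pact h a)) (pact g (pact h b))"
    using gh Fract by (simp only: act_Fract pact_eq_0_iff not_False_eq_True)
  then show ?thesis
    unfolding Fract(1) act_Fract[OF m_closed[OF gh(2,1)] Fract(2)] pact_mult[OF gh] .
qed

lemma act_one: "act \<one> r = r"
proof (cases r)
  case (Fract a b)
  show ?thesis unfolding Fract(1) act_Fract[OF one_closed Fract(2)] pact_one ..
qed

lemma act_ratfuns: "g \<in> carrier G \<Longrightarrow> r \<in> ratfuns n \<Longrightarrow> act g r \<in> ratfuns n"
proof -
  assume g: "g \<in> carrier G" and "r \<in> ratfuns n"
  then obtain a b where ab: "a \<in> polys n" "b \<in> polys n" "b \<noteq> 0" "r = Fract a b"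
    by (auto simp: ratfuns_iff)
  then have "pact g a \<in> polys n" "pact g b \<in> polys n" "pact g b \<noteq> 0"
    using g by (simp_all add: pact_def lin_subst_polys pact_eq_0_iff[unfolded pact_def])
  then show ?thesis unfolding ab(4) act_Fract[OF g ab(3)] ratfuns_iff by blast
qed

lemma poly_eval_pact:
  assumes g: "g \<in> carrier G" and p: "p \<in> polys n"
  shows "poly_eval (const_mat (\<rho> g) *\<^sub>v vec n var_rf) p = to_fract (pact g p)"
  unfolding poly_eval_meval
proof (rule meval_unique_polys[OF const_rf.comm_ring_hom_meval comm_ring_hom_to_fract_pact p])
  fix i assume i: "i < n"
  have "(const_mat (\<rho> g) *\<^sub>v vec n var_rf) $ i = (\<Sum>j<n. const_rf (\<rho> g $$ (i, j)) * var_rf j)"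
    using i rho_carrier[OF g] by (auto simp: scalar_prod_def atLeast0LessThan intro!: sum.cong)
  also have "\<dots> = to_fract (pact g (mX i))"
  proof -
    interpret tf: comm_ring_hom "to_fract :: 'k mpoly \<Rightarrow> _" by simp
    show ?thesis using i
      by (simp add: pact_def lin_subst_mX lin_form_def tf.hom_sum tf.hom_mult const_rf_to_fract var_rf_to_fract)
  qed
  finally show "meval const_rf (($) (const_mat (\<rho> g) *\<^sub>v vec n var_rf)) (mX i) = to_fract (pact g (mX i))"
    by simp
qed (simp_all add: const_rf_to_fract pact_def)

lemma ratfun_eval_act:
  assumes g: "g \<in> carrier G" and r: "r \<in> ratfuns n"
  shows "ratfun_eval (const_mat (\<rho> g) *\<^sub>v vec n var_rf) r = act g r"
proof -
  obtain a b where ab: "a \<in> polys n" "b \<in> polys n" "b \<noteq> 0" "r = Fract a b"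
    using r by (auto simp: ratfuns_iff)
  have "comm_ring_hom (poly_eval (const_mat (\<rho> g) *\<^sub>v vec n var_rf))"
    unfolding poly_eval_meval[abs_def] by (rule const_rf.comm_ring_hom_meval)
  then have "ratfun_eval (const_mat (\<rho> g) *\<^sub>v vec n var_rf) r = to_fract (pact g a) / to_fract (pact g b)"
    unfolding ratfun_eval_fext ab(4) using g ab(1-3)
    by (subst fext_Fract) (simp_all add: poly_eval_pact pact_eq_0_iff)
  then show ?thesis unfolding ab(4) act_Fract[OF g ab(3)] unfolding Fract_conv_to_fract .
qed

end

definition mact :: "nat \<Rightarrow> 'k::field mat \<Rightarrow> (nat \<Rightarrow> 'k ratfun) \<Rightarrow> nat \<Rightarrow> 'k ratfun" where
  "mact m A v i = (\<Sum>j<m. const_rf (A $$ (i, j)) * v j)"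

lemma mact_mult:
  assumes "A \<in> carrier_mat m m" "B \<in> carrier_mat m m" "i < m"
  shows "mact m (A * B) v i = mact m A (mact m B v) i"
proof -
  have "mact m (A * B) v i = (\<Sum>j<m. (\<Sum>l<m. const_rf (A $$ (i, l)) * const_rf (B $$ (l, j))) * v j)"
    unfolding mact_def using assms
    by (intro sum.cong) (simp_all add: scalar_prod_def const_rf.hom_sum const_rf.hom_mult atLeast0LessThan)
  also have "\<dots> = mact m A (mact m B v) i"
    unfolding mact_def sum_distrib_left sum_distrib_right
    by (subst sum.swap) (simp add: mult_ac)
  finally show ?thesis .
qed

lemma mact_one: "i < m \<Longrightarrow> mact m (1\<^sub>m m) v i = v i"
proof -
  assume i: "i < m"
  have "mact m (1\<^sub>m m) v i = (\<Sum>j<m. if i = j then v j else 0)"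
    unfolding mact_def using i by (intro sum.cong) auto
  then show ?thesis using i by simp
qed

lemma mact_cong: "(\<And>j. j < m \<Longrightarrow> v j = w j) \<Longrightarrow> mact m A v i = mact m A w i"
  by (simp add: mact_def)

lemma mact_scale: "mact m A (\<lambda>j. c * v j) i = c * mact m A v i"
  by (simp add: mact_def sum_distrib_left mult_ac)

lemma mult_mat_vec_mact:
  assumes "A \<in> carrier_mat m m" "f \<in> carrier_vec m" "i < m"
  shows "(const_mat A *\<^sub>v f) $ i = mact m A (($) f) i"
  using assms by (auto simp: mact_def scalar_prod_def atLeast0LessThan intro!: sum.cong)

context linear_group
begin

lemma covariant_iff:
  assumes "f \<in> carrier_vec m"
  shows "covariant G n \<rho> m \<sigma> f \<longleftrightarrow> representation G m \<sigma> \<and> rational_map n m f \<and>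
    (\<forall>g\<in>carrier G. \<forall>i<m. act g (f $ i) = mact m (\<sigma> g) (($) f) i)"
proof -
  have "map_vec (ratfun_eval (const_mat (\<rho> g) *\<^sub>v vec n var_rf)) f = const_mat (\<sigma> g) *\<^sub>v f \<longleftrightarrow>
      (\<forall>i<m. act g (f $ i) = mact m (\<sigma> g) (($) f) i)"
    if "representation G m \<sigma>" "rational_map n m f" "g \<in> carrier G" for g
  proof -
    have s: "\<sigma> g \<in> carrier_mat m m" using that representation_iff[OF group_axioms] by blast
    have f: "f $ i \<in> ratfuns n" if "i < m" for i using \<open>rational_map n m f\<close> that by (simp add: rational_map_def)
    have "map_vec (ratfun_eval (const_mat (\<rho> g) *\<^sub>v vec n var_rf)) f = const_mat (\<sigma> g) *\<^sub>v f \<longleftrightarrow>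
      (\<forall>i<m. ratfun_eval (const_mat (\<rho> g) *\<^sub>v vec n var_rf) (f $ i) = (const_mat (\<sigma> g) *\<^sub>v f) $ i)"
      using s assms by (subst vec_eq_iff) auto
    also have "\<dots> \<longleftrightarrow> (\<forall>i<m. act g (f $ i) = mact m (\<sigma> g) (($) f) i)"
      using ratfun_eval_act[OF that(3) f] mult_mat_vec_mact[OF s assms] by simp
    finally show ?thesis .
  qed
  then show ?thesis using rep by (auto simp: covariant_def)
qed

lemma stabilizer_iff:
  assumes "f \<in> carrier_vec m" "\<sigma> g \<in> carrier_mat m m"
  shows "const_mat (\<sigma> g) *\<^sub>v f = f \<longleftrightarrow> (\<forall>i<m. mact m (\<sigma> g) (($) f) i = f $ i)"
  using assms by (subst vec_eq_iff) (auto simp: mult_mat_vec_mact simp del: index_mult_mat_vec)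

end

section \<open>Equivariant projections in completely reducible representations\<close>

lemma subspace_module_vec_iff:
  "VectorSpace.subspace class_ring U (module_vec TYPE('k::field) n) \<longleftrightarrow>
    U \<subseteq> carrier_vec n \<and> 0\<^sub>v n \<in> U \<and> (\<forall>u\<in>U. \<forall>v\<in>U. u + v \<in> U) \<and> (\<forall>c. \<forall>u\<in>U. c \<cdot>\<^sub>v u \<in> U)"
  using vec_vs[where 'a = 'k, of n] vec_module[where 'a = 'k, of n]
  by (auto simp: VectorSpace.subspace_def submodule_def module_vec_simps class_ring_simps)

text \<open>The vectors supported on the first \<open>k\<close> coordinates are treated by induction
  on \<open>k\<close>. \<open>Q\<close> relates a vector to its image, so that membership statements
  involving both are covered.\<close>

lemma mat_vec_linear_extension:
  fixes A :: "'k::field mat"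
  assumes A: "A \<in> carrier_mat m n"
    and add: "\<And>u v. u \<in> carrier_vec n \<Longrightarrow> v \<in> carrier_vec n \<Longrightarrow> Q u (A *\<^sub>v u) \<Longrightarrow> Q v (A *\<^sub>v v) \<Longrightarrow>
      Q (u + v) (A *\<^sub>v u + A *\<^sub>v v)"
    and smult: "\<And>c u. u \<in> carrier_vec n \<Longrightarrow> Q u (A *\<^sub>v u) \<Longrightarrow> Q (c \<cdot>\<^sub>v u) (c \<cdot>\<^sub>v (A *\<^sub>v u))"
    and zero: "Q (0\<^sub>v n) (0\<^sub>v m)"
    and unit: "\<And>j. j < n \<Longrightarrow> Q (unit_vec n j) (A *\<^sub>v unit_vec n j)"
    and v: "v \<in> carrier_vec n"
  shows "Q v (A *\<^sub>v v)"
proof -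
  have "Q (vec n (\<lambda>i. if i < k then v $ i else 0)) (A *\<^sub>v vec n (\<lambda>i. if i < k then v $ i else 0))"
    if "k \<le> n" for k
    using that
  proof (induction k)
    case 0
    have "vec n (\<lambda>i. if i < 0 then v $ i else 0) = 0\<^sub>v n" by (auto simp: vec_eq_iff)
    moreover have "A *\<^sub>v 0\<^sub>v n = 0\<^sub>v m" using A by (auto simp: vec_eq_iff)
    ultimately show ?case using zero by simp
  next
    case (Suc k)
    let ?w = "vec n (\<lambda>i. if i < k then v $ i else 0)"
    have "vec n (\<lambda>i. if i < Suc k then v $ i else 0) = ?w + (v $ k) \<cdot>\<^sub>v unit_vec n k"
      using Suc.prems by (auto simp: vec_eq_iff less_Suc_eq)
    moreover have "Q (?w + (v $ k) \<cdot>\<^sub>v unit_vec n k) (A *\<^sub>v ?w + A *\<^sub>v ((v $ k) \<cdot>\<^sub>v unit_vec n k))"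
      using Suc smult[OF _ unit, of k "v $ k"] A by (intro add) (auto simp: mult_mat_vec)
    ultimately show ?case using A by (simp add: mult_add_distrib_mat_vec[of A m n])
  qed
  from this[of n] have "Q (vec n (\<lambda>i. if i < n then v $ i else 0)) (A *\<^sub>v vec n (\<lambda>i. if i < n then v $ i else 0))"
    by simp
  moreover have "vec n (\<lambda>i. if i < n then v $ i else 0) = v" using v by (auto simp: vec_eq_iff)
  ultimately show ?thesis by simp
qed

text \<open>Each column is the \<open>U'\<close>-component of a chosen decomposition of a unit
  vector; the stated memberships extend from unit vectors by linearity.\<close>

lemma projection_matrix:
  fixes U U' :: "'k::field vec set"
  assumes U: "VectorSpace.subspace class_ring U (module_vec TYPE('k) n)"
    and U': "VectorSpace.subspace class_ring U' (module_vec TYPE('k) n)"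
    and dec: "\<forall>v\<in>carrier_vec n. \<exists>u\<in>U. \<exists>u'\<in>U'. v = u + u'"
  shows "\<exists>P\<in>carrier_mat n n. \<forall>v\<in>carrier_vec n. P *\<^sub>v v \<in> U' \<and> v - P *\<^sub>v v \<in> U"
proof -
  note U = U[unfolded subspace_module_vec_iff] and U' = U'[unfolded subspace_module_vec_iff]
  have "\<forall>j. \<exists>w. j < n \<longrightarrow> w \<in> U' \<and> unit_vec n j - w \<in> U"
  proof (intro allI)
    fix j
    show "\<exists>w. j < n \<longrightarrow> w \<in> U' \<and> unit_vec n j - w \<in> U"
    proof (cases "j < n")
      case True
      then obtain u u' where u: "u \<in> U" "u' \<in> U'" "unit_vec n j = u + u'"
        using dec unit_vec_carrier by blast
      then have "u \<in> carrier_vec n" "u' \<in> carrier_vec n" using U U' by auto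
      then have "unit_vec n j - u' = u" unfolding u(3) by auto
      then show ?thesis using u by (intro exI[of _ u']) simp
    qed simp
  qed
  then obtain w where w: "\<And>j. j < n \<Longrightarrow> w j \<in> U'" "\<And>j. j < n \<Longrightarrow> unit_vec n j - w j \<in> U" by metis
  define P where "P = mat n n (\<lambda>(i, j). w j $ i)"
  have P: "P \<in> carrier_mat n n" by (simp add: P_def)
  have Pu: "P *\<^sub>v unit_vec n j = w j" if "j < n" for j
  proof -
    have "w j \<in> carrier_vec n" using w(1)[OF that] U' by auto
    then show ?thesis using that by (auto simp: vec_eq_iff P_def mult_mat_vec_def)
  qed
  let ?Q = "\<lambda>v x. x \<in> U' \<and> v - x \<in> U"
  have "?Q v (P *\<^sub>v v)" if v: "v \<in> carrier_vec n" for v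
  proof (rule mat_vec_linear_extension[OF P _ _ _ _ v, where Q = ?Q])
    fix x y assume xy: "x \<in> carrier_vec n" "y \<in> carrier_vec n" "?Q x (P *\<^sub>v x)" "?Q y (P *\<^sub>v y)"
    have "x + y - (P *\<^sub>v x + P *\<^sub>v y) = (x - P *\<^sub>v x) + (y - P *\<^sub>v y)"
      using xy P by (auto simp: vec_eq_iff)
    then show "?Q (x + y) (P *\<^sub>v x + P *\<^sub>v y)" using xy U U' by simp
  next
    fix c x assume x: "x \<in> carrier_vec n" "?Q x (P *\<^sub>v x)"
    have "c \<cdot>\<^sub>v x - c \<cdot>\<^sub>v (P *\<^sub>v x) = c \<cdot>\<^sub>v (x - P *\<^sub>v x)"
      using x P by (auto simp: vec_eq_iff algebra_simps)
    then show "?Q (c \<cdot>\<^sub>v x) (c \<cdot>\<^sub>v (P *\<^sub>v x))" using x U U' by simp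
  next
    have "0\<^sub>v n - 0\<^sub>v n = (0\<^sub>v n :: 'k vec)" by (auto simp: vec_eq_iff)
    then show "?Q (0\<^sub>v n) (0\<^sub>v n)" using U U' by simp
  next
    show "?Q (unit_vec n j) (P *\<^sub>v unit_vec n j)" if "j < n" for j using w Pu that by simp
  qed
  then show ?thesis using P by blast
qed

lemma mat_eq_by_vec:
  fixes A :: "'k::field mat"
  assumes "A \<in> carrier_mat m n" "B \<in> carrier_mat m n" "\<And>v. v \<in> carrier_vec n \<Longrightarrow> A *\<^sub>v v = B *\<^sub>v v"
  shows "A = B"
proof (rule eq_matI)
  fix i j assume ij: "i < dim_row B" "j < dim_col B"
  have "(A *\<^sub>v unit_vec n j) $ i = (B *\<^sub>v unit_vec n j) $ i" using assms(3) by simp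
  then show "A $$ (i, j) = B $$ (i, j)" using assms(1,2) ij by simp
qed (use assms in auto)

lemma mult_mat_vec_zero:
  "A \<in> carrier_mat m n \<Longrightarrow> A *\<^sub>v 0\<^sub>v n = (0\<^sub>v m :: 'k::field vec)"
  by (auto simp: vec_eq_iff)

text \<open>The complement of the fixed space of the normal closure of \<open>h\<close> contains no nonzero vector fixed
  by that normal closure.\<close>

lemma fixed_complement_projection:
  fixes \<sigma> :: "'g \<Rightarrow> 'k::field mat"
  assumes G: "group G" and rep: "representation G N \<sigma>" and cr: "completely_reducible G N \<sigma>"
    and h: "h \<in> carrier G" "\<sigma> h \<noteq> 1\<^sub>m N"
  shows "\<exists>P\<in>carrier_mat N N. P \<noteq> 0\<^sub>m N N \<and> P * P = P \<and> (\<forall>g\<in>carrier G. P * \<sigma> g = \<sigma> g * P) \<and>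
    (\<forall>u\<in>carrier_vec N. P *\<^sub>v u = u \<longrightarrow>
      (\<forall>l\<in>carrier G. \<sigma> (inv\<^bsub>G\<^esub> l \<otimes>\<^bsub>G\<^esub> h \<otimes>\<^bsub>G\<^esub> l) *\<^sub>v u = u) \<longrightarrow> u = 0\<^sub>v N)"
proof -
  interpret group G by fact
  note R = rep[unfolded representation_iff[OF G]]
  have sc: "\<sigma> g \<in> carrier_mat N N" if "g \<in> carrier G" for g using R that by blast
  have sm: "\<sigma> (g \<otimes>\<^bsub>G\<^esub> l) = \<sigma> g * \<sigma> l" if "g \<in> carrier G" "l \<in> carrier G" for g l using R that by blast
  let ?c = "\<lambda>l. inv\<^bsub>G\<^esub> l \<otimes>\<^bsub>G\<^esub> h \<otimes>\<^bsub>G\<^esub> l"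
  have cc: "?c l \<in> carrier G" if "l \<in> carrier G" for l using that h by simp
  define U where "U = {u \<in> carrier_vec N. \<forall>l\<in>carrier G. \<sigma> (?c l) *\<^sub>v u = u}"
  have sg: "\<sigma> g *\<^sub>v u \<in> U" if g: "g \<in> carrier G" and u: "u \<in> U" for g u
    unfolding U_def
  proof (intro CollectI conjI ballI)
    have uc: "u \<in> carrier_vec N" using u by (simp add: U_def)
    show "\<sigma> g *\<^sub>v u \<in> carrier_vec N" using sc[OF g] uc by simp
    fix l assume l: "l \<in> carrier G"
    \<comment> \<open>Conjugation by \<open>g\<close> permutes the conjugates of \<open>h\<close>,
      so their common fixed space is invariant.\<close>
    have "?c l \<otimes>\<^bsub>G\<^esub> g = g \<otimes>\<^bsub>G\<^esub> ?c (l \<otimes>\<^bsub>G\<^esub> g)"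
    proof -
      have "?c (l \<otimes>\<^bsub>G\<^esub> g) = inv\<^bsub>G\<^esub> g \<otimes>\<^bsub>G\<^esub> (?c l \<otimes>\<^bsub>G\<^esub> g)"
        using g l h by (simp add: inv_mult_group m_assoc)
      then show ?thesis using g cc[OF l] by (simp add: m_assoc[symmetric])
    qed
    then have "\<sigma> (?c l) * \<sigma> g = \<sigma> g * \<sigma> (?c (l \<otimes>\<^bsub>G\<^esub> g))"
      using sm[of "?c l" g] sm[of g "?c (l \<otimes>\<^bsub>G\<^esub> g)"] cc g l by simp
    then have "\<sigma> (?c l) *\<^sub>v (\<sigma> g *\<^sub>v u) = \<sigma> g *\<^sub>v (\<sigma> (?c (l \<otimes>\<^bsub>G\<^esub> g)) *\<^sub>v u)"
      using sc cc g l uc assoc_mult_mat_vec by (metis m_closed)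
    also have "\<dots> = \<sigma> g *\<^sub>v u" using u g l by (simp add: U_def)
    finally show "\<sigma> (?c l) *\<^sub>v (\<sigma> g *\<^sub>v u) = \<sigma> g *\<^sub>v u" .
  qed
  have Us: "VectorSpace.subspace class_ring U (module_vec TYPE('k) N)"
    unfolding subspace_module_vec_iff
  proof (intro conjI ballI allI)
    show "U \<subseteq> carrier_vec N" by (auto simp: U_def)
    show "0\<^sub>v N \<in> U" by (simp add: U_def mult_mat_vec_zero[OF sc[OF cc]])
    show "u + v \<in> U" if "u \<in> U" "v \<in> U" for u v
      using that by (simp add: U_def mult_add_distrib_mat_vec[OF sc[OF cc]])
    show "c \<cdot>\<^sub>v u \<in> U" if "u \<in> U" for c u
      using that by (simp add: U_def mult_mat_vec[OF sc[OF cc]])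
  qed
  then have "invariant_subspace G N \<sigma> U" using sg by (simp add: invariant_subspace_def)
  from cr[unfolded completely_reducible_def, rule_format, OF this] obtain U' where U': "invariant_subspace G N \<sigma> U'" "U \<inter> U' = {0\<^sub>v N}"
      "\<forall>v\<in>carrier_vec N. \<exists>u\<in>U. \<exists>u'\<in>U'. v = u + u'"
    by auto
  have Us': "VectorSpace.subspace class_ring U' (module_vec TYPE('k) N)"
    and sg': "\<And>g u. g \<in> carrier G \<Longrightarrow> u \<in> U' \<Longrightarrow> \<sigma> g *\<^sub>v u \<in> U'"
    using U'(1) by (auto simp: invariant_subspace_def)
  obtain P where P: "P \<in> carrier_mat N N" "\<And>v. v \<in> carrier_vec N \<Longrightarrow> P *\<^sub>v v \<in> U'"
      "\<And>v. v \<in> carrier_vec N \<Longrightarrow> v - P *\<^sub>v v \<in> U"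
    using projection_matrix[OF Us Us' U'(3)] by blast
  note Us = Us[unfolded subspace_module_vec_iff] and Us' = Us'[unfolded subspace_module_vec_iff]
  have neg: "- x \<in> W" if "x \<in> W" "\<forall>c. \<forall>u\<in>W. c \<cdot>\<^sub>v u \<in> W" "W \<subseteq> carrier_vec N"
    for x :: "'k vec" and W
  proof -
    have "- x = (- 1) \<cdot>\<^sub>v x" using that by (auto simp: vec_eq_iff)
    then show ?thesis using that by simp
  qed
  \<comment> \<open>Since \<open>U\<close> and \<open>U'\<close> meet in 0, the two memberships
    determine the projection. Idempotence and commutation with the group follow from this
    uniqueness.\<close>
  have uniq: "P *\<^sub>v v = w" if v: "v \<in> carrier_vec N" and w: "w \<in> U'" "v - w \<in> U" for v w
  proof -
    have wc: "w \<in> carrier_vec N" and pc: "P *\<^sub>v v \<in> carrier_vec N" using w Us' P(1) v by auto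
    have "w - P *\<^sub>v v = w + - (P *\<^sub>v v)" using wc pc by auto
    then have 1: "w - P *\<^sub>v v \<in> U'" using neg[OF P(2)[OF v]] Us' w(1) by simp
    have "w - p = (v - p) + - (v - w)" if "p \<in> carrier_vec N" for p
      using that wc v by (auto simp: vec_eq_iff)
    from this[OF pc] have "w - P *\<^sub>v v = (v - P *\<^sub>v v) + - (v - w)" .
    then have "w - P *\<^sub>v v \<in> U" using neg[OF w(2)] Us P(3)[OF v] by simp
    then have "w - P *\<^sub>v v = 0\<^sub>v N" using 1 U'(2) by blast
    then have "(w - P *\<^sub>v v) $ i = 0" if "i < N" for i using that by simp
    then show ?thesis using wc pc P(1) by (auto simp: vec_eq_iff)
  qed
  have self: "P *\<^sub>v w = w" if "w \<in> U'" for w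
  proof -
    have "w \<in> carrier_vec N" using that Us' by blast
    moreover from this have "w - w = 0\<^sub>v N" by auto
    ultimately show ?thesis using uniq[of w w] that Us by simp
  qed
  have "P * P = P"
    by (rule mat_eq_by_vec[of _ N N]) (use P(1) self[OF P(2)] in \<open>auto simp: assoc_mult_mat_vec[of _ N N _ N]\<close>)
  moreover have "P * \<sigma> g = \<sigma> g * P" if g: "g \<in> carrier G" for g
  proof (rule mat_eq_by_vec[of _ N N])
    fix v :: "'k vec" assume v: "v \<in> carrier_vec N"
    note s = sc[OF g]
    have "\<sigma> g *\<^sub>v v - \<sigma> g *\<^sub>v (P *\<^sub>v v) = \<sigma> g *\<^sub>v (v - P *\<^sub>v v)"
      using s v P(1) by (simp add: mult_minus_distrib_mat_vec[of _ N N])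
    then have "P *\<^sub>v (\<sigma> g *\<^sub>v v) = \<sigma> g *\<^sub>v (P *\<^sub>v v)"
      using sg[OF g P(3)[OF v]] sg'[OF g P(2)[OF v]] s v by (intro uniq) auto
    then show "(P * \<sigma> g) *\<^sub>v v = (\<sigma> g * P) *\<^sub>v v"
      using s v P(1) by (simp add: assoc_mult_mat_vec[of _ N N _ N])
  qed (use P(1) sc[OF g] in auto)
  moreover have "P \<noteq> 0\<^sub>m N N"
  proof
    assume P0: "P = 0\<^sub>m N N"
    have "v \<in> U" if "v \<in> carrier_vec N" for v
    proof -
      have "P *\<^sub>v v = 0\<^sub>v N" "v - 0\<^sub>v N = v" unfolding P0 using that by (auto simp: vec_eq_iff)
      then show ?thesis using P(3)[OF that] by simp
    qed
    then have "\<sigma> (?c \<one>\<^bsub>G\<^esub>) *\<^sub>v v = v" if "v \<in> carrier_vec N" for v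
      using that unfolding U_def by blast
    then have "\<sigma> h = 1\<^sub>m N"
      using h(1) sc by (intro mat_eq_by_vec[of _ N N]) auto
    then show False using h(2) by simp
  qed
  moreover have "u = 0\<^sub>v N" if u: "u \<in> carrier_vec N" "P *\<^sub>v u = u" "\<forall>l\<in>carrier G. \<sigma> (?c l) *\<^sub>v u = u" for u
  proof -
    have "u \<in> U" using u by (simp add: U_def)
    moreover have "u \<in> U'" using P(2)[OF u(1)] u(2) by simp
    ultimately show ?thesis using U'(2) by blast
  qed
  ultimately show ?thesis using P(1) by blast
qed

section \<open>Families of covariants into the projected representations\<close>

lemma lookup_mC_mult: "Poly_Mapping.lookup (mC c * p) \<mu> = c * Poly_Mapping.lookup p \<mu>"
  unfolding mult_map_scale_conv_mult[symmetric] by (simp add: Poly_Mapping.map.rep_eq when_def)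

section \<open>Direct sums of copies of a representation\<close>

lemma sum_blocks: "(\<Sum>j<L * N. F j) = (\<Sum>b<L. \<Sum>r<N. F (b * N + r))" for F :: "nat \<Rightarrow> 'a::comm_monoid_add"
proof -
  have "(\<Sum>j<L * N. F j) = (\<Sum>b<L. sum F {b * N..<b * N + N})" by (simp add: sum.nat_group)
  also have "\<dots> = (\<Sum>b<L. \<Sum>r<N. F (b * N + r))"
  proof (rule sum.cong)
    fix b
    show "sum F {b * N..<b * N + N} = (\<Sum>r<N. F (b * N + r))"
      using sum.shift_bounds_nat_ivl[of F 0 "b * N" N] by (simp add: add.commute atLeast0LessThan)
  qed simp
  finally show ?thesis .
qed

text \<open>The direct sum of \<open>L\<close> copies of \<open>A\<close>; index \<open>i\<close>
  stands for position \<open>i mod N\<close> in block \<open>i div N\<close>.\<close>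

definition block_mat :: "nat \<Rightarrow> nat \<Rightarrow> 'k::field mat \<Rightarrow> 'k mat" where
  "block_mat L N A = mat (L * N) (L * N)
     (\<lambda>(i, j). if i div N = j div N then A $$ (i mod N, j mod N) else 0)"

lemma block_mat_carrier [simp]: "block_mat L N A \<in> carrier_mat (L * N) (L * N)"
  by (simp add: block_mat_def)

lemma block_index:
  fixes i :: nat
  assumes "i < L * N" shows "i div N < L" "i mod N < N"
proof -
  have "N > 0" using assms by (cases N) auto
  then show "i div N < L" "i mod N < N" using assms by (simp_all add: less_mult_imp_div_less)
qed

lemma sum_block_row:
  assumes i: "i < L * N"
  shows "(\<Sum>j<L * N. block_mat L N A $$ (i, j) * F j) = (\<Sum>r<N. A $$ (i mod N, r) * F (i div N * N + r))"
proof -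
  have N: "N > 0" using i by (cases N) auto
  have lt: "b * N + r < L * N" if "b < L" "r < N" for b r
  proof -
    have "b * N + r < Suc b * N" using that by simp
    also have "\<dots> \<le> L * N" using that by (intro mult_le_mono1) simp
    finally show ?thesis .
  qed
  have "(\<Sum>j<L * N. block_mat L N A $$ (i, j) * F j) =
     (\<Sum>b<L. if i div N = b then \<Sum>r<N. A $$ (i mod N, r) * F (b * N + r) else 0)"
    unfolding sum_blocks using i N lt by (intro sum.cong) (auto simp: block_mat_def)
  then show ?thesis using block_index[OF i] by simp
qed

lemma block_mat_mult:
  assumes "A \<in> carrier_mat N N" "B \<in> carrier_mat N N"
  shows "block_mat L N (A * B) = block_mat L N A * block_mat L N B"
proof (rule eq_matI)
  fix i j assume "i < dim_row (block_mat L N A * block_mat L N B)" "j < dim_col (block_mat L N A * block_mat L N B)"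
  then have ij: "i < L * N" "j < L * N" by (simp_all add: block_mat_def)
  have N: "N > 0" using ij by (cases N) auto
  have lt: "i div N * N + r < L * N" if "r < N" for r
  proof -
    have "i div N * N + r < Suc (i div N) * N" using that by simp
    also have "\<dots> \<le> L * N" using block_index[OF ij(1)] by (intro mult_le_mono1) simp
    finally show ?thesis .
  qed
  have "(block_mat L N A * block_mat L N B) $$ (i, j) =
      (\<Sum>l<L * N. block_mat L N A $$ (i, l) * block_mat L N B $$ (l, j))"
    using ij by (simp add: block_mat_def scalar_prod_def atLeast0LessThan)
  also have "\<dots> = (\<Sum>r<N. A $$ (i mod N, r) * block_mat L N B $$ (i div N * N + r, j))"
    by (rule sum_block_row[OF ij(1)])
  also have "\<dots> = (\<Sum>r<N. A $$ (i mod N, r) * (if i div N = j div N then B $$ (r, j mod N) else 0))"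
    using ij lt N by (intro sum.cong) (auto simp: block_mat_def)
  also have "\<dots> = block_mat L N (A * B) $$ (i, j)"
    using ij assms block_index[OF ij(1)] block_index[OF ij(2)]
    by (auto simp: block_mat_def scalar_prod_def atLeast0LessThan)
  finally show "block_mat L N (A * B) $$ (i, j) = (block_mat L N A * block_mat L N B) $$ (i, j)" by simp
qed (simp_all add: block_mat_def)

lemma block_mat_one: "block_mat L N (1\<^sub>m N) = 1\<^sub>m (L * N)"
proof (rule eq_matI)
  fix i j assume "i < dim_row (1\<^sub>m (L * N) :: 'a mat)" "j < dim_col (1\<^sub>m (L * N) :: 'a mat)"
  then have ij: "i < L * N" "j < L * N" by simp_all
  have "i = j \<longleftrightarrow> i div N = j div N \<and> i mod N = j mod N" by (metis div_mult_mod_eq)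
  then show "block_mat L N (1\<^sub>m N) $$ (i, j) = (1\<^sub>m (L * N) :: 'a mat) $$ (i, j)"
    using ij block_index[OF ij(1)] block_index[OF ij(2)] by (auto simp: block_mat_def)
qed (simp_all add: block_mat_def)

lemma mact_block_mat:
  assumes "i < L * N"
  shows "mact (L * N) (block_mat L N A) v i = mact N A (\<lambda>r. v (i div N * N + r)) (i mod N)"
proof -
  have N: "N > 0" using assms by (cases N) auto
  have lt: "b * N + r < L * N" if "b < L" "r < N" for b r
  proof -
    have "b * N + r < Suc b * N" using that by simp
    also have "\<dots> \<le> L * N" using that by (intro mult_le_mono1) simp
    finally show ?thesis .
  qed
  have "mact (L * N) (block_mat L N A) v i =
     (\<Sum>b<L. if i div N = b then \<Sum>r<N. const_rf (A $$ (i mod N, r)) * v (b * N + r) else 0)"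
    unfolding mact_def sum_blocks using assms N lt by (intro sum.cong) (auto simp: block_mat_def)
  then show ?thesis using block_index[OF assms] by (simp add: mact_def)
qed

text \<open>Of complete reducibility only the projections \<open>Pr h\<close> are retained: by
  \<open>Pr_fixed\<close> the image of \<open>Pr h\<close> contains no nonzero vector fixed by all
  conjugates of \<open>h\<close>. The target \<open>\<sigma>\<close> and the projections do not
  depend on the source \<open>\<rho>\<close>, so covariants with different sources are treated
  alike.\<close>

locale covariant_setting = linear_group G n \<rho>
  for G :: "('g, 'b) monoid_scheme" (structure) and n and \<rho> :: "'g \<Rightarrow> 'k::field mat" +
  fixes N :: nat and \<sigma> :: "'g \<Rightarrow> 'k mat" and Pr :: "'g \<Rightarrow> 'k mat"
  assumes rep_sigma: "representation G N \<sigma>"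
    and Pr_carrier: "\<And>h. h \<in> carrier G - {\<one>} \<Longrightarrow> Pr h \<in> carrier_mat N N"
    and Pr_nonzero: "\<And>h. h \<in> carrier G - {\<one>} \<Longrightarrow> Pr h \<noteq> 0\<^sub>m N N"
    and Pr_idem: "\<And>h. h \<in> carrier G - {\<one>} \<Longrightarrow> Pr h * Pr h = Pr h"
    and Pr_comm: "\<And>h g. h \<in> carrier G - {\<one>} \<Longrightarrow> g \<in> carrier G \<Longrightarrow> Pr h * \<sigma> g = \<sigma> g * Pr h"
    and Pr_fixed: "\<And>h u. h \<in> carrier G - {\<one>} \<Longrightarrow> u \<in> carrier_vec N \<Longrightarrow> Pr h *\<^sub>v u = u \<Longrightarrow>
      (\<And>l. l \<in> carrier G \<Longrightarrow> \<sigma> (inv l \<otimes> h \<otimes> l) *\<^sub>v u = u) \<Longrightarrow> u = 0\<^sub>v N"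
begin

lemma sigma_carrier: "g \<in> carrier G \<Longrightarrow> \<sigma> g \<in> carrier_mat N N"
  and sigma_one: "\<sigma> \<one> = 1\<^sub>m N"
  and sigma_mult: "g \<in> carrier G \<Longrightarrow> h \<in> carrier G \<Longrightarrow> \<sigma> (g \<otimes> h) = \<sigma> g * \<sigma> h"
  using rep_sigma unfolding representation_iff[OF group_axioms] by simp_all

definition equivariant :: "(nat \<Rightarrow> 'k ratfun) \<Rightarrow> bool" where
  "equivariant v \<longleftrightarrow> (\<forall>g\<in>carrier G. \<forall>i<N. act g (v i) = mact N (\<sigma> g) v i)"

text \<open>Nonzero covariants into the images of the projections. Faithfulness of the whole family
  is automatic by \<open>good_not_fixed\<close>, so constructions only have to preserve these linear
  conditions and nonvanishing.\<close>

definition good :: "('g \<Rightarrow> nat \<Rightarrow> 'k ratfun) \<Rightarrow> bool" where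
  "good \<psi> \<longleftrightarrow> (\<forall>h\<in>carrier G - {\<one>}. (\<forall>i<N. \<psi> h i \<in> ratfuns n) \<and> equivariant (\<psi> h) \<and>
     (\<forall>i<N. mact N (Pr h) (\<psi> h) i = \<psi> h i) \<and> (\<exists>i<N. \<psi> h i \<noteq> 0))"

lemma goodD:
  assumes "good \<psi>" "h \<in> carrier G" "h \<noteq> \<one>"
  shows "\<And>i. i < N \<Longrightarrow> \<psi> h i \<in> ratfuns n"
    "\<And>g i. g \<in> carrier G \<Longrightarrow> i < N \<Longrightarrow> act g (\<psi> h i) = mact N (\<sigma> g) (\<psi> h) i"
    "\<And>i. i < N \<Longrightarrow> mact N (Pr h) (\<psi> h) i = \<psi> h i" "\<exists>i<N. \<psi> h i \<noteq> 0"
  using assms by (auto simp: good_def equivariant_def)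

text \<open>A linear system over \<open>k\<close> with a nonzero solution in rational functions has a nonzero solution
  over \<open>k\<close>, given by the coefficients of a monomial after clearing denominators.\<close>

lemma solution_over_base:
  fixes v :: "nat \<Rightarrow> 'k ratfun"
  assumes v: "\<And>i. i < N \<Longrightarrow> v i \<in> ratfuns n" "\<exists>i<N. v i \<noteq> 0"
    and A: "\<And>A i. A \<in> \<A> \<Longrightarrow> i < N \<Longrightarrow> mact N A v i = v i" "\<And>A. A \<in> \<A> \<Longrightarrow> A \<in> carrier_mat N N"
  shows "\<exists>u\<in>carrier_vec N. u \<noteq> 0\<^sub>v N \<and> (\<forall>A\<in>\<A>. A *\<^sub>v u = u)"
proof -
  obtain b where b: "b \<noteq> 0" "\<forall>r\<in>v ` {..<N}. \<exists>a\<in>polys n. r = Fract a b"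
    using common_denominator[of "v ` {..<N}" n] v(1) by auto
  then have "\<forall>i. \<exists>a. i < N \<longrightarrow> v i = Fract a b" by auto
  then obtain a where a: "\<And>i. i < N \<Longrightarrow> v i = Fract (a i) b" by metis
  obtain i0 where i0: "i0 < N" "v i0 \<noteq> 0" using v(2) by blast
  then have "a i0 \<noteq> 0" using a[OF i0(1)] by (auto simp: fract_collapse)
  then obtain \<mu> where mu: "Poly_Mapping.lookup (a i0) \<mu> \<noteq> 0" by (metis poly_mapping_eqI lookup_zero)
  define u where "u = vec N (\<lambda>i. Poly_Mapping.lookup (a i) \<mu>)"
  have "u \<noteq> 0\<^sub>v N"
  proof
    assume "u = 0\<^sub>v N"
    then have "u $ i0 = 0" using i0 by simp
    then show False using mu i0 by (simp add: u_def)
  qed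
  moreover have "M *\<^sub>v u = u" if M: "M \<in> \<A>" for M
  proof -
    note Mc = A(2)[OF M]
    have "(M *\<^sub>v u) $ i = u $ i" if i: "i < N" for i
    proof -
      interpret tf: comm_ring_hom "to_fract :: 'k mpoly \<Rightarrow> _" by simp
      have "mact N M v i = (\<Sum>j<N. to_fract (mC (M $$ (i, j)) * a j)) / to_fract b"
        unfolding mact_def sum_divide_distrib
        by (intro sum.cong) (simp_all add: a const_rf_to_fract Fract_conv_to_fract tf.hom_mult)
      also have "mact N M v i = v i" using A(1)[OF M i] .
      also have "v i = to_fract (a i) / to_fract b" using a[OF i] by (simp only: Fract_conv_to_fract)
      finally have "(\<Sum>j<N. to_fract (mC (M $$ (i, j)) * a j)) = to_fract (a i)"
        using b(1) by (auto simp only: divide_cancel_right to_fract_eq_0_iff)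
      then have "to_fract (\<Sum>j<N. mC (M $$ (i, j)) * a j) = to_fract (a i)"
        unfolding tf.hom_sum .
      then have "(\<Sum>j<N. mC (M $$ (i, j)) * a j) = a i" by (simp only: to_fract_eq_iff)
      from arg_cong[OF this, of "\<lambda>p. Poly_Mapping.lookup p \<mu>"]
      have "(\<Sum>j<N. M $$ (i, j) * Poly_Mapping.lookup (a j) \<mu>) = Poly_Mapping.lookup (a i) \<mu>"
        by (simp add: lookup_sum lookup_mC_mult)
      then show ?thesis using Mc i by (simp add: u_def scalar_prod_def atLeast0LessThan)
    qed
    then show ?thesis using Mc by (auto simp: vec_eq_iff u_def)
  qed
  ultimately show ?thesis by (intro bexI[of _ u]) (auto simp: u_def)
qed

text \<open>Applying \<open>act l\<close> to the eigenvector equation replaces \<open>v\<close> by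
  \<open>\<sigma> l\<close> applied to \<open>v\<close>, because \<open>v\<close> is equivariant,
  and leaves \<open>c\<close> alone. Multiplying by the inverse of \<open>\<sigma> l\<close> gives
  the equation for the conjugate.\<close>

lemma scalar_conj:
  assumes v: "equivariant v" and x: "x \<in> carrier G" and l: "l \<in> carrier G" and c: "act l c = c"
    and sc: "\<And>i. i < N \<Longrightarrow> mact N (\<sigma> x) v i = c * v i" and i: "i < N"
  shows "mact N (\<sigma> (inv l \<otimes> x \<otimes> l)) v i = c * v i"
proof -
  interpret al: field_hom "act l" by (rule field_hom_act[OF l])
  have av: "act l (v j) = mact N (\<sigma> l) v j" if "j < N" for j using v l that by (simp add: equivariant_def)
  have "mact N (\<sigma> x * \<sigma> l) v j = c * mact N (\<sigma> l) v j" if j: "j < N" for j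
  proof -
    have "act l (mact N (\<sigma> x) v j) = mact N (\<sigma> x) (mact N (\<sigma> l) v) j"
      unfolding mact_def[of N "\<sigma> x"] al.hom_sum al.hom_mult act_const using av by simp
    then show ?thesis
      using sc[OF j] av[OF j] c x l j by (simp add: al.hom_mult mact_mult sigma_carrier)
  qed
  then have e: "mact N (\<sigma> x * \<sigma> l) v j = (\<lambda>j. c * mact N (\<sigma> l) v j) j" if "j < N" for j
    using that by simp
  have "mact N (\<sigma> (inv l \<otimes> x \<otimes> l)) v i = mact N (\<sigma> (inv l) * (\<sigma> x * \<sigma> l)) v i"
    using x l by (simp add: m_assoc sigma_mult)
  also have "\<dots> = mact N (\<sigma> (inv l)) (mact N (\<sigma> x * \<sigma> l) v) i"
    using x l i by (intro mact_mult mult_carrier_mat[of _ N N] sigma_carrier) auto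
  also have "\<dots> = mact N (\<sigma> (inv l)) (\<lambda>j. c * mact N (\<sigma> l) v j) i"
    by (rule mact_cong) (rule e)
  also have "\<dots> = c * mact N (\<sigma> (inv l) * \<sigma> l) v i"
    unfolding mact_scale using l i sigma_carrier by (subst mact_mult) auto
  also have "\<sigma> (inv l) * \<sigma> l = 1\<^sub>m N" using l sigma_mult[of "inv l" l] by (simp add: sigma_one)
  finally show ?thesis using i by (simp add: mact_one)
qed

text \<open>If \<open>h\<close> fixed \<open>\<psi> h\<close>, all its conjugates would, by
  \<open>scalar_conj\<close> with scalar 1. These equations, and the one for the image of
  \<open>Pr h\<close>, are linear over \<open>k\<close>, so they would have a nonzero solution over
  \<open>k\<close>, against \<open>Pr_fixed\<close>.\<close>

lemma good_not_fixed:
  assumes good: "good \<psi>" and h: "h \<in> carrier G" "h \<noteq> \<one>"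
  shows "\<exists>i<N. mact N (\<sigma> h) (\<psi> h) i \<noteq> \<psi> h i"
proof (rule ccontr)
  assume "\<not> ?thesis"
  then have fx: "\<And>i. i < N \<Longrightarrow> mact N (\<sigma> h) (\<psi> h) i = \<psi> h i" by blast
  note D = goodD[OF good h]
  let ?A = "insert (Pr h) ((\<lambda>l. \<sigma> (inv l \<otimes> h \<otimes> l)) ` carrier G)"
  have "equivariant (\<psi> h)" using good h by (simp add: good_def)
  then have conj: "mact N (\<sigma> (inv l \<otimes> h \<otimes> l)) (\<psi> h) i = \<psi> h i" if "l \<in> carrier G" "i < N" for l i
    using scalar_conj[of "\<psi> h" h l 1 i] fx h that field_hom_act[of l] act_const[of l 1] by simp
  have "\<exists>u\<in>carrier_vec N. u \<noteq> 0\<^sub>v N \<and> (\<forall>A\<in>?A. A *\<^sub>v u = u)"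
  proof (rule solution_over_base)
    show "mact N A (\<psi> h) i = \<psi> h i" if "A \<in> ?A" "i < N" for A i using that D(3) conj by auto
    show "A \<in> carrier_mat N N" if "A \<in> ?A" for A using that Pr_carrier sigma_carrier h by auto
  qed (use D in auto)
  then show False using Pr_fixed h by auto
qed

section \<open>Assembling a family into one covariant\<close>

definition elems :: "'g list" where "elems = (SOME hs. set hs = carrier G - {\<one>})"

lemma set_elems: "set elems = carrier G - {\<one>}"
proof -
  have "\<exists>hs. set hs = carrier G - {\<one>}" using fin by (intro finite_list) simp
  then show ?thesis unfolding elems_def by (rule someI_ex)
qed

definition flat_dim :: nat where "flat_dim = length elems * N"

definition flat_rep :: "'g \<Rightarrow> 'k mat" where "flat_rep g = block_mat (length elems) N (\<sigma> g)"

definition flatten :: "('g \<Rightarrow> nat \<Rightarrow> 'k ratfun) \<Rightarrow> 'k ratfun vec" where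
  "flatten \<psi> = vec flat_dim (\<lambda>i. \<psi> (elems ! (i div N)) (i mod N))"

lemma flatten_components: "($) (flatten \<psi>) ` {..<flat_dim} = {\<psi> h i | h i. h \<in> carrier G - {\<one>} \<and> i < N}"
proof (intro subset_antisym subsetI)
  fix x assume "x \<in> ($) (flatten \<psi>) ` {..<flat_dim}"
  then obtain i where "i < flat_dim" "x = \<psi> (elems ! (i div N)) (i mod N)" by (auto simp: flatten_def)
  then show "x \<in> {\<psi> h i | h i. h \<in> carrier G - {\<one>} \<and> i < N}"
    using block_index[of i "length elems" N] set_elems nth_mem unfolding flat_dim_def by blast
next
  fix x assume "x \<in> {\<psi> h i | h i. h \<in> carrier G - {\<one>} \<and> i < N}"
  then obtain h i where "h \<in> carrier G - {\<one>}" and i: "i < N" and x: "x = \<psi> h i" by blast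
  then obtain b where b: "b < length elems" "h = elems ! b"
    using set_elems by (metis in_set_conv_nth)
  have "b * N + i < Suc b * N" using i by simp
  also have "\<dots> \<le> length elems * N" using b by (intro mult_le_mono1) simp
  finally have "b * N + i < flat_dim" by (simp add: flat_dim_def)
  moreover from this have "flatten \<psi> $ (b * N + i) = x" using i x b by (simp add: flatten_def)
  ultimately show "x \<in> ($) (flatten \<psi>) ` {..<flat_dim}" by (metis imageI lessThan_iff)
qed

lemma flatten_rational: "good \<psi> \<Longrightarrow> rational_map n flat_dim (flatten \<psi>)"
proof -
  assume good: "good \<psi>"
  have "flatten \<psi> $ i \<in> ratfuns n" if "i < flat_dim" for i
  proof -
    have "flatten \<psi> $ i \<in> {\<psi> h i | h i. h \<in> carrier G - {\<one>} \<and> i < N}"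
      using flatten_components[of \<psi>] that by blast
    then show ?thesis using goodD(1)[OF good] by auto
  qed
  then show ?thesis by (simp add: rational_map_def flatten_def)
qed

text \<open>An element \<open>g\<close> other than 1 is detected by its own block
  \<open>\<psi> g\<close>.\<close>

lemma flatten_faithful_covariant:
  assumes good: "good \<psi>"
  shows "faithful_covariant G n \<rho> flat_dim flat_rep (flatten \<psi>)"
proof -
  let ?L = "length elems"
  have rep': "representation G flat_dim flat_rep"
    unfolding representation_iff[OF group_axioms] flat_rep_def flat_dim_def
    by (simp add: sigma_one block_mat_one sigma_mult block_mat_mult sigma_carrier)
  have car: "flatten \<psi> \<in> carrier_vec flat_dim" by (simp add: flatten_def)
  have el: "elems ! (i div N) \<in> carrier G - {\<one>}" "i mod N < N" if "i < flat_dim" for i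
    using block_index[of i ?L N] that set_elems nth_mem unfolding flat_dim_def by blast+
  have ma: "mact flat_dim (flat_rep g) (($) (flatten \<psi>)) i = mact N (\<sigma> g) (\<psi> (elems ! (i div N))) (i mod N)"
    if i: "i < flat_dim" for g i
  proof -
    have "mact flat_dim (flat_rep g) (($) (flatten \<psi>)) i =
        mact N (\<sigma> g) (\<lambda>r. flatten \<psi> $ (i div N * N + r)) (i mod N)"
      using i unfolding flat_dim_def flat_rep_def by (rule mact_block_mat)
    also have "\<dots> = mact N (\<sigma> g) (\<psi> (elems ! (i div N))) (i mod N)"
    proof (rule mact_cong)
      fix r assume r: "r < N"
      have "i div N * N + r < Suc (i div N) * N" using r by simp
      also have "\<dots> \<le> ?L * N" using block_index[of i ?L N] i unfolding flat_dim_def by (intro mult_le_mono1) simp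
      finally show "flatten \<psi> $ (i div N * N + r) = \<psi> (elems ! (i div N)) r"
        using r by (simp add: flatten_def flat_dim_def)
    qed
    finally show ?thesis .
  qed
  have "covariant G n \<rho> flat_dim flat_rep (flatten \<psi>)"
    unfolding covariant_iff[OF car]
  proof (intro conjI ballI allI impI)
    fix g i assume "g \<in> carrier G" "i < flat_dim"
    then show "act g (flatten \<psi> $ i) = mact flat_dim (flat_rep g) (($) (flatten \<psi>)) i"
      using ma[of i g] goodD(2)[OF good, of "elems ! (i div N)" g "i mod N"] el[of i] by (simp add: flatten_def)
  qed (use rep' flatten_rational[OF good] in auto)
  moreover have "{g \<in> carrier G. const_mat (flat_rep g) *\<^sub>v flatten \<psi> = flatten \<psi>} = {\<one>}"
  proof (intro subset_antisym subsetI)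
    fix g assume "g \<in> {g \<in> carrier G. const_mat (flat_rep g) *\<^sub>v flatten \<psi> = flatten \<psi>}"
    then have g: "g \<in> carrier G" and st: "const_mat (flat_rep g) *\<^sub>v flatten \<psi> = flatten \<psi>" by auto
    have fc: "flat_rep g \<in> carrier_mat flat_dim flat_dim" by (simp add: flat_rep_def flat_dim_def)
    show "g \<in> {\<one>}"
    proof (rule ccontr)
      assume "g \<notin> {\<one>}"
      then obtain i where i: "i < N" "mact N (\<sigma> g) (\<psi> g) i \<noteq> \<psi> g i"
        using good_not_fixed[OF good g] by blast
      obtain b where b: "b < ?L" "elems ! b = g"
        using \<open>g \<notin> {\<one>}\<close> g set_elems by (metis Diff_iff in_set_conv_nth)
      have "b * N + i < Suc b * N" using i by simp
      also have "\<dots> \<le> ?L * N" using b by (intro mult_le_mono1) simp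
      finally have lt: "b * N + i < flat_dim" by (simp add: flat_dim_def)
      have "mact flat_dim (flat_rep g) (($) (flatten \<psi>)) (b * N + i) = flatten \<psi> $ (b * N + i)"
        using st lt stabilizer_iff[where \<sigma> = flat_rep and g = g, OF car fc] by blast
      then show False using ma[OF lt] i b lt by (simp add: flatten_def)
    qed
  next
    fix g assume "g \<in> {\<one>}"
    then show "g \<in> {g \<in> carrier G. const_mat (flat_rep g) *\<^sub>v flatten \<psi> = flatten \<psi>}"
      using car stabilizer_iff[OF car, of flat_rep \<one>] rep'[unfolded representation_iff[OF group_axioms]]
      by (simp add: mact_one)
  qed
  ultimately show ?thesis by (simp add: faithful_covariant_def)
qed

end

section \<open>Compression to a completely reducible representation\<close>

context linear_group
begin

lemma act_inv_distinct:
  assumes R: "\<And>h. h \<in> carrier G \<Longrightarrow> h \<noteq> \<one> \<Longrightarrow> \<exists>r\<in>R. act h r \<noteq> r"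
    and xy: "x \<in> carrier G" "y \<in> carrier G" "x \<noteq> y"
  shows "\<exists>r\<in>R. act (inv x) r \<noteq> act (inv y) r"
proof -
  have "inv y \<otimes> x \<noteq> \<one>" using xy by (metis inv_closed inv_equality inv_inv)
  then obtain r where r: "r \<in> R" "act (inv y \<otimes> x) r \<noteq> r" using R[of "inv y \<otimes> x"] xy by auto
  have "act x (act (inv y) r) = act (inv y \<otimes> x) r" "act x (act (inv x) r) = r"
    using xy by (simp_all add: act_mult act_one)
  then have "act (inv x) r \<noteq> act (inv y) r" using r(2) by metis
  then show ?thesis using r(1) by blast
qed

text \<open>Dedekind's independence of characters for the restrictions of the group elements to \<open>R\<close>.\<close>

lemma act_independent:
  assumes one: "1 \<in> R" and mult: "\<And>x y. x \<in> R \<Longrightarrow> y \<in> R \<Longrightarrow> x * y \<in> R"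
    and R: "\<And>h. h \<in> carrier G \<Longrightarrow> h \<noteq> \<one> \<Longrightarrow> \<exists>r\<in>R. act h r \<noteq> r"
    and S: "S \<subseteq> carrier G" and z: "\<forall>r\<in>R. (\<Sum>l\<in>S. c l * act (inv l) r) = 0"
  shows "\<forall>l\<in>S. c l = 0"
proof -
  have "finite S" using S fin finite_subset by blast
  then show ?thesis
    using S z
  proof (induction S arbitrary: c)
    case (insert x S)
    have hom: "field_hom (act (inv l))" if "l \<in> insert x S" for l
      using that insert.prems(1) by (intro field_hom_act) auto
    have c0: "c y = 0" if y: "y \<in> S" for y
    proof -
      \<comment> \<open>\<open>r0\<close> separates \<open>x\<close> from \<open>y\<close>.
        Subtracting \<open>act (inv x) r0\<close> times the relation at \<open>r\<close> from the
        relation at \<open>r0 * r\<close> removes the term of \<open>x\<close> and keeps that of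
        \<open>y\<close>.\<close>
      obtain r0 where r0: "r0 \<in> R" "act (inv x) r0 \<noteq> act (inv y) r0"
        using act_inv_distinct[OF R, of x y] insert y by blast
      have "\<forall>r\<in>R. (\<Sum>l\<in>S. (c l * (act (inv l) r0 - act (inv x) r0)) * act (inv l) r) = 0"
      proof
        fix r assume r: "r \<in> R"
        have m: "act (inv l) (r0 * r) = act (inv l) r0 * act (inv l) r" if "l \<in> insert x S" for l
        proof -
          interpret field_hom "act (inv l)" using hom[OF that] .
          show ?thesis by (rule hom_mult)
        qed
        have "(\<Sum>l\<in>S. (c l * (act (inv l) r0 - act (inv x) r0)) * act (inv l) r) =
            (\<Sum>l\<in>insert x S. c l * act (inv l) (r0 * r)) - act (inv x) r0 * (\<Sum>l\<in>insert x S. c l * act (inv l) r)"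
          using insert.hyps m by (simp add: sum_distrib_left sum_subtractf[symmetric] algebra_simps)
        also have "\<dots> = 0" using insert.prems(2) r mult[OF r0(1) r] by simp
        finally show "(\<Sum>l\<in>S. (c l * (act (inv l) r0 - act (inv x) r0)) * act (inv l) r) = 0" .
      qed
      then have "c y * (act (inv y) r0 - act (inv x) r0) = 0"
        using insert.IH[of "\<lambda>l. c l * (act (inv l) r0 - act (inv x) r0)"] insert.prems(1) y by blast
      then show ?thesis using r0(2) by simp
    qed
    moreover have "c x = 0"
    proof -
      interpret field_hom "act (inv x)" using hom[of x] by simp
      have "(\<Sum>l\<in>insert x S. c l * act (inv l) 1) = 0" using insert.prems(2) one by blast
      then show ?thesis using insert.hyps c0 by simp
    qed
    ultimately show ?case by blast
  qed simp
qed

end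

context covariant_setting
begin

text \<open>A column of \<open>Pr h\<close> is spread over the group: the sum of its images under
  the \<open>\<sigma> l\<close>, weighted by \<open>act (inv l) \<theta>\<close>, is equivariant by
  reindexing. There is no division by the order of the group; independence of characters on
  \<open>R\<close> supplies a \<open>\<theta>\<close> for which the sum does not vanish.\<close>

lemma good_family_exists:
  assumes R: "R \<subseteq> ratfuns n" "\<And>c. const_rf c \<in> R"
      "\<And>x y. x \<in> R \<Longrightarrow> y \<in> R \<Longrightarrow> x + y \<in> R" "\<And>x y. x \<in> R \<Longrightarrow> y \<in> R \<Longrightarrow> x * y \<in> R"
      "\<And>g x. g \<in> carrier G \<Longrightarrow> x \<in> R \<Longrightarrow> act g x \<in> R"
    and faithful: "\<And>h. h \<in> carrier G \<Longrightarrow> h \<noteq> \<one> \<Longrightarrow> \<exists>r\<in>R. act h r \<noteq> r"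
  shows "\<exists>\<psi>. good \<psi> \<and> (\<forall>h\<in>carrier G - {\<one>}. \<forall>i<N. \<psi> h i \<in> R)"
proof -
  have one: "1 \<in> R" using R(2)[of 1] by simp
  have zero: "0 \<in> R" using R(2)[of 0] by simp
  have "\<exists>v. equivariant v \<and> (\<forall>i<N. mact N (Pr h) v i = v i) \<and> (\<exists>i<N. v i \<noteq> 0) \<and> (\<forall>i<N. v i \<in> R)"
    if h: "h \<in> carrier G - {\<one>}" for h
  proof -
    note Pc = Pr_carrier[OF h]
    obtain i0 j0 where ij: "i0 < N" "j0 < N" "Pr h $$ (i0, j0) \<noteq> 0"
    proof (rule ccontr)
      assume "\<not> thesis"
      then have "Pr h = 0\<^sub>m N N" using that Pc by (intro eq_matI) auto
      then show False using Pr_nonzero[OF h] by simp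
    qed
    let ?P = "Pr h"
    \<comment> \<open>For \<open>l\<close> the identity this is the column \<open>j0\<close> of
      \<open>Pr h\<close>, whose entry in row \<open>i0\<close> is nonzero. So the combination of
      characters in row \<open>i0\<close> is nontrivial.\<close>
    define d where "d l i = const_rf ((\<sigma> l * ?P) $$ (i, j0))" for l i
    have "d \<one> i0 \<noteq> 0" using ij Pc by (simp add: d_def sigma_one)
    then have "\<not> (\<forall>l\<in>carrier G. d l i0 = 0)" using one_closed by blast
    then obtain \<theta> where th: "\<theta> \<in> R" "(\<Sum>l\<in>carrier G. d l i0 * act (inv l) \<theta>) \<noteq> 0"
    proof -
      have "\<not> (\<forall>r\<in>R. (\<Sum>l\<in>carrier G. d l i0 * act (inv l) r) = 0)"
        using act_independent[of R "carrier G" "\<lambda>l. d l i0", OF one R(4) faithful subset_refl]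
          \<open>\<not> (\<forall>l\<in>carrier G. d l i0 = 0)\<close> by blast
      then show ?thesis using that by blast
    qed
    define v where "v i = (\<Sum>l\<in>carrier G. d l i * act (inv l) \<theta>)" for i
    have md: "(\<Sum>j<N. const_rf (A $$ (i, j)) * d l j) = const_rf ((A * (\<sigma> l * ?P)) $$ (i, j0))"
      if "A \<in> carrier_mat N N" "l \<in> carrier G" "i < N" for A l i
      using that ij(2) Pc sigma_carrier[OF that(2)]
      by (simp add: d_def scalar_prod_def atLeast0LessThan const_rf.hom_sum const_rf.hom_mult)
    have mv: "mact N A v i = (\<Sum>l\<in>carrier G. const_rf ((A * (\<sigma> l * ?P)) $$ (i, j0)) * act (inv l) \<theta>)"
      if "A \<in> carrier_mat N N" "i < N" for A i
    proof -
      have "mact N A v i = (\<Sum>l\<in>carrier G. (\<Sum>j<N. const_rf (A $$ (i, j)) * d l j) * act (inv l) \<theta>)"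
        unfolding mact_def v_def sum_distrib_left sum_distrib_right
        by (subst sum.swap) (simp add: mult.assoc)
      then show ?thesis using md that by simp
    qed
    have "equivariant v"
      unfolding equivariant_def
    proof (intro ballI allI impI)
      fix g i assume g: "g \<in> carrier G" and i: "i < N"
      interpret ag: field_hom "act g" by (rule field_hom_act[OF g])
      have "act g (v i) = (\<Sum>l\<in>carrier G. d l i * act (inv l \<otimes> g) \<theta>)"
        unfolding v_def ag.hom_sum ag.hom_mult
        by (rule sum.cong) (simp_all add: d_def act_mult g)
      also have "\<dots> = (\<Sum>l\<in>carrier G. d (g \<otimes> l) i * act (inv (g \<otimes> l) \<otimes> g) \<theta>)"
        by (rule sum.reindex_bij_witness[of _ "\<lambda>l. g \<otimes> l" "\<lambda>l. inv g \<otimes> l"])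
           (use g in \<open>simp_all add: m_assoc[symmetric]\<close>)
      also have "\<dots> = (\<Sum>l\<in>carrier G. const_rf ((\<sigma> g * (\<sigma> l * ?P)) $$ (i, j0)) * act (inv l) \<theta>)"
      proof (rule sum.cong)
        fix l assume l: "l \<in> carrier G"
        have "inv (g \<otimes> l) \<otimes> g = inv l" using g l by (simp add: inv_mult_group m_assoc)
        moreover have "\<sigma> (g \<otimes> l) * ?P = \<sigma> g * (\<sigma> l * ?P)"
          using g l Pc by (simp add: sigma_mult assoc_mult_mat[OF sigma_carrier sigma_carrier Pc])
        ultimately show "d (g \<otimes> l) i * act (inv (g \<otimes> l) \<otimes> g) \<theta> =
            const_rf ((\<sigma> g * (\<sigma> l * ?P)) $$ (i, j0)) * act (inv l) \<theta>"
          by (simp add: d_def)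
      qed simp
      also have "\<dots> = mact N (\<sigma> g) v i" using mv[OF sigma_carrier[OF g] i] by simp
      finally show "act g (v i) = mact N (\<sigma> g) v i" .
    qed
    moreover have "mact N ?P v i = v i" if "i < N" for i
    proof -
      have "?P * (\<sigma> l * ?P) = \<sigma> l * ?P" if l: "l \<in> carrier G" for l
      proof -
        have "?P * (\<sigma> l * ?P) = (\<sigma> l * ?P) * ?P"
          using Pc sigma_carrier[OF l] Pr_comm[OF h l] by (metis assoc_mult_mat)
        also have "\<dots> = \<sigma> l * ?P"
          using Pc sigma_carrier[OF l] Pr_idem[OF h] by (metis assoc_mult_mat)
        finally show ?thesis .
      qed
      then show ?thesis using mv[OF Pc that] by (simp add: v_def d_def)
    qed
    moreover have "v i \<in> R" for i
    proof -
      have s: "sum f I \<in> R" if "\<And>l. l \<in> I \<Longrightarrow> f l \<in> R" for f and I :: "'g set"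
        using that by (induction I rule: infinite_finite_induct) (simp_all add: zero R(3))
      have "d l i * act (inv l) \<theta> \<in> R" if "l \<in> carrier G" for l
        using that th(1) R(2,4,5) by (simp add: d_def)
      then show ?thesis unfolding v_def by (rule s)
    qed
    moreover have "v i0 \<noteq> 0" using th(2) by (simp add: v_def)
    ultimately show ?thesis using ij(1) by blast
  qed
  then obtain \<psi> where \<psi>: "\<And>h. h \<in> carrier G - {\<one>} \<Longrightarrow> equivariant (\<psi> h) \<and> (\<forall>i<N. mact N (Pr h) (\<psi> h) i = \<psi> h i) \<and>
      (\<exists>i<N. \<psi> h i \<noteq> 0) \<and> (\<forall>i<N. \<psi> h i \<in> R)"
    by metis
  have "good \<psi>" unfolding good_def using \<psi> R(1) by blast
  then show ?thesis using \<psi> by blast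
qed

text \<open>The algebra generated by the components of \<open>f\<close> is stable under the group by
  equivariance, and the group acts faithfully on it because the stabilizer of \<open>f\<close> is
  trivial. The new entries are polynomials in the components, so they are regular if
  \<open>f\<close> is.\<close>

lemma compress:
  fixes f :: "'k ratfun vec"
  assumes f: "faithful_covariant G n \<rho> m \<tau> f"
  shows "\<exists>\<psi>. good \<psi> \<and> (\<forall>h\<in>carrier G - {\<one>}. \<forall>i<N. \<psi> h i \<in> rgen (consts_rf \<union> ($) f ` {..<m}))"
proof -
  have cov: "covariant G n \<rho> m \<tau> f" and st: "{g \<in> carrier G. const_mat (\<tau> g) *\<^sub>v f = f} = {\<one>}"
    using f by (auto simp: faithful_covariant_def)
  then have fr: "rational_map n m f" and rt: "representation G m \<tau>" by (auto simp: covariant_def)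
  have fc: "f \<in> carrier_vec m" using fr by (simp add: rational_map_def)
  have eq: "act g (f $ i) = mact m (\<tau> g) (($) f) i" if "g \<in> carrier G" "i < m" for g i
    using cov that unfolding covariant_iff[OF fc] by blast
  let ?R = "rgen (consts_rf \<union> ($) f ` {..<m})"
  show ?thesis
  proof (rule good_family_exists)
    show "?R \<subseteq> ratfuns n" using fr by (intro rgen_ratfuns) (auto simp: rational_map_def)
    show "const_rf c \<in> ?R" for c by (auto intro: rgen.base)
    show "x + y \<in> ?R" "x * y \<in> ?R" if "x \<in> ?R" "y \<in> ?R" for x y using that by (auto intro: rgen.intros)
    show "act g x \<in> ?R" if g: "g \<in> carrier G" and x: "x \<in> ?R" for g x
    proof -
      interpret ag: field_hom "act g" by (rule field_hom_act[OF g])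
      show ?thesis using x
      proof induction
        case (base x)
        show ?case
        proof (cases "x \<in> consts_rf")
          case True
          then show ?thesis by (auto intro: rgen.base)
        next
          case False
          then obtain i where i: "i < m" "x = f $ i" using base by auto
          then have "act g x = (\<Sum>j<m. const_rf (\<tau> g $$ (i, j)) * f $ j)" using eq[OF g i(1)] by (simp add: mact_def)
          also have "\<dots> \<in> ?R" by (intro rgen_sum rgen.mult rgen.base) auto
          finally show ?thesis .
        qed
      qed (simp_all add: ag.hom_add ag.hom_mult ag.hom_uminus rgen.intros)
    qed
    fix h assume h: "h \<in> carrier G" "h \<noteq> \<one>"
    have tc: "\<tau> h \<in> carrier_mat m m" using rt h representation_iff[OF group_axioms] by blast
    have "const_mat (\<tau> h) *\<^sub>v f \<noteq> f" using st h by blast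
    then obtain i where i: "i < m" "mact m (\<tau> h) (($) f) i \<noteq> f $ i"
      using stabilizer_iff[where \<sigma> = \<tau> and g = h, OF fc tc] by blast
    then have "act h (f $ i) \<noteq> f $ i" using eq h by simp
    moreover have "f $ i \<in> ?R" using i by (auto intro: rgen.base)
    ultimately show "\<exists>r\<in>?R. act h r \<noteq> r" by blast
  qed
qed

end

section \<open>Regularisation by an invariant denominator\<close>

context linear_group
begin

text \<open>A common denominator is replaced by its norm, the product of its translates.\<close>

lemma invariant_denominator:
  assumes F: "finite F" "F \<subseteq> ratfuns n"
  shows "\<exists>b. b \<in> polys n \<and> b \<noteq> 0 \<and> (\<forall>g\<in>carrier G. pact g b = b) \<and> (\<forall>r\<in>F. \<exists>a\<in>polys n. r = Fract a b)"
proof -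
  obtain b where b: "b \<in> polys n" "b \<noteq> 0" "\<forall>r\<in>F. \<exists>a\<in>polys n. r = Fract a b"
    using common_denominator[OF F] by blast
  define B where "B = (\<Prod>g\<in>carrier G. pact g b)"
  have Bn: "B \<in> polys n" unfolding B_def using b(1) by (intro polys_prod) (simp add: pact_def lin_subst_polys)
  have B0: "B \<noteq> 0" unfolding B_def using b(2) fin by (simp add: pact_eq_0_iff)
  have "pact g B = B" if g: "g \<in> carrier G" for g
  proof -
    interpret pg: comm_ring_hom "pact g" by simp
    have "pact g B = (\<Prod>h\<in>carrier G. pact (h \<otimes> g) b)"
      unfolding B_def pg.hom_prod using g by (intro prod.cong) (simp_all add: pact_mult)
    also have "\<dots> = B" unfolding B_def
      by (rule prod.reindex_bij_witness[of _ "\<lambda>h. h \<otimes> inv g" "\<lambda>h. h \<otimes> g"])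
         (use g in \<open>simp_all add: m_assoc\<close>)
    finally show ?thesis .
  qed
  moreover have "\<exists>a\<in>polys n. r = Fract a B" if rF: "r \<in> F" for r
  proof -
    obtain a where a: "a \<in> polys n" "r = Fract a b" using b(3)[rule_format, OF rF] by blast
    define C where "C = (\<Prod>g\<in>carrier G - {\<one>}. pact g b)"
    have BC: "B = b * C" unfolding B_def C_def using fin by (subst prod.remove[of _ \<one>]) (simp_all add: pact_one)
    have "C \<in> polys n" unfolding C_def using b(1) by (intro polys_prod) (simp add: pact_def lin_subst_polys)
    moreover have "r = Fract (a * C) B" using a(2) b(2) B0 by (simp add: eq_fract BC)
    ultimately show ?thesis using a(1) polys_mult by blast
  qed
  ultimately show ?thesis using Bn B0 by blast
qed

lemma faithful_covariant_scale:
  fixes f :: "'k ratfun vec"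
  assumes f: "faithful_covariant G n \<rho> m \<tau> f" and c: "c \<in> ratfuns n" "c \<noteq> 0" "\<And>g. g \<in> carrier G \<Longrightarrow> act g c = c"
  shows "faithful_covariant G n \<rho> m \<tau> (c \<cdot>\<^sub>v f)"
proof -
  have cov: "covariant G n \<rho> m \<tau> f" and st: "{g \<in> carrier G. const_mat (\<tau> g) *\<^sub>v f = f} = {\<one>}"
    using f by (auto simp: faithful_covariant_def)
  then have fr: "rational_map n m f" and rt: "representation G m \<tau>" by (auto simp: covariant_def)
  have fc: "f \<in> carrier_vec m" and fc': "c \<cdot>\<^sub>v f \<in> carrier_vec m" using fr by (simp_all add: rational_map_def)
  have tc: "\<tau> g \<in> carrier_mat m m" if "g \<in> carrier G" for g
    using rt that representation_iff[OF group_axioms] by blast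
  have ms: "mact m A (($) (c \<cdot>\<^sub>v f)) i = c * mact m A (($) f) i" for A i
    using fc by (subst mact_scale[symmetric]) (auto intro!: mact_cong)
  have "covariant G n \<rho> m \<tau> (c \<cdot>\<^sub>v f)"
    unfolding covariant_iff[OF fc']
  proof (intro conjI ballI allI impI)
    show "rational_map n m (c \<cdot>\<^sub>v f)" using fr c(1) by (auto simp: rational_map_def ratfuns_mult)
    fix g i assume g: "g \<in> carrier G" and i: "i < m"
    interpret ag: field_hom "act g" by (rule field_hom_act[OF g])
    show "act g ((c \<cdot>\<^sub>v f) $ i) = mact m (\<tau> g) (($) (c \<cdot>\<^sub>v f)) i"
      using cov[unfolded covariant_iff[OF fc]] g i c(3)[OF g] fc unfolding ms by (simp add: ag.hom_mult)
  qed (rule rt)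
  moreover have "const_mat (\<tau> g) *\<^sub>v (c \<cdot>\<^sub>v f) = c \<cdot>\<^sub>v f \<longleftrightarrow> const_mat (\<tau> g) *\<^sub>v f = f" if "g \<in> carrier G" for g
    unfolding stabilizer_iff[where \<sigma> = \<tau> and g = g, OF fc tc[OF that]] stabilizer_iff[where \<sigma> = \<tau> and g = g, OF fc' tc[OF that]] ms
    using fc c(2) by auto
  ultimately show ?thesis using st by (auto simp: faithful_covariant_def)
qed

text \<open>Scaling by an invariant changes neither equivariance nor the stabilizer. The new
  components are algebraic over a transcendence basis of the old ones together with the single
  element \<open>b\<close>, whence the summand 1.\<close>

lemma regularise:
  fixes f :: "'k ratfun vec"
  assumes f: "faithful_covariant G n \<rho> m \<tau> f"
  shows "\<exists>f'. faithful_covariant G n \<rho> m \<tau> f' \<and> regular_map n m f' \<and> map_dim n m f' \<le> map_dim n m f + 1"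
proof -
  have fr: "rational_map n m f" using f by (auto simp: covariant_def faithful_covariant_def)
  then have fc: "f \<in> carrier_vec m" and fi: "\<And>i. i < m \<Longrightarrow> f $ i \<in> ratfuns n" by (simp_all add: rational_map_def)
  obtain b where b: "b \<in> polys n" "b \<noteq> 0" "\<forall>g\<in>carrier G. pact g b = b"
      "\<And>r. r \<in> ($) f ` {..<m} \<Longrightarrow> \<exists>a\<in>polys n. r = Fract a b"
  proof -
    have "($) f ` {..<m} \<subseteq> ratfuns n" using fi by auto
    from invariant_denominator[OF _ this] show ?thesis using that by (metis finite_imageI finite_lessThan)
  qed
  let ?c = "to_fract b"
  let ?f = "?c \<cdot>\<^sub>v f"
  have f': "faithful_covariant G n \<rho> m \<tau> ?f"
    by (rule faithful_covariant_scale[OF f]) (use b in \<open>auto simp: ratfuns_to_fract\<close>)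
  have "?f $ i \<in> {Fract a 1 | a. a \<in> polys n}" if im: "i < m" for i
  proof -
    have "f $ i \<in> ($) f ` {..<m}" using im by simp
    then obtain a where "a \<in> polys n" "f $ i = Fract a b" using b(4) by blast
    moreover from this have "?f $ i = Fract a 1" using im fc b(2) by (simp add: to_fract_def eq_fract)
    ultimately show ?thesis by blast
  qed
  then have reg: "regular_map n m ?f" using fc by (simp add: regular_map_def)
  have fr': "rational_map n m ?f" using f' by (auto simp: covariant_def faithful_covariant_def)
  obtain vs where vs: "($) f ` {..<m} \<subseteq> acl (consts_rf \<union> set vs)" "map_dim n m f = enat (length vs)"
    using map_dim_basis[OF fr] by blast
  have "map_dim n m ?f \<le> enat (length (?c # vs))"
  proof (rule map_dim_le[OF fr'])
    fix i assume i: "i < m"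
    have "f $ i \<in> acl (consts_rf \<union> set (?c # vs))"
      using vs(1) i acl_mono[of "consts_rf \<union> set vs" "consts_rf \<union> set (?c # vs)"] by auto
    moreover have "?c \<in> acl (consts_rf \<union> set (?c # vs))"
      by (rule subsetD[OF acl_base]) simp
    ultimately show "?f $ i \<in> acl (consts_rf \<union> set (?c # vs))" using i fc by (simp add: acl_mult)
  qed
  then show ?thesis using f' reg vs(2) by (intro exI[of _ ?f]) (simp add: one_enat_def)
qed

end

section \<open>Algebraic independence in terms of polynomial relations\<close>

lemma single_out_polys: "p \<in> polys d \<Longrightarrow> single_out d p = [:p:]"
  by (rule meval_unique_polys[where G = "\<lambda>p. [:p:]"])
     (auto simp: single_out_mX comm_ring_hom_pCons comm_ring_hom_ident)

lemma coeff_single_out_polys: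
  assumes "p \<in> polys (Suc d)" shows "coeff (single_out d p) e \<in> polys d"
proof -
  let ?R = "{q. \<forall>e. coeff q e \<in> polys d}"
  have "single_out d p \<in> ?R"
    unfolding single_out_def
    by (rule meval_closed[OF assms])
       (auto simp: coeff_pCons coeff_mult less_Suc_eq intro: polys_add polys_sum polys_mult split: nat.splits)
  then show ?thesis by blast
qed

text \<open>Reversing the range makes \<open>f d\<close> the head of the list, as the recursion of
  \<open>alg_indep\<close> requires. In the step, a polynomial in \<open>d + 1\<close> variables is
  read as univariate in the last one.\<close>

lemma alg_indep_iff_relations:
  "alg_indep consts_rf (map f (rev [0..<d])) \<longleftrightarrow> (\<forall>p\<in>polys d. meval const_rf f p = 0 \<longrightarrow> p = 0)"
proof (induction d)
  case 0
  have "p = 0" if p: "p \<in> polys 0" "meval const_rf f p = 0" for p :: "'a mpoly"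
  proof -
    have "p \<in> rgen (range mC)"
      using p(1) by (induction rule: polys_induct) (auto intro: rgen.base rgen.add rgen.mult)
    then obtain c where "p = mC c" using rgen_range_mC by blast
    then show ?thesis using p(2) by simp
  qed
  then show ?case by simp
next
  case (Suc d)
  interpret F: comm_ring_hom "meval const_rf f" by (rule const_rf.comm_ring_hom_meval)
  let ?S = "consts_rf \<union> f ` {..<d}"
  have st: "set (map f (rev [0..<d])) = f ` {..<d}" by (auto simp: atLeast0LessThan)
  have IH: "alg_indep consts_rf (map f (rev [0..<Suc d])) \<longleftrightarrow>
      f d \<notin> acl ?S \<and> (\<forall>p\<in>polys d. meval const_rf f p = 0 \<longrightarrow> p = 0)"
    using Suc.IH st by (simp add: rev_map)
  show ?case
    unfolding IH
  proof (intro iffI conjI ballI impI)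
    fix p assume H: "f d \<notin> acl ?S \<and> (\<forall>p\<in>polys d. meval const_rf f p = 0 \<longrightarrow> p = 0)"
      and p: "p \<in> polys (Suc d)" "meval const_rf f p = 0"
    let ?q = "single_out d p"
    let ?r = "map_poly (meval const_rf f) ?q"
    have "p = poly ?q (mX d)"
    proof -
      have "(\<lambda>i. if i = d then mX d else mX i) = (mX :: nat \<Rightarrow> 'a mpoly)" by auto
      then show ?thesis unfolding poly_single_out by simp
    qed
    then have "meval const_rf f p = (\<Sum>i\<le>Polynomial.degree ?q. meval const_rf f (coeff ?q i) * f d ^ i)"
    proof -
      assume "p = poly ?q (mX d)"
      from arg_cong[OF this, of "meval const_rf f"] show ?thesis
        by (simp add: poly_altdef F.hom_sum F.hom_mult F.hom_power)
    qed
    also have "\<dots> = poly ?r (f d)"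
      by (subst poly_altdef_le[of ?r "Polynomial.degree ?q"]) (auto intro!: degree_le simp: coeff_map_poly coeff_eq_0)
    finally have "poly ?r (f d) = 0" using p(2) by simp
    moreover have "coeff ?r i \<in> rgen ?S" for i
    proof -
      have "meval const_rf f x \<in> rgen ?S" if "x \<in> polys d" for x
        using that
        by (induction rule: polys_induct) (auto simp: F.hom_add F.hom_mult intro: rgen.base rgen.add rgen.mult)
      then show ?thesis using coeff_single_out_polys[OF p(1)] by (simp add: coeff_map_poly)
    qed
    ultimately have "?r = 0" using H aclI by blast
    then have "coeff ?q i = 0" for i
    proof -
      have "coeff ?r i = 0" using \<open>?r = 0\<close> by simp
      then show ?thesis using H coeff_single_out_polys[OF p(1)] by (simp add: coeff_map_poly)
    qed
    then have "?q = 0" by (simp add: poly_eq_iff)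
    then show "p = 0" by (simp add: single_out_eq_0_iff)
  next
    assume H: "\<forall>p\<in>polys (Suc d). meval const_rf f p = 0 \<longrightarrow> p = 0"
    show "p = 0" if "p \<in> polys d" "meval const_rf f p = 0" for p
      using H that polys_mono[of d "Suc d"] by auto
    show "f d \<notin> acl ?S"
    proof
      assume "f d \<in> acl ?S"
      then obtain p where p: "p \<noteq> 0" "\<And>i. coeff p i \<in> rgen ?S" "poly p (f d) = 0" by (auto elim: aclE)
      have "\<forall>i. \<exists>P. P \<in> polys d \<and> coeff p i = meval const_rf f P"
        using rgen_consts_meval[OF p(2), of d] by blast
      then obtain P where P: "\<And>i. P i \<in> polys d" "\<And>i. coeff p i = meval const_rf f (P i)" by metis
      define k where "k = Polynomial.degree p"
      define w where "w = (\<Sum>i\<le>k. P i * mX d ^ i)"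
      have "w \<in> polys (Suc d)"
        unfolding w_def using P(1) polys_mono[of d "Suc d"] by (intro polys_sum polys_mult polys_power) auto
      moreover have "meval const_rf f w = 0"
        using p(3) by (simp add: w_def k_def poly_altdef P(2) F.hom_sum F.hom_mult F.hom_power)
      ultimately have "w = 0" using H by blast
      interpret so: comm_ring_hom "single_out d :: 'a mpoly \<Rightarrow> _" by simp
      have "0 = single_out d w" using \<open>w = 0\<close> by simp
      also have "\<dots> = (\<Sum>i\<le>k. monom (P i) i)"
        by (simp add: w_def so.hom_sum so.hom_mult so.hom_power single_out_polys[OF P(1)] single_out_mX)
           (simp add: monom_altdef)
      finally have "coeff (\<Sum>i\<le>k. monom (P i) i) k = 0" by (metis coeff_0)
      then have "P k = 0" by (simp add: coeff_sum_monom)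
      then have "coeff p k = 0" by (simp add: P(2))
      then show False using p(1) by (simp add: k_def)
    qed
  qed
qed

section \<open>Gradings and leading forms\<close>

lemma coeff_mult_bounds:
  assumes "Polynomial.degree p \<le> i" "Polynomial.degree q \<le> j"
  shows "coeff (p * q) (i + j) = coeff p i * coeff q j"
proof -
  have "coeff (p * q) (i + j) = (\<Sum>k\<le>i + j. coeff p k * coeff q (i + j - k))" by (rule coeff_mult)
  also have "\<dots> = (\<Sum>k\<in>{i}. coeff p k * coeff q (i + j - k))"
  proof (rule sum.mono_neutral_right)
    show "\<forall>k\<in>{..i + j} - {i}. coeff p k * coeff q (i + j - k) = 0"
    proof
      fix k assume "k \<in> {..i + j} - {i}"
      then consider "k > i" | "i + j - k > j" by force
      then show "coeff p k * coeff q (i + j - k) = 0" using assms by cases (simp_all add: coeff_eq_0)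
    qed
  qed auto
  finally show ?thesis by simp
qed

text \<open>An action of the multiplicative group on affine space that commutes with \<open>G\<close>, given by its
  coaction; the coefficient of \<open>t\<^sup>e\<close> is the component of degree \<open>e\<close>.\<close>

locale graded_group = linear_group G n \<rho>
  for G :: "('g, 'b) monoid_scheme" (structure) and n and \<rho> :: "'g \<Rightarrow> 'k::field mat" +
  fixes \<Theta> :: "'k mpoly \<Rightarrow> 'k mpoly poly"
  assumes hom_Theta: "comm_ring_hom \<Theta>"
    and Theta_mC: "\<Theta> (mC c) = [:mC c:]"
    and Theta_at_1: "poly (\<Theta> p) 1 = p"
    and Theta_coeff: "\<Theta> (coeff (\<Theta> p) e) = monom (coeff (\<Theta> p) e) e"
    and Theta_pact: "g \<in> carrier G \<Longrightarrow> \<Theta> (pact g p) = map_poly (pact g) (\<Theta> p)"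
    and Theta_polys: "p \<in> polys n \<Longrightarrow> coeff (\<Theta> p) e \<in> polys n"
begin

sublocale Theta: comm_ring_hom \<Theta> by (rule hom_Theta)

lemma Theta_eq_0_iff [simp]: "\<Theta> p = 0 \<longleftrightarrow> p = 0"
  using Theta_at_1[of p] by auto

text \<open>\<open>r\<close> has degree at most \<open>d\<close>, and \<open>s\<close> is its
  component of degree \<open>d\<close> in the expansion by descending degrees. As \<open>i\<close>
  only bounds the degree of the numerator, \<open>s\<close> may be 0, so that sums remain compatible
  under cancellation. \<open>lead d r r\<close> expresses that \<open>r\<close> is homogeneous of
  degree \<open>d\<close>.\<close>

definition lead :: "int \<Rightarrow> 'k ratfun \<Rightarrow> 'k ratfun \<Rightarrow> bool" where
  "lead d r s \<longleftrightarrow> (\<exists>a b i. b \<noteq> 0 \<and> r = Fract a b \<and> Polynomial.degree (\<Theta> a) \<le> i \<and>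
     s = Fract (coeff (\<Theta> a) i) (Polynomial.lead_coeff (\<Theta> b)) \<and> d = int i - int (Polynomial.degree (\<Theta> b)))"

lemma leadI:
  "b \<noteq> 0 \<Longrightarrow> Polynomial.degree (\<Theta> a) \<le> i \<Longrightarrow>
    lead (int i - int (Polynomial.degree (\<Theta> b))) (Fract a b) (Fract (coeff (\<Theta> a) i) (Polynomial.lead_coeff (\<Theta> b)))"
  unfolding lead_def by blast

lemma leadE:
  assumes "lead d r s"
  obtains a b i where "b \<noteq> 0" "r = Fract a b" "Polynomial.degree (\<Theta> a) \<le> i"
    "s = Fract (coeff (\<Theta> a) i) (Polynomial.lead_coeff (\<Theta> b))" "d = int i - int (Polynomial.degree (\<Theta> b))"
    "Polynomial.lead_coeff (\<Theta> b) \<noteq> 0"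
proof -
  obtain a b i where "b \<noteq> 0" "r = Fract a b" "Polynomial.degree (\<Theta> a) \<le> i"
    "s = Fract (coeff (\<Theta> a) i) (Polynomial.lead_coeff (\<Theta> b))" "d = int i - int (Polynomial.degree (\<Theta> b))"
    using assms unfolding lead_def by blast
  then show ?thesis using that[of b a i] by simp
qed

lemma lead_const: "lead 0 (const_rf c) (const_rf c)"
proof -
  have "\<Theta> 1 = 1" by (rule Theta.hom_one)
  then show ?thesis using leadI[of 1 "mC c" 0] by (simp add: Theta_mC const_rf_to_fract to_fract_def)
qed

lemma lead_add:
  assumes "lead d r s" "lead d r' s'" shows "lead d (r + r') (s + s')"
proof -
  obtain a b i where a: "b \<noteq> 0" "r = Fract a b" "Polynomial.degree (\<Theta> a) \<le> i"
    "s = Fract (coeff (\<Theta> a) i) (Polynomial.lead_coeff (\<Theta> b))" "d = int i - int (Polynomial.degree (\<Theta> b))"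
    "Polynomial.lead_coeff (\<Theta> b) \<noteq> 0" using assms(1) by (rule leadE)
  obtain a' b' i' where a': "b' \<noteq> 0" "r' = Fract a' b'" "Polynomial.degree (\<Theta> a') \<le> i'"
    "s' = Fract (coeff (\<Theta> a') i') (Polynomial.lead_coeff (\<Theta> b'))" "d = int i' - int (Polynomial.degree (\<Theta> b'))"
    "Polynomial.lead_coeff (\<Theta> b') \<noteq> 0" using assms(2) by (rule leadE)
  let ?j = "Polynomial.degree (\<Theta> b)" and ?j' = "Polynomial.degree (\<Theta> b')"
  have ij: "i + ?j' = i' + ?j" using a(5) a'(5) by linarith
  have db: "Polynomial.degree (\<Theta> (b * b')) = ?j + ?j'"
    using a(1) a'(1) by (simp add: Theta.hom_mult degree_mult_eq)
  have deg: "Polynomial.degree (\<Theta> (a * b' + a' * b)) \<le> i + ?j'"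
    unfolding Theta.hom_add Theta.hom_mult
    using degree_mult_le[of "\<Theta> a" "\<Theta> b'"] degree_mult_le[of "\<Theta> a'" "\<Theta> b"] a(3) a'(3) ij
    by (intro degree_add_le) linarith+
  have "coeff (\<Theta> (a * b' + a' * b)) (i + ?j') = coeff (\<Theta> a) i * Polynomial.lead_coeff (\<Theta> b') + coeff (\<Theta> a') i' * Polynomial.lead_coeff (\<Theta> b)"
    unfolding Theta.hom_add Theta.hom_mult coeff_add
    using coeff_mult_bounds[OF a(3), of "\<Theta> b'" ?j'] coeff_mult_bounds[OF a'(3), of "\<Theta> b" ?j] ij by simp
  moreover have "Polynomial.lead_coeff (\<Theta> (b * b')) = Polynomial.lead_coeff (\<Theta> b) * Polynomial.lead_coeff (\<Theta> b')"
    by (simp add: Theta.hom_mult lead_coeff_mult)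
  moreover have "r + r' = Fract (a * b' + a' * b) (b * b')" using a a' by simp
  moreover have "s + s' = Fract (coeff (\<Theta> a) i * Polynomial.lead_coeff (\<Theta> b') + coeff (\<Theta> a') i' * Polynomial.lead_coeff (\<Theta> b))
      (Polynomial.lead_coeff (\<Theta> b) * Polynomial.lead_coeff (\<Theta> b'))" using a a' by simp
  moreover have "d = int (i + ?j') - int (?j + ?j')" using a(5) by simp
  ultimately show ?thesis using leadI[OF _ deg, of "b * b'"] a(1) a'(1) db by simp
qed

lemma lead_mult:
  assumes "lead d r s" "lead d' r' s'" shows "lead (d + d') (r * r') (s * s')"
proof -
  obtain a b i where a: "b \<noteq> 0" "r = Fract a b" "Polynomial.degree (\<Theta> a) \<le> i"
    "s = Fract (coeff (\<Theta> a) i) (Polynomial.lead_coeff (\<Theta> b))" "d = int i - int (Polynomial.degree (\<Theta> b))"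
    "Polynomial.lead_coeff (\<Theta> b) \<noteq> 0" using assms(1) by (rule leadE)
  obtain a' b' i' where a': "b' \<noteq> 0" "r' = Fract a' b'" "Polynomial.degree (\<Theta> a') \<le> i'"
    "s' = Fract (coeff (\<Theta> a') i') (Polynomial.lead_coeff (\<Theta> b'))" "d' = int i' - int (Polynomial.degree (\<Theta> b'))"
    "Polynomial.lead_coeff (\<Theta> b') \<noteq> 0" using assms(2) by (rule leadE)
  have db: "Polynomial.degree (\<Theta> (b * b')) = Polynomial.degree (\<Theta> b) + Polynomial.degree (\<Theta> b')"
    using a(1) a'(1) by (simp add: Theta.hom_mult degree_mult_eq)
  have deg: "Polynomial.degree (\<Theta> (a * a')) \<le> i + i'"
    using degree_mult_le[of "\<Theta> a" "\<Theta> a'"] a(3) a'(3) by (simp add: Theta.hom_mult)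
  have "coeff (\<Theta> (a * a')) (i + i') = coeff (\<Theta> a) i * coeff (\<Theta> a') i'"
    using coeff_mult_bounds[OF a(3) a'(3)] by (simp add: Theta.hom_mult)
  moreover have "Polynomial.lead_coeff (\<Theta> (b * b')) = Polynomial.lead_coeff (\<Theta> b) * Polynomial.lead_coeff (\<Theta> b')"
    by (simp add: Theta.hom_mult lead_coeff_mult)
  moreover have "r * r' = Fract (a * a') (b * b')" using a a' by simp
  moreover have "s * s' = Fract (coeff (\<Theta> a) i * coeff (\<Theta> a') i')
      (Polynomial.lead_coeff (\<Theta> b) * Polynomial.lead_coeff (\<Theta> b'))" using a a' by simp
  moreover have "d + d' = int (i + i') - int (Polynomial.degree (\<Theta> b) + Polynomial.degree (\<Theta> b'))" using a(5) a'(5) by simp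
  ultimately show ?thesis using leadI[OF _ deg, of "b * b'"] a(1) a'(1) db by simp
qed

lemma lead_inverse:
  assumes "lead d r s" "s \<noteq> 0" shows "lead (- d) (inverse r) (inverse s)"
proof -
  obtain a b i where a: "b \<noteq> 0" "r = Fract a b" "Polynomial.degree (\<Theta> a) \<le> i"
    "s = Fract (coeff (\<Theta> a) i) (Polynomial.lead_coeff (\<Theta> b))" "d = int i - int (Polynomial.degree (\<Theta> b))"
    "Polynomial.lead_coeff (\<Theta> b) \<noteq> 0" using assms(1) by (rule leadE)
  have "coeff (\<Theta> a) i \<noteq> 0" using assms(2) a(4) by (auto simp: fract_collapse)
  then have i: "i = Polynomial.degree (\<Theta> a)" and "a \<noteq> 0" using a(3) le_degree[of "\<Theta> a" i] by auto
  then show ?thesis using leadI[of a b "Polynomial.degree (\<Theta> b)"] a by simp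
qed

lemma lead_zero: "lead d 0 s \<Longrightarrow> s = 0"
  by (elim leadE) (auto simp: Zero_fract_def eq_fract)

lemma lead_weaken: assumes "lead d r s" "d < d'" shows "lead d' r 0"
proof -
  obtain a b i where a: "b \<noteq> 0" "r = Fract a b" "Polynomial.degree (\<Theta> a) \<le> i"
    "s = Fract (coeff (\<Theta> a) i) (Polynomial.lead_coeff (\<Theta> b))" "d = int i - int (Polynomial.degree (\<Theta> b))"
    "Polynomial.lead_coeff (\<Theta> b) \<noteq> 0" using assms(1) by (rule leadE)
  let ?i = "nat (d' - d) + i"
  have "Polynomial.degree (\<Theta> a) \<le> ?i" using a(3) by simp
  moreover have "coeff (\<Theta> a) ?i = 0" using a(3) assms(2) by (intro coeff_eq_0) linarith
  moreover have "int ?i - int (Polynomial.degree (\<Theta> b)) = d'" using a(5) assms(2) by simp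
  ultimately show ?thesis using leadI[of b a ?i] a(1,2) by (simp add: fract_collapse)
qed

lemma lead_act:
  assumes g: "g \<in> carrier G" and "lead d r s" shows "lead d (act g r) (act g s)"
proof -
  obtain a b i where a: "b \<noteq> 0" "r = Fract a b" "Polynomial.degree (\<Theta> a) \<le> i"
    "s = Fract (coeff (\<Theta> a) i) (Polynomial.lead_coeff (\<Theta> b))" "d = int i - int (Polynomial.degree (\<Theta> b))"
    "Polynomial.lead_coeff (\<Theta> b) \<noteq> 0" using assms(2) by (rule leadE)
  interpret pg: comm_ring_hom "pact g" by simp
  have deg: "Polynomial.degree (\<Theta> (pact g p)) = Polynomial.degree (\<Theta> p)" for p
    unfolding Theta_pact[OF g] using g by (intro degree_map_poly) (simp add: pact_eq_0_iff)
  have cf: "coeff (\<Theta> (pact g p)) e = pact g (coeff (\<Theta> p) e)" for p e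
    unfolding Theta_pact[OF g] by (simp add: coeff_map_poly)
  show ?thesis
    using leadI[of "pact g b" "pact g a" i] a g by (simp add: act_Fract deg cf pact_eq_0_iff)
qed

lemma lead_unique: assumes "lead d r s" "lead d r s'" shows "s = s'"
proof -
  have "lead d (const_rf (- 1) * r) (const_rf (- 1) * s')" using lead_mult[OF lead_const assms(2)] by simp
  then have "lead d (- r) (- s')" by (simp add: const_rf.hom_uminus)
  then show ?thesis using lead_add[OF assms(1)] lead_zero[of d "s - s'"] by fastforce
qed

lemma lead_sum:
  assumes "finite I" "I \<noteq> {}" "\<And>i. i \<in> I \<Longrightarrow> lead d (r i) (s i)"
  shows "lead d (sum r I) (sum s I)"
  using assms by (induction rule: finite_ne_induct) (simp_all add: lead_add)

lemma lead_power: "lead d r s \<Longrightarrow> lead (int k * d) (r ^ k) (s ^ k)"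
proof (induction k)
  case 0
  then show ?case using lead_const[of 1] by simp
next
  case (Suc k)
  then have "lead (d + int k * d) (r * r ^ k) (s * s ^ k)" by (intro lead_mult) auto
  then show ?case by (simp add: algebra_simps)
qed

lemma lead_prod:
  assumes "finite I" "\<And>i. i \<in> I \<Longrightarrow> lead (d i) (r i) (s i)"
  shows "lead (sum d I) (prod r I) (prod s I)"
  using assms by (induction) (use lead_const[of 1] in \<open>simp_all add: lead_mult\<close>)

text \<open>By \<open>lead_weaken\<close> the terms of smaller weight count as terms of degree
  \<open>E\<close> with component 0. Adding up, the component of degree \<open>E\<close> of the zero
  sum is the sum of the top forms.\<close>

lemma leading_sum_zero:
  fixes w :: "'i \<Rightarrow> int"
  assumes I: "finite I" and r: "\<And>i. i \<in> I \<Longrightarrow> lead (w i) (r i) (s i)" and z: "sum r I = 0"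
    and E: "\<And>i. i \<in> I \<Longrightarrow> w i \<le> E"
  shows "(\<Sum>i\<in>{i \<in> I. w i = E}. s i) = 0"
proof (cases "I = {}")
  case False
  have "lead E (r i) (if w i = E then s i else 0)" if "i \<in> I" for i
    using r[OF that] E[OF that] lead_weaken[of "w i" "r i" "s i" E] by auto
  then have "lead E (sum r I) (\<Sum>i\<in>I. if w i = E then s i else 0)"
    by (intro lead_sum[OF I False])
  then have "(\<Sum>i\<in>I. if w i = E then s i else 0) = 0" using z lead_zero by simp
  then show ?thesis using I by (simp add: sum.inter_filter)
qed simp

text \<open>The terms of highest weight cancel by \<open>leading_sum_zero\<close>; removing them
  leaves a shorter vanishing sum.\<close>

lemma homogeneous_sum_zero:
  fixes w :: "'i \<Rightarrow> int"
  assumes "finite I" "\<And>i. i \<in> I \<Longrightarrow> lead (w i) (r i) (r i)" "sum r I = 0"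
  shows "(\<Sum>i\<in>{i \<in> I. w i = E}. r i) = 0"
  using assms
proof (induction "card I" arbitrary: I rule: less_induct)
  case less
  show ?case
  proof (cases "I = {}")
    case False
    define M where "M = Max (w ` I)"
    have M: "w i \<le> M" if "i \<in> I" for i using that less.prems(1) by (simp add: M_def)
    have "M \<in> w ` I" unfolding M_def using False less.prems(1) by (intro Max_in) auto
    then obtain j where j: "j \<in> I" "w j = M" by auto
    have top: "(\<Sum>i\<in>{i \<in> I. w i = M}. r i) = 0"
      by (rule leading_sum_zero[where w = w, OF less.prems M])
    show ?thesis
    proof (cases "E = M")
      case False
      let ?J = "{i \<in> I. w i \<noteq> M}"
      have "sum r I = sum r {i \<in> I. w i = M} + sum r ?J"
        using less.prems(1) by (subst sum.union_disjoint[symmetric]) (auto intro: sum.cong)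
      then have "sum r ?J = 0" using less.prems(3) top by simp
      moreover have "card ?J < card I" using j less.prems(1) by (intro psubset_card_mono) auto
      ultimately have "(\<Sum>i\<in>{i \<in> ?J. w i = E}. r i) = 0"
        using less.prems(1,2) by (intro less.hyps) auto
      moreover have "{i \<in> ?J. w i = E} = {i \<in> I. w i = E}" using False by auto
      ultimately show ?thesis by simp
    qed (use top in simp)
  qed simp
qed

section \<open>Leading forms and polynomial relations\<close>

definition weight :: "(nat \<Rightarrow> int) \<Rightarrow> (nat \<Rightarrow>\<^sub>0 nat) \<Rightarrow> int" where
  "weight D \<mu> = (\<Sum>i\<in>Poly_Mapping.keys \<mu>. int (Poly_Mapping.lookup \<mu> i) * D i)"

lemma lead_mon:
  assumes "\<And>i. i \<in> Poly_Mapping.keys \<mu> \<Longrightarrow> lead (D i) (u i) (s i)"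
  shows "lead (weight D \<mu>) (const_rf c * mon u \<mu>) (const_rf c * mon s \<mu>)"
proof -
  have "lead (weight D \<mu>) (mon u \<mu>) (mon s \<mu>)"
    unfolding weight_def mon_def using assms by (intro lead_prod lead_power) auto
  then show ?thesis using lead_mult[OF lead_const] by fastforce
qed

text \<open>\<open>p'\<close> consists of the monomials of highest weight in \<open>p\<close>; the
  leading forms of all other terms fall into smaller degree.\<close>

lemma relation_lead:
  assumes u: "\<And>i. i < d \<Longrightarrow> lead (D i) (u i) (s i)"
    and p: "p \<in> polys d" "p \<noteq> 0" "meval const_rf u p = 0"
  shows "\<exists>p'\<in>polys d. p' \<noteq> 0 \<and> meval const_rf s p' = 0"
proof -
  let ?K = "Poly_Mapping.keys p"
  have K: "finite ?K" "?K \<noteq> {}" using p(2) by auto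
  define E where "E = Max (weight D ` ?K)"
  have ku: "lead (D i) (u i) (s i)" if "\<mu> \<in> ?K" "i \<in> Poly_Mapping.keys \<mu>" for \<mu> i
    using p(1) that u unfolding polys_def by blast
  let ?J = "{\<mu> \<in> ?K. weight D \<mu> = E}"
  have "(\<Sum>\<mu>\<in>?J. const_rf (Poly_Mapping.lookup p \<mu>) * mon s \<mu>) = 0"
    by (rule leading_sum_zero[where w = "weight D" and r = "\<lambda>\<mu>. const_rf (Poly_Mapping.lookup p \<mu>) * mon u \<mu>", OF K(1)])
       (use p(3) K in \<open>auto simp: meval_def E_def intro: lead_mon ku\<close>)
  moreover define p' where "p' = (\<Sum>\<mu>\<in>?J. Poly_Mapping.single \<mu> (Poly_Mapping.lookup p \<mu>))"
  ultimately have "meval const_rf s p' = 0"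
    by (simp add: const_rf.meval_sum)
  moreover have "p' \<noteq> 0"
  proof -
    have "E \<in> weight D ` ?K" unfolding E_def using K by (intro Max_in) auto
    then obtain \<mu> where mu: "\<mu> \<in> ?J" by auto
    have "Poly_Mapping.lookup p' \<mu> = Poly_Mapping.lookup p \<mu>"
      using mu K(1) by (simp add: p'_def lookup_sum lookup_single when_def)
    then show ?thesis using mu by (auto simp: in_keys_iff)
  qed
  moreover have "p' \<in> polys d"
    unfolding p'_def using p(1) by (intro polys_sum) (auto simp: polys_def)
  ultimately show ?thesis by blast
qed

text \<open>The contrapositive of \<open>relation_lead\<close>. It shows that passing to leading
  forms does not raise the transcendence degree.\<close>

lemma alg_indep_lead:
  fixes u s :: "'i \<Rightarrow> 'k ratfun"
  assumes u: "\<And>j. j \<in> set js \<Longrightarrow> lead (D j) (u j) (s j)" and s: "alg_indep consts_rf (map s js)"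
  shows "alg_indep consts_rf (map u js)"
proof -
  let ?d = "length js" and ?j = "\<lambda>i. rev js ! i"
  have eq: "map (\<lambda>i. f (?j i)) (rev [0..<?d]) = map f js" for f :: "'i \<Rightarrow> 'k ratfun"
  proof -
    have "map ?j [0..<?d] = rev js" using map_nth[of "rev js"] by simp
    then have "map f (map ?j [0..<?d]) = rev (map f js)" by (simp add: rev_map)
    then show ?thesis by (simp add: rev_map[symmetric] comp_def)
  qed
  have "p = 0" if p: "p \<in> polys ?d" "meval const_rf (\<lambda>i. u (?j i)) p = 0" for p
  proof (rule ccontr)
    assume "p \<noteq> 0"
    have "lead (D (?j i)) (u (?j i)) (s (?j i))" if "i < ?d" for i
      using that by (intro u) (metis length_rev nth_mem set_rev)
    then obtain p' where "p' \<in> polys ?d" "p' \<noteq> 0" "meval const_rf (\<lambda>i. s (?j i)) p' = 0"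
      using relation_lead[of ?d "\<lambda>i. D (?j i)" "\<lambda>i. u (?j i)" "\<lambda>i. s (?j i)" p] p \<open>p \<noteq> 0\<close> by blast
    then show False using s alg_indep_iff_relations[of "\<lambda>i. s (?j i)" ?d] unfolding eq by blast
  qed
  then show ?thesis using alg_indep_iff_relations[of "\<lambda>i. u (?j i)" ?d] unfolding eq by blast
qed

text \<open>Relations among homogeneous elements split into weighted homogeneous components. The
  rescaling multiplies the component of weight \<open>e\<close> by \<open>c ^ e\<close>, so each
  component still vanishes. Geometrically, the multiplicative group acts on the closure of the
  image.\<close>

lemma relations_rescale:
  assumes u: "\<And>i. i < m \<Longrightarrow> lead (int (k i)) (u i) (u i)"
  shows "relations m u \<subseteq> relations m (\<lambda>i. c ^ k i * u i)"
proof
  fix p assume p: "p \<in> relations m u"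
  let ?K = "Poly_Mapping.keys p"
  let ?w = "\<lambda>\<mu>. \<Sum>i\<in>Poly_Mapping.keys \<mu>. Poly_Mapping.lookup \<mu> i * k i"
  let ?t = "\<lambda>\<mu>. const_rf (Poly_Mapping.lookup p \<mu>) * mon u \<mu>"
  have w: "weight (\<lambda>i. int (k i)) \<mu> = int (?w \<mu>)" for \<mu> by (simp add: weight_def)
  have ku: "lead (int (k i)) (u i) (u i)" if "\<mu> \<in> ?K" "i \<in> Poly_Mapping.keys \<mu>" for \<mu> i
    using p that u unfolding hom_kernel_def polys_def by blast
  have comp: "(\<Sum>\<mu>\<in>{\<mu> \<in> ?K. ?w \<mu> = e}. ?t \<mu>) = 0" for e
  proof -
    have "(\<Sum>\<mu>\<in>{\<mu> \<in> ?K. weight (\<lambda>i. int (k i)) \<mu> = int e}. ?t \<mu>) = 0"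
      by (rule homogeneous_sum_zero) (use p in \<open>auto simp: hom_kernel_def meval_def intro: lead_mon ku\<close>)
    then show ?thesis unfolding w of_nat_eq_iff .
  qed
  have "mon (\<lambda>i. c ^ k i * u i) \<mu> = c ^ ?w \<mu> * mon u \<mu>" for \<mu>
    by (simp add: mon_def power_mult_distrib prod.distrib power_sum power_mult[symmetric] mult.commute)
  then have "meval const_rf (\<lambda>i. c ^ k i * u i) p = (\<Sum>\<mu>\<in>?K. c ^ ?w \<mu> * ?t \<mu>)"
    by (simp add: meval_def mult_ac)
  also have "\<dots> = (\<Sum>e\<in>?w ` ?K. \<Sum>\<mu>\<in>{\<mu> \<in> ?K. ?w \<mu> = e}. c ^ ?w \<mu> * ?t \<mu>)"
    by (rule sum.image_gen) simp
  also have "\<dots> = (\<Sum>e\<in>?w ` ?K. c ^ e * (\<Sum>\<mu>\<in>{\<mu> \<in> ?K. ?w \<mu> = e}. ?t \<mu>))"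
    by (intro sum.cong) (auto simp: sum_distrib_left)
  also have "\<dots> = 0" by (simp add: comp)
  finally show "p \<in> relations m (\<lambda>i. c ^ k i * u i)" using p by (simp add: hom_kernel_def)
qed

definition degree_zero :: "'k ratfun set" where "degree_zero = {r. lead 0 r r}"

lemma degree_zero_closed:
  shows "const_rf c \<in> degree_zero" "x \<in> degree_zero \<Longrightarrow> y \<in> degree_zero \<Longrightarrow> x + y \<in> degree_zero"
    "x \<in> degree_zero \<Longrightarrow> y \<in> degree_zero \<Longrightarrow> x * y \<in> degree_zero"
    "x \<in> degree_zero \<Longrightarrow> - x \<in> degree_zero"
    "g \<in> carrier G \<Longrightarrow> x \<in> degree_zero \<Longrightarrow> act g x \<in> degree_zero"
  using lead_const[of c] lead_add[of 0 x x y y] lead_mult[of 0 x x 0 y y] lead_act[of g 0 x x]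
    lead_mult[OF lead_const[of "- 1"], of 0 x x]
  by (simp_all add: degree_zero_def const_rf.hom_uminus)

lemma rgen_degree_zero: "S \<subseteq> degree_zero \<Longrightarrow> rgen S \<subseteq> degree_zero"
  using degree_zero_closed(1)[of 1] by (intro rgen_least) (auto intro: degree_zero_closed)

text \<open>In an equation for \<open>u\<close> over \<open>S\<close> the terms have the distinct
  degrees \<open>i * d\<close>, so they vanish separately, in particular the leading one.\<close>

lemma homogeneous_not_acl:
  assumes u: "lead d u u" "u \<noteq> 0" "d \<noteq> 0" and S: "S \<subseteq> degree_zero"
  shows "u \<notin> acl S"
proof
  assume "u \<in> acl S"
  then obtain p where p: "p \<noteq> 0" "\<And>i. coeff p i \<in> rgen S" "poly p u = 0" by (auto elim: aclE)
  have l: "lead (int i * d) (coeff p i * u ^ i) (coeff p i * u ^ i)" for i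
  proof -
    have "lead 0 (coeff p i) (coeff p i)" using rgen_degree_zero[OF S] p(2)[of i] by (auto simp: degree_zero_def)
    from lead_mult[OF this lead_power[OF u(1), of i]] show ?thesis by simp
  qed
  let ?k = "Polynomial.degree p"
  have "(\<Sum>i\<in>{i \<in> {..?k}. int i * d = int ?k * d}. coeff p i * u ^ i) = 0"
    by (rule homogeneous_sum_zero) (use l p(3) in \<open>auto simp: poly_altdef\<close>)
  moreover have "{i \<in> {..?k}. int i * d = int ?k * d} = {?k}" using u(3) by auto
  ultimately show False using p(1) u(2) by simp
qed

end

section \<open>Homogeneous families\<close>

lemma acl_field_hom_image:
  assumes h: "field_hom h" and S: "h ` S \<subseteq> acl T"
  shows "h ` acl S \<subseteq> acl (T :: 'b::field set)"
proof
  interpret field_hom h by fact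
  fix y assume "y \<in> h ` acl S"
  then obtain x p where x: "y = h x" and p: "p \<noteq> 0" "\<And>i. coeff p i \<in> rgen S" "poly p x = 0"
    by (auto simp: acl_def)
  have rg: "h r \<in> rgen (h ` S)" if "r \<in> rgen S" for r
    using that by induction (auto simp: hom_add hom_mult hom_uminus intro: rgen.intros)
  have "y \<in> acl (h ` S)"
  proof (rule aclI)
    show "map_poly h p \<noteq> 0" using p(1) by (simp add: map_poly_eq_0_iff)
    show "coeff (map_poly h p) i \<in> rgen (h ` S)" for i by (simp add: coeff_map_poly rg p(2))
    have "poly (map_poly h p) (h x) = h (poly p x)"
      by (simp add: poly_altdef degree_map_poly coeff_map_poly hom_sum hom_mult hom_power)
    then show "poly (map_poly h p) y = 0" using p(3) x by simp
  qed
  then show "y \<in> acl T" using acl_idem[OF S] by blast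
qed

lemma relations_cong: "(\<And>i. i < m \<Longrightarrow> f i = g i) \<Longrightarrow> relations m f = relations m g"
proof -
  assume *: "\<And>i. i < m \<Longrightarrow> f i = g i"
  have "meval const_rf f p = meval const_rf g p" if "p \<in> polys m" for p
    by (rule meval_unique_polys[OF const_rf.comm_ring_hom_meval const_rf.comm_ring_hom_meval that]) (simp_all add: *)
  then show ?thesis by (auto simp: hom_kernel_def)
qed

context covariant_setting
begin

lemma good_scale:
  assumes good: "good \<psi>" and c: "\<And>h. h \<in> carrier G - {\<one>} \<Longrightarrow> c h \<in> ratfuns n \<and> c h \<noteq> 0 \<and> (\<forall>g\<in>carrier G. act g (c h) = c h)"
  shows "good (\<lambda>h i. c h * \<psi> h i)"
  unfolding good_def equivariant_def
proof (intro ballI conjI allI impI)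
  fix h i assume h: "h \<in> carrier G - {\<one>}" and i: "i < N"
  then have h': "h \<in> carrier G" "h \<noteq> \<one>" by auto
  note D = goodD[OF good h']
  show "c h * \<psi> h i \<in> ratfuns n" using c[OF h] D(1)[OF i] by (simp add: ratfuns_mult)
  show "mact N (Pr h) (\<lambda>i. c h * \<psi> h i) i = c h * \<psi> h i" using D(3)[OF i] by (simp add: mact_scale)
  fix g assume g: "g \<in> carrier G"
  interpret field_hom "act g" by (rule field_hom_act[OF g])
  show "act g (c h * \<psi> h i) = mact N (\<sigma> g) (\<lambda>i. c h * \<psi> h i) i"
    using D(2)[OF g i] c[OF h] g by (simp add: mact_scale hom_mult)
next
  fix h assume h: "h \<in> carrier G - {\<one>}"
  then show "\<exists>i<N. c h * \<psi> h i \<noteq> 0" using goodD(4)[OF good, of h] c[OF h] by auto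
qed

lemma flatten_index: "j < flat_dim \<Longrightarrow> flatten \<psi> $ j = \<psi> (elems ! (j div N)) (j mod N)"
  by (simp add: flatten_def)

lemma elems_index: "j < flat_dim \<Longrightarrow> elems ! (j div N) \<in> carrier G - {\<one>} \<and> j mod N < N"
  using block_index[of j "length elems" N] set_elems nth_mem unfolding flat_dim_def by blast

lemma flatten_dim_le:
  fixes f :: "'k ratfun vec"
  assumes good: "good \<psi>" and f: "rational_map n' m f"
    and sub: "\<And>h i. h \<in> carrier G - {\<one>} \<Longrightarrow> i < N \<Longrightarrow> \<psi> h i \<in> acl (consts_rf \<union> ($) f ` {..<m})"
  shows "map_dim n flat_dim (flatten \<psi>) \<le> map_dim n' m f"
proof -
  obtain vs where vs: "($) f ` {..<m} \<subseteq> acl (consts_rf \<union> set vs)" "map_dim n' m f = enat (length vs)"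
    using map_dim_basis[OF f] by blast
  have "consts_rf \<union> ($) f ` {..<m} \<subseteq> acl (consts_rf \<union> set vs)"
    using vs(1) acl_base[of "consts_rf \<union> set vs"] by blast
  then have "acl (consts_rf \<union> ($) f ` {..<m}) \<subseteq> acl (consts_rf \<union> set vs)" by (rule acl_idem)
  then have "flatten \<psi> $ j \<in> acl (consts_rf \<union> set vs)" if "j < flat_dim" for j
    using sub elems_index[OF that] by (auto simp: flatten_index[OF that])
  then show ?thesis using map_dim_le[OF flatten_rational[OF good]] vs(2) by simp
qed

definition entries :: "('g \<Rightarrow> nat \<Rightarrow> 'k ratfun) \<Rightarrow> 'k ratfun set" where
  "entries \<psi> = {\<psi> h i | h i. h \<in> carrier G - {\<one>} \<and> i < N}"

lemma flatten_entries: "($) (flatten \<psi>) ` {..<flat_dim} = entries \<psi>"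
  by (simp add: flatten_components entries_def)

text \<open>The group maps an entry to a linear combination of entries. Stability of this field
  keeps norms of entries, and the ring of degree 0 elements used for the trivial center, within
  functions algebraic over the entries.\<close>

lemma act_acl_entries:
  assumes good: "good \<psi>" and g: "g \<in> carrier G" and x: "x \<in> acl (consts_rf \<union> entries \<psi>)"
  shows "act g x \<in> acl (consts_rf \<union> entries \<psi>)"
proof -
  have "act g ` (consts_rf \<union> entries \<psi>) \<subseteq> acl (consts_rf \<union> entries \<psi>)"
  proof
    fix y assume "y \<in> act g ` (consts_rf \<union> entries \<psi>)"
    then consider c where "y = const_rf c" | h i where "h \<in> carrier G - {\<one>}" "i < N" "y = act g (\<psi> h i)"
      by (auto simp: entries_def)
    then show "y \<in> acl (consts_rf \<union> entries \<psi>)"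
    proof cases
      case 1
      then show ?thesis using acl_base[of "consts_rf \<union> entries \<psi>"] by auto
    next
      case 2
      then have "y = (\<Sum>j<N. const_rf (\<sigma> g $$ (i, j)) * \<psi> h j)"
        using goodD(2)[OF good, of h g i] g by (simp add: mact_def)
      also have "\<dots> \<in> rgen (consts_rf \<union> entries \<psi>)"
        using 2 by (intro rgen_sum rgen.mult rgen.base) (auto simp: entries_def)
      finally show ?thesis using rgen_acl by blast
    qed
  qed
  from acl_field_hom_image[OF field_hom_act[OF g] this] show ?thesis using x by blast
qed

end

locale graded_setting = covariant_setting G n \<rho> N \<sigma> Pr + graded_group G n \<rho> \<Theta>
  for G :: "('g, 'b) monoid_scheme" (structure) and n and \<rho> :: "'g \<Rightarrow> 'k::field mat"
    and N and \<sigma> :: "'g \<Rightarrow> 'k mat" and Pr :: "'g \<Rightarrow> 'k mat" and \<Theta>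
begin

text \<open>The exponent \<open>e\<close> is the largest degree of a numerator and is common to all
  entries: the group mixes the entries linearly, so only components of one common degree form a
  covariant again.\<close>

lemma leading_vector:
  assumes b: "b \<in> polys n" "b \<noteq> 0" and a: "\<And>i. i < N \<Longrightarrow> a i \<in> polys n" and nz: "\<exists>i<N. a i \<noteq> 0"
  shows "\<exists>e. (\<exists>i<N. coeff (\<Theta> (a i)) e \<noteq> 0) \<and>
    (\<forall>i<N. let s = Fract (coeff (\<Theta> (a i)) e) (Polynomial.lead_coeff (\<Theta> b));
       d = int e - int (Polynomial.degree (\<Theta> b)) in
       lead d (Fract (a i) b) s \<and> lead d s s \<and> s \<in> ratfuns n)"
proof -
  define e where "e = Max ((\<lambda>i. Polynomial.degree (\<Theta> (a i))) ` {i. i < N \<and> a i \<noteq> 0})"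
  let ?S = "{i. i < N \<and> a i \<noteq> 0}"
  have fS: "finite ?S" "?S \<noteq> {}" using nz by auto
  have e: "Polynomial.degree (\<Theta> (a i)) \<le> e" if "i < N" for i
  proof (cases "a i = 0")
    case False
    then show ?thesis unfolding e_def using that fS by (intro Max_ge) auto
  qed simp
  have "e \<in> (\<lambda>i. Polynomial.degree (\<Theta> (a i))) ` ?S" unfolding e_def using fS by (intro Max_in) auto
  then obtain i0 where i0: "i0 < N" "a i0 \<noteq> 0" "e = Polynomial.degree (\<Theta> (a i0))" by auto
  let ?l = "Polynomial.lead_coeff (\<Theta> b)"
  have l: "?l \<noteq> 0" "?l \<in> polys n" using b Theta_polys by simp_all
  have Tl: "\<Theta> ?l = monom ?l (Polynomial.degree (\<Theta> b))" by (rule Theta_coeff)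
  have "lead (int e - int (Polynomial.degree (\<Theta> b))) (Fract (a i) b) (Fract (coeff (\<Theta> (a i)) e) ?l) \<and>
      lead (int e - int (Polynomial.degree (\<Theta> b))) (Fract (coeff (\<Theta> (a i)) e) ?l) (Fract (coeff (\<Theta> (a i)) e) ?l) \<and>
      Fract (coeff (\<Theta> (a i)) e) ?l \<in> ratfuns n" if i: "i < N" for i
  proof (intro conjI)
    show "lead (int e - int (Polynomial.degree (\<Theta> b))) (Fract (a i) b) (Fract (coeff (\<Theta> (a i)) e) ?l)"
      by (rule leadI[OF b(2) e[OF i]])
    have "Polynomial.degree (\<Theta> (coeff (\<Theta> (a i)) e)) \<le> e" unfolding Theta_coeff by (rule degree_monom_le)
    from leadI[OF l(1) this]
    show "lead (int e - int (Polynomial.degree (\<Theta> b))) (Fract (coeff (\<Theta> (a i)) e) ?l) (Fract (coeff (\<Theta> (a i)) e) ?l)"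
      unfolding Tl Theta_coeff using l(1) by (simp add: degree_monom_eq)
    show "Fract (coeff (\<Theta> (a i)) e) ?l \<in> ratfuns n"
      unfolding ratfuns_iff using l Theta_polys a[OF i] by blast
  qed
  moreover have "coeff (\<Theta> (a i0)) e \<noteq> 0" using i0 by simp
  ultimately show ?thesis using i0(1) by (intro exI[of _ e]) (auto simp: Let_def)
qed

text \<open>Equivariance and the equation for \<open>Pr h\<close> are linear with constant
  coefficients, so they pass to the components of degree \<open>D h\<close>, which are determined by
  \<open>lead_unique\<close>.\<close>

lemma good_from_lead:
  assumes good: "good \<psi>"
    and lead: "\<And>h i. h \<in> carrier G - {\<one>} \<Longrightarrow> i < N \<Longrightarrow> lead (D h) (\<psi> h i) (\<psi>' h i) \<and> \<psi>' h i \<in> ratfuns n"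
    and nz: "\<And>h. h \<in> carrier G - {\<one>} \<Longrightarrow> \<exists>i<N. \<psi>' h i \<noteq> 0"
  shows "good \<psi>'"
  unfolding good_def equivariant_def
proof (intro ballI conjI allI impI)
  fix h i assume h: "h \<in> carrier G - {\<one>}" and i: "i < N"
  then have h': "h \<in> carrier G" "h \<noteq> \<one>" by auto
  have lm: "lead (D h) (mact N A (\<psi> h) i) (mact N A (\<psi>' h) i)" for A
    unfolding mact_def using i lead_mult[OF lead_const] lead[OF h] by (intro lead_sum) fastforce+
  show "\<psi>' h i \<in> ratfuns n" using lead[OF h i] by blast
  show "mact N (Pr h) (\<psi>' h) i = \<psi>' h i"
    using lm[of "Pr h"] lead[OF h i] goodD(3)[OF good h' i] lead_unique by metis
  fix g assume g: "g \<in> carrier G"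
  show "act g (\<psi>' h i) = mact N (\<sigma> g) (\<psi>' h) i"
    using lm[of "\<sigma> g"] lead_act[OF g] lead[OF h i] goodD(2)[OF good h' g i] lead_unique by metis
qed (rule nz)

definition homogeneous :: "('g \<Rightarrow> int) \<Rightarrow> ('g \<Rightarrow> nat \<Rightarrow> 'k ratfun) \<Rightarrow> bool" where
  "homogeneous D \<psi> \<longleftrightarrow> (\<forall>h\<in>carrier G - {\<one>}. \<forall>i<N. lead (D h) (\<psi> h i) (\<psi> h i))"

lemma map_dim_lead:
  assumes good: "good \<psi>" "good \<psi>'"
    and lead: "\<And>h i. h \<in> carrier G - {\<one>} \<Longrightarrow> i < N \<Longrightarrow> lead (D h) (\<psi> h i) (\<psi>' h i)"
  shows "map_dim n flat_dim (flatten \<psi>') \<le> map_dim n flat_dim (flatten \<psi>)"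
proof -
  obtain vs where vs: "alg_indep consts_rf vs" "set vs \<subseteq> ($) (flatten \<psi>') ` {..<flat_dim}"
      "map_dim n flat_dim (flatten \<psi>') = enat (length vs)"
    using map_dim_basis[OF flatten_rational[OF good(2)]] by blast
  obtain js where js: "vs = map (($) (flatten \<psi>')) js" "set js \<subseteq> {..<flat_dim}"
    using ex_map_index[OF vs(2)] by blast
  have "alg_indep consts_rf (map (($) (flatten \<psi>)) js)"
  proof (rule alg_indep_lead[where D = "\<lambda>j. D (elems ! (j div N))"])
    show "alg_indep consts_rf (map (($) (flatten \<psi>')) js)" using vs(1) js(1) by simp
    fix j assume "j \<in> set js"
    then have j: "j < flat_dim" using js(2) by auto
    then show "lead (D (elems ! (j div N))) (flatten \<psi> $ j) (flatten \<psi>' $ j)"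
      using lead elems_index[OF j] by (simp add: flatten_index)
  qed
  then have "enat (length js) \<le> map_dim n flat_dim (flatten \<psi>)"
    using map_dim_ge[OF flatten_rational[OF good(1)], of "map (($) (flatten \<psi>)) js"] js(2) by auto
  then show ?thesis using vs(3) js(1) by simp
qed

text \<open>The denominators are parameters because of the regular case: for denominator 1 the last
  conjunct yields polynomial leading forms and degrees \<open>D h\<close> that are not
  negative.\<close>

lemma homogenise_with:
  assumes good: "good \<psi>"
    and B: "\<And>h. h \<in> carrier G - {\<one>} \<Longrightarrow> B h \<in> polys n \<and> B h \<noteq> 0 \<and> (\<forall>i<N. \<exists>a\<in>polys n. \<psi> h i = Fract a (B h))"
  shows "\<exists>D \<psi>'. good \<psi>' \<and> homogeneous D \<psi>' \<and> map_dim n flat_dim (flatten \<psi>') \<le> map_dim n flat_dim (flatten \<psi>) \<and>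
    (\<forall>h\<in>carrier G - {\<one>}. \<forall>i<N. \<exists>a e. \<psi>' h i = Fract (coeff (\<Theta> a) e) (Polynomial.lead_coeff (\<Theta> (B h))) \<and>
      D h = int e - int (Polynomial.degree (\<Theta> (B h))))"
proof -
  have "\<exists>d s. (\<forall>i<N. lead d (\<psi> h i) (s i) \<and> lead d (s i) (s i) \<and> s i \<in> ratfuns n \<and>
      (\<exists>a e. s i = Fract (coeff (\<Theta> a) e) (Polynomial.lead_coeff (\<Theta> (B h))) \<and> d = int e - int (Polynomial.degree (\<Theta> (B h))))) \<and>
      (\<exists>i<N. s i \<noteq> 0)"
    if h: "h \<in> carrier G - {\<one>}" for h
  proof -
    have h': "h \<in> carrier G" "h \<noteq> \<one>" using h by auto
    note b = B[OF h]
    then have "\<forall>i. \<exists>a. i < N \<longrightarrow> a \<in> polys n \<and> \<psi> h i = Fract a (B h)" by blast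
    then obtain a where a: "\<And>i. i < N \<Longrightarrow> a i \<in> polys n" "\<And>i. i < N \<Longrightarrow> \<psi> h i = Fract (a i) (B h)" by metis
    have "\<exists>i<N. a i \<noteq> 0" using goodD(4)[OF good h'] a(2) by (metis fract_collapse(1))
    from leading_vector[OF conjunct1[OF b] conjunct1[OF conjunct2[OF b]] a(1) this]
    obtain e where e: "\<exists>i<N. coeff (\<Theta> (a i)) e \<noteq> 0"
      "\<forall>i<N. let s = Fract (coeff (\<Theta> (a i)) e) (Polynomial.lead_coeff (\<Theta> (B h)));
       d = int e - int (Polynomial.degree (\<Theta> (B h))) in
       lead d (Fract (a i) (B h)) s \<and> lead d s s \<and> s \<in> ratfuns n" by auto
    have "Fract (coeff (\<Theta> (a i)) e) (Polynomial.lead_coeff (\<Theta> (B h))) \<noteq> 0" if "coeff (\<Theta> (a i)) e \<noteq> 0" for i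
      using that b by (simp add: Zero_fract_def eq_fract)
    then show ?thesis
      using e a(2)
      by (intro exI[of _ "int e - int (Polynomial.degree (\<Theta> (B h)))"]
          exI[of _ "\<lambda>i. Fract (coeff (\<Theta> (a i)) e) (Polynomial.lead_coeff (\<Theta> (B h)))"]) (auto simp: Let_def)
  qed
  then obtain D \<psi>' where *: "\<And>h. h \<in> carrier G - {\<one>} \<Longrightarrow>
      (\<forall>i<N. lead (D h) (\<psi> h i) (\<psi>' h i) \<and> lead (D h) (\<psi>' h i) (\<psi>' h i) \<and> \<psi>' h i \<in> ratfuns n \<and>
      (\<exists>a e. \<psi>' h i = Fract (coeff (\<Theta> a) e) (Polynomial.lead_coeff (\<Theta> (B h))) \<and> D h = int e - int (Polynomial.degree (\<Theta> (B h))))) \<and>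
      (\<exists>i<N. \<psi>' h i \<noteq> 0)"
    by metis
  have g': "good \<psi>'" by (rule good_from_lead[OF good, of D]) (use * in blast)+
  moreover have "homogeneous D \<psi>'" using * by (simp add: homogeneous_def)
  moreover have "map_dim n flat_dim (flatten \<psi>') \<le> map_dim n flat_dim (flatten \<psi>)"
    by (rule map_dim_lead[OF good g', of D]) (use * in blast)
  ultimately show ?thesis using * by (intro exI[of _ D] exI[of _ \<psi>']) blast
qed

lemma homogenise:
  assumes good: "good \<psi>"
  shows "\<exists>D \<psi>'. good \<psi>' \<and> homogeneous D \<psi>' \<and> map_dim n flat_dim (flatten \<psi>') \<le> map_dim n flat_dim (flatten \<psi>)"
proof -
  have "\<exists>b. b \<in> polys n \<and> b \<noteq> 0 \<and> (\<forall>i<N. \<exists>a\<in>polys n. \<psi> h i = Fract a b)"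
    if h: "h \<in> carrier G - {\<one>}" for h
  proof -
    have "\<psi> h ` {..<N} \<subseteq> ratfuns n" using goodD(1)[OF good, of h] h by auto
    from common_denominator[OF _ this] show ?thesis by auto
  qed
  then obtain B where B: "\<And>h. h \<in> carrier G - {\<one>} \<Longrightarrow>
      B h \<in> polys n \<and> B h \<noteq> 0 \<and> (\<forall>i<N. \<exists>a\<in>polys n. \<psi> h i = Fract a (B h))" by metis
  show ?thesis using homogenise_with[OF good B] by blast
qed

text \<open>A power of an invariant of nonzero degree in the field generated by \<open>\<psi>\<close> makes all degrees
  positive; then a suitable power of an invariant denominator can be absorbed by the action of the
  multiplicative group on the closure of the image.\<close>

lemma regularise_homogeneous:
  assumes good: "good \<psi>" and hom: "homogeneous D \<psi>" and h0: "h0 \<in> carrier G - {\<one>}" "D h0 \<noteq> 0"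
  shows "\<exists>\<chi>. good \<chi> \<and> regular_map n flat_dim (flatten \<chi>) \<and>
    map_dim n flat_dim (flatten \<chi>) \<le> map_dim n flat_dim (flatten \<psi>)"
proof -
  have h0': "h0 \<in> carrier G" "h0 \<noteq> \<one>" using h0 by auto
  obtain i0 where i0: "i0 < N" "\<psi> h0 i0 \<noteq> 0" using goodD(4)[OF good h0'] by blast
  let ?x = "\<psi> h0 i0" and ?A = "acl (consts_rf \<union> entries \<psi>)"
  have lx: "lead (D h0) ?x ?x" using hom h0 i0 by (simp add: homogeneous_def)
  have eA: "entries \<psi> \<subseteq> ?A" using acl_base[of "consts_rf \<union> entries \<psi>"] by blast
  have xA: "?x \<in> ?A" using eA h0 i0 by (auto simp: entries_def)
  \<comment> \<open>The norm of an entry of nonzero degree is an invariant of nonzero degree. It is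
    algebraic over the entries, so multiplying by its powers does not raise the dimension.\<close>
  define H where "H = (\<Prod>g\<in>carrier G. act g ?x)"
  have "0 < card (carrier G)" using fin h0' by (auto simp: card_gt_0_iff)
  have lH: "lead (int (card (carrier G)) * D h0) H H"
    using lead_prod[OF fin, of "\<lambda>_. D h0" "\<lambda>g. act g ?x" "\<lambda>g. act g ?x"] lead_act[OF _ lx] by (simp add: H_def)
  have H0: "H \<noteq> 0"
  proof -
    have "act g ?x \<noteq> 0" if "g \<in> carrier G" for g
    proof -
      interpret field_hom "act g" by (rule field_hom_act[OF that])
      show ?thesis using i0 by simp
    qed
    then show ?thesis using fin by (simp add: H_def)
  qed
  have aH: "act g H = H" if g: "g \<in> carrier G" for g
  proof -
    interpret field_hom "act g" by (rule field_hom_act[OF g])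
    have "act g H = (\<Prod>h\<in>carrier G. act (h \<otimes> g) ?x)"
      unfolding H_def hom_prod using g by (intro prod.cong) (simp_all add: act_mult)
    also have "\<dots> = H" unfolding H_def
      by (rule prod.reindex_bij_witness[of _ "\<lambda>h. h \<otimes> inv g" "\<lambda>h. h \<otimes> g"]) (use g in \<open>simp_all add: m_assoc\<close>)
    finally show ?thesis .
  qed
  have HA: "H \<in> ?A"
  proof -
    have "H \<in> rgen ?A" unfolding H_def using act_acl_entries[OF good _ xA] by (intro rgen_prod rgen.base)
    then show ?thesis using rgen_subset_acl[of ?A "consts_rf \<union> entries \<psi>"] by blast
  qed
  have Hn: "H \<in> ratfuns n"
    unfolding H_def using goodD(1)[OF good h0' i0(1)] by (intro ratfuns_prod act_ratfuns)
  define y where "y = (if D h0 > 0 then H else inverse H)"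
  define \<delta> where "\<delta> = int (card (carrier G)) * \<bar>D h0\<bar>"
  have ly: "lead \<delta> y y"
    using lH lead_inverse[OF lH H0] by (auto simp: y_def \<delta>_def abs_if)
  have \<delta>: "\<delta> \<ge> 1"
  proof -
    have "int (card (carrier G)) \<ge> 1" "\<bar>D h0\<bar> \<ge> 1" using \<open>0 < card (carrier G)\<close> h0(2) by linarith+
    then have "1 * 1 \<le> \<delta>" unfolding \<delta>_def by (intro mult_mono) auto
    then show ?thesis by simp
  qed
  have y0: "y \<noteq> 0" and yA: "y \<in> ?A" and yn: "y \<in> ratfuns n"
    using H0 HA Hn by (auto simp: y_def acl_inverse ratfuns_inverse)
  have ay: "act g y = y" if g: "g \<in> carrier G" for g
  proof -
    interpret field_hom "act g" by (rule field_hom_act[OF g])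
    show ?thesis using aH[OF g] by (simp add: y_def hom_inverse)
  qed
  \<comment> \<open>As \<open>y\<close> has degree at least 1, the degree of \<open>y ^ M\<close>
    exceeds the absolute value of every \<open>D h\<close>, and the new degrees \<open>k h\<close>
    are positive.\<close>
  define M where "M = nat (\<Sum>h\<in>carrier G. \<bar>D h\<bar>) + 1"
  have Mh: "D h + int M * \<delta> \<ge> 1" if "h \<in> carrier G" for h
  proof -
    have "\<bar>D h\<bar> \<le> (\<Sum>h\<in>carrier G. \<bar>D h\<bar>)" using that fin by (intro member_le_sum) auto
    then have "\<bar>D h\<bar> + 1 \<le> int M" by (simp add: M_def)
    also have "\<dots> \<le> int M * \<delta>" using \<delta> mult_left_mono[of 1 \<delta> "int M"] by simp
    finally show ?thesis by linarith
  qed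
  define \<phi> where "\<phi> h i = y ^ M * \<psi> h i" for h i
  define k where "k h = nat (D h + int M * \<delta>)" for h
  have gphi: "good \<phi>" unfolding \<phi>_def
  proof (rule good_scale[OF good])
    fix h
    have "act g (y ^ M) = y ^ M" if g: "g \<in> carrier G" for g
    proof -
      interpret field_hom "act g" by (rule field_hom_act[OF g])
      show ?thesis using ay[OF g] by (simp add: hom_power)
    qed
    then show "y ^ M \<in> ratfuns n \<and> y ^ M \<noteq> 0 \<and> (\<forall>g\<in>carrier G. act g (y ^ M) = y ^ M)"
      using y0 yn by (simp add: ratfuns_power)
  qed
  have yM: "y ^ M \<in> ?A"
    using rgen_power[OF rgen.base[OF yA], of M] rgen_subset_acl[of ?A "consts_rf \<union> entries \<psi>"] by blast
  have lphi: "lead (int (k h)) (\<phi> h i) (\<phi> h i)" if h: "h \<in> carrier G - {\<one>}" "i < N" for h i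
  proof -
    have "lead (int M * \<delta> + D h) (\<phi> h i) (\<phi> h i)"
      unfolding \<phi>_def using hom h by (intro lead_mult lead_power ly) (auto simp: homogeneous_def)
    moreover have "int (k h) = int M * \<delta> + D h" using Mh[of h] h by (simp add: k_def)
    ultimately show ?thesis by simp
  qed
  have dphi: "map_dim n flat_dim (flatten \<phi>) \<le> map_dim n flat_dim (flatten \<psi>)"
  proof (rule flatten_dim_le[OF gphi flatten_rational[OF good]])
    fix h i assume "h \<in> carrier G - {\<one>}" "i < N"
    then have "\<psi> h i \<in> ?A" using eA by (auto simp: entries_def)
    then show "\<phi> h i \<in> acl (consts_rf \<union> ($) (flatten \<psi>) ` {..<flat_dim})"
      unfolding flatten_entries \<phi>_def using yM by (simp add: acl_mult)
  qed
  have "entries \<phi> \<subseteq> ratfuns n"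
    using goodD(1)[OF gphi] by (auto simp: entries_def)
  moreover have "finite (entries \<phi>)"
    unfolding flatten_entries[symmetric] by simp
  ultimately obtain b where b: "b \<in> polys n" "b \<noteq> 0" "\<forall>g\<in>carrier G. pact g b = b"
      "\<And>r. r \<in> entries \<phi> \<Longrightarrow> \<exists>a\<in>polys n. r = Fract a b"
    using invariant_denominator[of "entries \<phi>"] by blast
  let ?b = "to_fract b"
  \<comment> \<open>The exponent is the degree \<open>k h\<close>, as
    \<open>relations_rescale\<close> requires; being at least 1, it clears the denominator
    \<open>b\<close>.\<close>
  define \<chi> where "\<chi> h i = ?b ^ k h * \<phi> h i" for h i
  have gchi: "good \<chi>" unfolding \<chi>_def
  proof (rule good_scale[OF gphi])
    fix h
    have "act g (?b ^ k h) = ?b ^ k h" if g: "g \<in> carrier G" for g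
    proof -
      interpret field_hom "act g" by (rule field_hom_act[OF g])
      show ?thesis using b(3) g by (simp add: hom_power)
    qed
    then show "?b ^ k h \<in> ratfuns n \<and> ?b ^ k h \<noteq> 0 \<and> (\<forall>g\<in>carrier G. act g (?b ^ k h) = ?b ^ k h)"
      using b by (simp add: ratfuns_power ratfuns_to_fract)
  qed
  have "flatten \<chi> $ j \<in> {Fract a 1 | a. a \<in> polys n}" if j: "j < flat_dim" for j
  proof -
    let ?h = "elems ! (j div N)" and ?i = "j mod N"
    have hi: "?h \<in> carrier G - {\<one>}" "?i < N" using elems_index[OF j] by auto
    then obtain a where a: "a \<in> polys n" "\<phi> ?h ?i = Fract a b" using b(4)[of "\<phi> ?h ?i"] by (auto simp: entries_def)
    have "k ?h \<ge> 1" using Mh[of ?h] hi by (simp add: k_def)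
    then obtain k' where k': "k ?h = Suc k'" by (cases "k ?h") auto
    have "\<chi> ?h ?i = ?b ^ k' * (?b * (to_fract a / ?b))" by (simp add: \<chi>_def k' a(2) Fract_conv_to_fract)
    also have "\<dots> = ?b ^ k' * to_fract a" using b(2) by simp
    also have "\<dots> = to_fract (b ^ k' * a)"
    proof -
      interpret tf: comm_ring_hom "to_fract :: 'k mpoly \<Rightarrow> _" by simp
      show ?thesis by (simp add: tf.hom_mult tf.hom_power)
    qed
    finally have "flatten \<chi> $ j = Fract (b ^ k' * a) 1" by (simp add: flatten_index[OF j] to_fract_def)
    then show ?thesis using a(1) b(1) by (auto intro: polys_mult polys_power)
  qed
  then have reg: "regular_map n flat_dim (flatten \<chi>)" by (simp add: regular_map_def flatten_def)
  have "map_dim n flat_dim (flatten \<chi>) \<le> map_dim n flat_dim (flatten \<phi>)"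
  proof (rule map_dim_mono[OF flatten_rational[OF gphi] flatten_rational[OF gchi]])
    have "relations flat_dim (($) (flatten \<phi>)) \<subseteq> relations flat_dim (\<lambda>j. ?b ^ k (elems ! (j div N)) * flatten \<phi> $ j)"
      using lphi elems_index by (intro relations_rescale) (simp add: flatten_index)
    also have "\<dots> = relations flat_dim (($) (flatten \<chi>))"
      by (rule relations_cong) (simp add: flatten_index \<chi>_def)
    finally show "relations flat_dim (($) (flatten \<phi>)) \<subseteq> relations flat_dim (($) (flatten \<chi>))" .
  qed
  then show ?thesis using gchi reg dphi by (intro exI[of _ \<chi>]) auto
qed

end

section \<open>Roots of unity in the field of rational functions\<close>

text \<open>The order is lexicographic; \<open>M\<close> need not occur in \<open>a\<close>, in which case \<open>c = 0\<close>.\<close>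

definition top_coeff :: "'k::field mpoly \<Rightarrow> (nat \<Rightarrow>\<^sub>0 nat) \<Rightarrow> 'k \<Rightarrow> bool" where
  "top_coeff a M c \<longleftrightarrow> (\<forall>\<mu>\<in>Poly_Mapping.keys a. \<mu> \<le> M) \<and> Poly_Mapping.lookup a M = c"

lemma top_coeff_add: "top_coeff a M c \<Longrightarrow> top_coeff b M d \<Longrightarrow> top_coeff (a + b) M (c + d)"
  using keys_add[of a b] by (auto simp: top_coeff_def lookup_add)

lemma top_coeff_sum:
  assumes "\<And>i. i < (k::nat) \<Longrightarrow> top_coeff (f i) M (c i)"
  shows "top_coeff (\<Sum>i<k. f i) M (\<Sum>i<k. c i)"
  using assms
proof (induction k)
  case (Suc k)
  then show ?case by (simp add: top_coeff_add)
qed (simp add: top_coeff_def)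

text \<open>The order on exponents is compatible with addition, so \<open>M + N\<close> is reached
  only by the pair of top exponents.\<close>

lemma top_coeff_mult:
  assumes a: "top_coeff a M c" and b: "top_coeff b N d"
  shows "top_coeff (a * b) (M + N) (c * d)"
proof -
  have le: "\<mu> + \<nu> \<le> M + N" if "\<mu> \<in> Poly_Mapping.keys a" "\<nu> \<in> Poly_Mapping.keys b" for \<mu> \<nu>
    using that a b by (intro add_mono) (auto simp: top_coeff_def)
  have eq: "\<mu> = M \<and> \<nu> = N"
    if "\<mu> \<in> Poly_Mapping.keys a" "\<nu> \<in> Poly_Mapping.keys b" "\<mu> + \<nu> = M + N" for \<mu> \<nu>
  proof -
    have "\<mu> \<le> M" "\<nu> \<le> N" using that a b by (auto simp: top_coeff_def)
    then show ?thesis using that(3) by (metis add_left_cancel add_less_le_mono less_irrefl order_le_less)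
  qed
  let ?A = "Poly_Mapping.keys a" and ?B = "Poly_Mapping.keys b"
  have "a * b = (\<Sum>\<mu>\<in>?A. \<Sum>\<nu>\<in>?B. Poly_Mapping.single (\<mu> + \<nu>) (Poly_Mapping.lookup a \<mu> * Poly_Mapping.lookup b \<nu>))"
    by (subst (1) mpoly_sum_monomials[of a], subst (1) mpoly_sum_monomials[of b]) (simp add: sum_product mult_single)
  then have "Poly_Mapping.lookup (a * b) (M + N) =
      (\<Sum>\<mu>\<in>?A. \<Sum>\<nu>\<in>?B. Poly_Mapping.lookup a \<mu> * Poly_Mapping.lookup b \<nu> when \<mu> + \<nu> = M + N)"
    by (simp add: lookup_sum lookup_single)
  also have "\<dots> = (\<Sum>\<mu>\<in>?A. \<Sum>\<nu>\<in>?B. if \<mu> = M then if \<nu> = N then c * d else 0 else 0)"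
    using eq a b by (intro sum.cong) (auto simp: when_def top_coeff_def)
  also have "\<dots> = c * d"
  proof (cases "c = 0 \<or> d = 0")
    case True
    then show ?thesis by (auto intro!: sum.neutral)
  next
    case False
    then have "M \<in> ?A" "N \<in> ?B" using a b by (auto simp: top_coeff_def in_keys_iff)
    moreover have "(\<Sum>\<nu>\<in>?B. if \<mu> = M then if \<nu> = N then c * d else 0 else 0) = (if \<mu> = M then c * d else 0)" for \<mu>
      using \<open>N \<in> ?B\<close> by simp
    ultimately show ?thesis by simp
  qed
  finally have "Poly_Mapping.lookup (a * b) (M + N) = c * d" .
  moreover have "\<mu> \<le> M + N" if "\<mu> \<in> Poly_Mapping.keys (a * b)" for \<mu>
    using keys_mult[of a b] that le by blast
  ultimately show ?thesis by (simp add: top_coeff_def)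
qed

lemma top_coeff_power:
  assumes "top_coeff a M c" shows "top_coeff (a ^ i) (\<Sum>_<i. M) (c ^ i)"
proof (induction i)
  case 0
  show ?case by (simp add: top_coeff_def lookup_one)
next
  case (Suc i)
  from top_coeff_mult[OF this assms] show ?case by (simp add: mult.commute del: sum_constant)
qed

text \<open>In characteristic \<open>p\<close> the equation becomes
  \<open>(x - 1) ^ p = 0\<close>.\<close>

lemma root_of_unity_char:
  fixes x :: "'a::field"
  assumes p: "Factorial_Ring.prime p" "of_nat p = (0::'a)" "x ^ p = 1"
  shows "x = 1"
proof -
  have "CHAR('a) dvd p" using p(2) by (simp add: of_nat_eq_0_iff_char_dvd)
  moreover have "CHAR('a) \<noteq> 1" by (metis of_nat_CHAR of_nat_1 zero_neq_one)
  ultimately have c: "CHAR('a) = p" using p(1) by (metis prime_nat_iff)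
  have "((x - 1) + 1) ^ p = (x - 1) ^ p + 1 ^ p" using p(1) c by (intro freshmans_dream) auto
  then have "(x - 1) ^ p = 0" using p(3) by simp
  then show ?thesis by simp
qed

text \<open>In characteristic \<open>p\<close> only 1 occurs. Otherwise \<open>a\<close> and
  \<open>b\<close> have equal \<open>p\<close>-th powers, and a constant factor makes their top
  coefficients equal. The cofactor of \<open>a - b'\<close> in the difference of \<open>p\<close>-th
  powers then has top coefficient \<open>of_nat p * c ^ (p - 1)\<close>, which is not 0, so
  \<open>a = b'\<close>.\<close>

lemma root_of_unity_const:
  fixes x :: "'k::field ratfun"
  assumes p: "Factorial_Ring.prime p" and x: "x ^ p = 1"
  shows "x \<in> consts_rf"
proof (cases "of_nat p = (0::'k)")
  case True
  then have "of_nat p = (0::'k ratfun)" by (metis const_rf.hom_of_nat const_rf.hom_zero)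
  then have "x = const_rf 1" using root_of_unity_char[OF p _ x] by simp
  then show ?thesis by blast
next
  case False
  obtain a b where ab: "x = Fract a b" "b \<noteq> 0" by (cases x) auto
  have p0: "p > 0" using p prime_gt_0_nat by blast
  have a0: "a \<noteq> 0" using x p0 ab by (auto simp: fract_collapse power_0_left)
  interpret tf: comm_ring_hom "to_fract :: 'k mpoly \<Rightarrow> _" by simp
  have "to_fract (a ^ p) = to_fract (b ^ p)"
    using x ab(2) by (simp add: ab(1) Fract_conv_to_fract power_divide tf.hom_power)
  then have eq: "a ^ p = b ^ p" by (simp only: to_fract_eq_iff)
  \<comment> \<open>A common bound for both supports, so at first only one of \<open>c\<close> and
    \<open>d\<close> is known to be nonzero; equality of their \<open>p\<close>-th powers gives the
    other.\<close>
  define M where "M = max (Max (Poly_Mapping.keys a)) (Max (Poly_Mapping.keys b))"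
  define c where "c = Poly_Mapping.lookup a M"
  define d where "d = Poly_Mapping.lookup b M"
  have ca: "top_coeff a M c" and db: "top_coeff b M d"
    unfolding top_coeff_def c_def d_def M_def by (auto simp: le_max_iff_disj)
  have "Max (Poly_Mapping.keys a) \<in> Poly_Mapping.keys a" "Max (Poly_Mapping.keys b) \<in> Poly_Mapping.keys b"
    using a0 ab(2) by (auto intro!: Max_in)
  then have "c \<noteq> 0 \<or> d \<noteq> 0" unfolding c_def d_def M_def max_def by (auto simp: in_keys_iff)
  moreover have cd: "c ^ p = d ^ p"
    using top_coeff_power[OF ca, of p] top_coeff_power[OF db, of p] eq by (simp add: top_coeff_def)
  ultimately have c0: "c \<noteq> 0" and d0: "d \<noteq> 0" using p0 by (auto simp: power_0_left)
  define b' where "b' = mC (c / d) * b"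
  have b': "top_coeff b' M c"
    using db d0 by (auto simp: top_coeff_def b'_def lookup_mC_mult in_keys_iff)
  have "b' ^ p = mC ((c / d) ^ p) * b ^ p"
    by (simp add: b'_def power_mult_distrib mC.hom_power)
  also have "(c / d) ^ p = 1" using cd d0 by (simp add: power_divide)
  finally have bp: "b' ^ p = a ^ p" using eq by simp
  let ?S = "\<Sum>i<p. a ^ i * b' ^ (p - Suc i)"
  have "top_coeff ?S (\<Sum>_<p - 1. M) (\<Sum>i<p. c ^ (p - 1))"
  proof (rule top_coeff_sum)
    fix i assume i: "i < p"
    have "(\<Sum>_<i. M) + (\<Sum>_<p - Suc i. M) = (\<Sum>_<i + (p - Suc i). M)"
      for M :: "nat \<Rightarrow>\<^sub>0 nat" and i j :: nat
    proof -
      have "(\<Sum>_<i. M) + (\<Sum>_<j. M) = (\<Sum>_<i + j. M)" for j by (induction j) (simp_all add: add_ac del: sum_constant)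
      then show ?thesis .
    qed
    moreover have "i + (p - Suc i) = p - 1" using i by simp
    ultimately show "top_coeff (a ^ i * b' ^ (p - Suc i)) (\<Sum>_<p - 1. M) (c ^ (p - 1))"
      using top_coeff_mult[OF top_coeff_power[OF ca, of i] top_coeff_power[OF b', of "p - Suc i"]]
      by (simp add: power_add[symmetric] del: sum_constant)
  qed
  then have "Poly_Mapping.lookup ?S (\<Sum>_<p - 1. M) = of_nat p * c ^ (p - 1)" by (simp add: top_coeff_def del: sum_constant) simp
  then have "?S \<noteq> 0" using False c0 by auto
  moreover have "(a - b') * ?S = 0"
    using bp power_diff_sumr2[of a p b'] by (simp add: mult_ac)
  ultimately have "a = b'" by simp
  then have "x = const_rf (c / d)"
    using ab by (simp add: b'_def Fract_conv_to_fract tf.hom_mult const_rf_to_fract)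
  then show ?thesis by blast
qed

section \<open>The case of a trivial center\<close>

lemma (in group) prime_order_power:
  assumes "finite (carrier G)" "g \<in> carrier G" "g \<noteq> \<one>"
  shows "\<exists>p k::nat. Factorial_Ring.prime p \<and> k > 0 \<and> ord g = p * k \<and> ord (g [^] k) = p"
proof -
  have o: "ord g \<ge> 1" "ord g \<noteq> 1" using assms ord_ge_1 ord_eq_1 by auto
  then obtain p where p: "Factorial_Ring.prime p" "p dvd ord g" using prime_factor_nat by blast
  then obtain k where k: "ord g = p * k" by blast
  then have "k \<noteq> 0" using o by auto
  moreover have "ord (g [^] k) = p" using ord_pow[OF assms(2), of k] k \<open>k \<noteq> 0\<close> by simp
  ultimately show ?thesis using p(1) k by blast
qed

lemma primitive_root_prime:
  assumes p: "Factorial_Ring.prime p" and z: "\<zeta> ^ p = 1" "\<zeta> \<noteq> (1::'k::field)"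
  shows "primitive_root_of_unity p \<zeta>"
  unfolding primitive_root_of_unity_def
proof (intro conjI allI impI)
  show "0 < p" using p prime_gt_0_nat by blast
  fix j assume j: "0 < j \<and> j < p"
  show "\<zeta> ^ j \<noteq> 1"
  proof
    assume zj: "\<zeta> ^ j = 1"
    have "coprime j p" using j p by (metis coprime_commute nat_dvd_not_less prime_imp_coprime)
    then obtain u v where uv: "j * u = p * v + 1"
      using j bezout_nat[of j p] by (metis coprime_imp_gcd_eq_1 not_gr_zero)
    have "\<zeta> ^ (j * u) = \<zeta> ^ (p * v) * \<zeta>" by (simp add: uv power_add)
    then show False using z zj by (simp add: power_mult)
  qed
qed (rule z)

context graded_setting
begin

lemma scalar_mult:
  assumes "x \<in> carrier G" "y \<in> carrier G"
    and "\<And>i. i < N \<Longrightarrow> mact N (\<sigma> x) v i = c * v i" "\<And>i. i < N \<Longrightarrow> mact N (\<sigma> y) v i = d * v i" "i < N"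
  shows "mact N (\<sigma> (x \<otimes> y)) v i = c * d * v i"
proof -
  have "mact N (\<sigma> (x \<otimes> y)) v i = mact N (\<sigma> x) (mact N (\<sigma> y) v) i"
    using assms by (simp add: sigma_mult mact_mult sigma_carrier)
  also have "\<dots> = mact N (\<sigma> x) (\<lambda>j. d * v j) i" by (rule mact_cong) (rule assms(4))
  finally show ?thesis using assms by (simp add: mact_scale)
qed

lemma trivial_center_family:
  assumes good: "good \<psi>" and hom: "homogeneous D \<psi>" and h0: "h0 \<in> carrier G - {\<one>}" "D h0 \<noteq> 0"
    and center: "k_center TYPE('k) G = {\<one>}"
  shows "\<exists>\<chi>. good \<chi> \<and> map_dim n flat_dim (flatten \<chi>) + 1 \<le> map_dim n flat_dim (flatten \<psi>)"
proof -
  let ?A = "acl (consts_rf \<union> entries \<psi>)"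
  define R where "R = ratfuns n \<inter> degree_zero \<inter> ?A"
  have eA: "entries \<psi> \<subseteq> ?A" and CA: "consts_rf \<subseteq> ?A" using acl_base[of "consts_rf \<union> entries \<psi>"] by auto
  have faithful: "\<exists>r\<in>R. act h r \<noteq> r" if h: "h \<in> carrier G" "h \<noteq> \<one>" for h
  proof (rule ccontr)
    assume "\<not> ?thesis"
    then have triv: "\<And>r. r \<in> R \<Longrightarrow> act h r = r" by blast
    obtain p k :: nat where pk: "Factorial_Ring.prime p" "k > 0" "ord (h [^] k) = p"
      using prime_order_power[OF fin h] by blast
    define g where "g = h [^] k"
    have g: "g \<in> carrier G" "ord g = p" using h pk by (simp_all add: g_def)
    have g1: "g \<noteq> \<one>" using g pk(1) by (metis not_prime_1 ord_id)
    have trivg: "act g r = r" if "r \<in> R" for r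
    proof -
      have "act (h [^] j) r = r" for j :: nat
        using h triv[OF that] by (induction j) (simp_all add: act_one act_mult[symmetric])
      then show ?thesis by (simp add: g_def)
    qed
    have "\<exists>c. \<forall>i<N. mact N (\<sigma> g) (\<psi> l) i = c * \<psi> l i" if l: "l \<in> carrier G - {\<one>}" for l
    proof -
      have l': "l \<in> carrier G" "l \<noteq> \<one>" using l by auto
      obtain j where j: "j < N" "\<psi> l j \<noteq> 0" using goodD(4)[OF good l'] by blast
      interpret ag: field_hom "act g" by (rule field_hom_act[OF g(1)])
      have "mact N (\<sigma> g) (\<psi> l) i = (act g (\<psi> l j) / \<psi> l j) * \<psi> l i" if i: "i < N" for i
      proof -
        \<comment> \<open>Entries of one block have the same degree, so their quotients have degree
          0 and are fixed by \<open>g\<close>. Hence \<open>g\<close> multiplies the whole block by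
          a single factor.\<close>
        have "\<psi> l i / \<psi> l j \<in> R"
          unfolding R_def
        proof (intro IntI)
          show "\<psi> l i / \<psi> l j \<in> ratfuns n" using goodD(1)[OF good l'] i j by (simp add: ratfuns_divide)
          show "\<psi> l i / \<psi> l j \<in> ?A" using eA l i j by (intro acl_divide) (auto simp: entries_def)
          have "lead (D l + - D l) (\<psi> l i * inverse (\<psi> l j)) (\<psi> l i * inverse (\<psi> l j))"
            using hom l i j by (intro lead_mult lead_inverse) (auto simp: homogeneous_def)
          then show "\<psi> l i / \<psi> l j \<in> degree_zero" by (simp add: degree_zero_def divide_inverse)
        qed
        then have "act g (\<psi> l i) / act g (\<psi> l j) = \<psi> l i / \<psi> l j" using trivg[of "\<psi> l i / \<psi> l j"]
          by (simp add: divide_inverse ag.hom_mult ag.hom_inverse)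
        then have "act g (\<psi> l i) = (act g (\<psi> l j) / \<psi> l j) * \<psi> l i"
          using j(2) by (simp add: field_simps)
        then show ?thesis using goodD(2)[OF good l' g(1) i] by simp
      qed
      then show ?thesis by blast
    qed
    then obtain c where c: "\<And>l i. l \<in> carrier G - {\<one>} \<Longrightarrow> i < N \<Longrightarrow> mact N (\<sigma> g) (\<psi> l) i = c l * \<psi> l i" by metis
    \<comment> \<open>The factor is so far only a rational function. As \<open>g\<close> has order
      \<open>p\<close>, it is a \<open>p\<close>-th root of unity and thus constant by
      \<open>root_of_unity_const\<close>; only a factor fixed by the group passes through
      conjugation in \<open>scalar_conj\<close>.\<close>
    have cp: "c l ^ p = 1" if l: "l \<in> carrier G - {\<one>}" for l
    proof -
      have pw: "mact N (\<sigma> (g [^] j)) (\<psi> l) i = c l ^ j * \<psi> l i" if "i < N" for i and j :: nat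
        using that
      proof (induction j arbitrary: i)
        case 0
        then show ?case by (simp add: sigma_one mact_one)
      next
        case (Suc j)
        then show ?case using scalar_mult[of "g [^] j" g "\<psi> l" "c l ^ j" "c l" i] c[OF l] g by (simp add: mult_ac)
      qed
      obtain i where "i < N" "\<psi> l i \<noteq> 0" using goodD(4)[OF good, of l] l by auto
      moreover have "g [^] p = \<one>" using g by (metis pow_ord_eq_1)
      ultimately show ?thesis using pw[of i p] by (simp add: sigma_one mact_one)
    qed
    have central: "l \<otimes> g = g \<otimes> l" if l: "l \<in> carrier G" for l
    proof -
      \<comment> \<open>On the block \<open>\<psi> u\<close> both \<open>g\<close> and its conjugate
        act by the same constant, so the commutator \<open>u\<close> fixes it. By
        \<open>good_not_fixed\<close> this is impossible unless \<open>u\<close> is 1.\<close>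
      define u where "u = (inv l \<otimes> g \<otimes> l) \<otimes> inv g"
      have uG: "u \<in> carrier G" using l g by (simp add: u_def)
      have "u = \<one>"
      proof (rule ccontr)
        assume u1: "u \<noteq> \<one>"
        then have uH: "u \<in> carrier G - {\<one>}" using uG by simp
        have c0: "c u \<noteq> 0" using cp[OF uH] pk(1) by (auto simp: power_0_left prime_gt_0_nat split: if_splits)
        obtain a where "c u = const_rf a" using root_of_unity_const[OF pk(1) cp[OF uH]] by blast
        then have cl: "act l (c u) = c u" by simp
        have ev: "equivariant (\<psi> u)" using good uH by (simp add: good_def)
        have 1: "mact N (\<sigma> (inv l \<otimes> g \<otimes> l)) (\<psi> u) i = c u * \<psi> u i" if "i < N" for i
          using scalar_conj[OF ev g(1) l cl c[OF uH] that] .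
        have 2: "mact N (\<sigma> (inv g)) (\<psi> u) i = inverse (c u) * \<psi> u i" if i: "i < N" for i
        proof -
          have "\<sigma> (inv g) * \<sigma> g = 1\<^sub>m N" using g sigma_mult[of "inv g" g] by (simp add: sigma_one)
          then have "\<psi> u i = mact N (\<sigma> (inv g) * \<sigma> g) (\<psi> u) i" using i by (simp add: mact_one)
          also have "\<dots> = mact N (\<sigma> (inv g)) (mact N (\<sigma> g) (\<psi> u)) i"
            using g i by (simp add: mact_mult sigma_carrier)
          also have "\<dots> = mact N (\<sigma> (inv g)) (\<lambda>j. c u * \<psi> u j) i" by (rule mact_cong) (rule c[OF uH])
          also have "\<dots> = c u * mact N (\<sigma> (inv g)) (\<psi> u) i" by (rule mact_scale)
          finally show ?thesis using c0 by (simp add: field_simps)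
        qed
        have "mact N (\<sigma> u) (\<psi> u) i = \<psi> u i" if "i < N" for i
          unfolding u_def using scalar_mult[OF _ _ 1 2 that] l g c0 by (simp add: u_def[symmetric])
        then show False using good_not_fixed[OF good uG u1] by blast
      qed
      then have "inv l \<otimes> g \<otimes> l = g" using l g unfolding u_def by (metis inv_closed inv_equality inv_inv m_closed)
      then have "l \<otimes> (inv l \<otimes> g \<otimes> l) = l \<otimes> g" by simp
      then show ?thesis using l g by (simp add: m_assoc[symmetric])
    qed
    have gH: "g \<in> carrier G - {\<one>}" using g g1 by simp
    obtain \<zeta> where z: "c g = const_rf \<zeta>" using root_of_unity_const[OF pk(1) cp[OF gH]] by blast
    have "const_rf (\<zeta> ^ p) = 1" using cp[OF gH] by (simp add: z const_rf.hom_power)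
    then have "\<zeta> ^ p = 1" by (metis const_rf.hom_1_iff)
    moreover have "\<zeta> \<noteq> 1"
    proof
      assume "\<zeta> = 1"
      then have "mact N (\<sigma> g) (\<psi> g) i = \<psi> g i" if "i < N" for i using c[OF gH that] z by simp
      then show False using good_not_fixed[OF good g(1) g1] by blast
    qed
    ultimately have "primitive_root_of_unity (ord g) \<zeta>" using primitive_root_prime pk(1) g(2) by blast
    then have "g \<in> k_center TYPE('k) G" using g(1) central by (auto simp: k_center_def)
    then show False using center g1 by blast
  qed
  have "\<exists>\<chi>. good \<chi> \<and> (\<forall>h\<in>carrier G - {\<one>}. \<forall>i<N. \<chi> h i \<in> R)"
  proof (rule good_family_exists)
    show "\<exists>r\<in>R. act h r \<noteq> r" if "h \<in> carrier G" "h \<noteq> \<one>" for h by (rule faithful[OF that])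
    show "const_rf c \<in> R" for c using CA by (auto simp: R_def degree_zero_closed(1))
    show "x + y \<in> R" "x * y \<in> R" if "x \<in> R" "y \<in> R" for x y
      using that by (auto simp: R_def ratfuns_add ratfuns_mult degree_zero_closed acl_add acl_mult)
    show "act g x \<in> R" if "g \<in> carrier G" "x \<in> R" for g x
      using that by (auto simp: R_def act_ratfuns degree_zero_closed(5) act_acl_entries[OF good])
  qed (auto simp: R_def)
  then obtain \<chi> where chi: "good \<chi>" "\<And>h i. h \<in> carrier G - {\<one>} \<Longrightarrow> i < N \<Longrightarrow> \<chi> h i \<in> R" by blast
  obtain vs where vs: "alg_indep consts_rf vs" "set vs \<subseteq> entries \<chi>" "map_dim n flat_dim (flatten \<chi>) = enat (length vs)"
    using map_dim_basis[OF flatten_rational[OF chi(1)]] unfolding flatten_entries by blast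
  have vR: "set vs \<subseteq> R" using vs(2) chi(2) by (auto simp: entries_def)
  obtain i0 where i0: "i0 < N" "\<psi> h0 i0 \<noteq> 0" using goodD(4)[OF good, of h0] h0 by auto
  let ?x = "\<psi> h0 i0"
  have xe: "?x \<in> entries \<psi>" using h0 i0 by (auto simp: entries_def)
  \<comment> \<open>\<open>?x\<close> has nonzero degree, so it is transcendental over the entries
    of \<open>\<chi>\<close>, which have degree 0. Both are algebraic over the entries of
    \<open>\<psi>\<close>, and this accounts for the drop by one.\<close>
  have "?x \<notin> acl (consts_rf \<union> set vs)"
  proof (rule homogeneous_not_acl[where d = "D h0"])
    show "consts_rf \<union> set vs \<subseteq> degree_zero" using vR by (auto simp: R_def degree_zero_closed(1))
  qed (use hom h0 i0 in \<open>auto simp: homogeneous_def\<close>)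
  then have ind: "alg_indep consts_rf (?x # vs)" using vs(1) by simp
  obtain ws where ws: "entries \<psi> \<subseteq> acl (consts_rf \<union> set ws)" "map_dim n flat_dim (flatten \<psi>) = enat (length ws)"
    using map_dim_basis[OF flatten_rational[OF good]] unfolding flatten_entries by blast
  have "consts_rf \<union> entries \<psi> \<subseteq> acl (consts_rf \<union> set ws)" using ws(1) acl_base[of "consts_rf \<union> set ws"] by auto
  then have "?A \<subseteq> acl (consts_rf \<union> set ws)" by (rule acl_idem)
  then have "set (?x # vs) \<subseteq> acl (consts_rf \<union> set ws)" using vR eA xe by (auto simp: R_def)
  then have "length (?x # vs) \<le> length ws" by (rule alg_indep_length_le'[OF ind])
  then show ?thesis using chi(1) vs(3) ws(2) by (intro exI[of _ \<chi>]) (simp add: one_enat_def)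
qed

end

section \<open>Two gradings commuting with the group\<close>

lemma sum_monom_same: "(\<Sum>i\<in>A. monom (f i) e) = monom (sum f A) e"
  by (induction A rule: infinite_finite_induct) (simp_all add: add_monom)

lemma sum_powers_root:
  fixes x :: "'a::field"
  assumes "x ^ p = 1" "x \<noteq> 1" shows "(\<Sum>j<p. x ^ j) = 0"
  using assms by (simp add: sum_gp_strict)

context linear_group
begin

text \<open>The axioms of a grading are inherited by sums and products, so they need checking on the
  variables only.\<close>

lemma graded_groupI:
  fixes y :: "nat \<Rightarrow> 'k mpoly poly"
  defines "\<Theta> \<equiv> meval (\<lambda>k. [:mC k:]) y"
  assumes at1: "\<And>i. poly (y i) 1 = mX i"
    and co: "\<And>i e. \<Theta> (coeff (y i) e) = monom (coeff (y i) e) e"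
    and eq: "\<And>g i. g \<in> carrier G \<Longrightarrow> \<Theta> (pact g (mX i)) = map_poly (pact g) (y i)"
    and pol: "\<And>i e. i < n \<Longrightarrow> coeff (y i) e \<in> polys n"
  shows "graded_group G n \<rho> \<Theta>"
proof -
  have hc: "comm_ring_hom (\<lambda>k. [:mC k:] :: 'k mpoly poly)" by (rule comm_ring_hom_pCons) simp
  interpret c: comm_ring_hom "\<lambda>k. [:mC k:] :: 'k mpoly poly" by (rule hc)
  have hT: "comm_ring_hom \<Theta>" unfolding \<Theta>_def by (rule c.comm_ring_hom_meval)
  interpret T: comm_ring_hom \<Theta> by (rule hT)
  have C: "\<Theta> (mC k) = [:mC k:]" and X: "\<Theta> (mX i) = y i" for k i
    unfolding \<Theta>_def by (simp_all only: meval_mC[OF hc] meval_mX[OF hc])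
  show ?thesis
  proof unfold_locales
    show "poly (\<Theta> p) 1 = p" for p
      by (induction p rule: mpoly_induct) (simp_all add: C X at1 T.hom_add T.hom_mult)
    show "\<Theta> (coeff (\<Theta> p) e) = monom (coeff (\<Theta> p) e) e" for p e
    proof (induction p arbitrary: e rule: mpoly_induct)
      case (const c)
      then show ?case by (cases e) (simp_all add: C monom_0)
    next
      case (mult p q)
      have "\<Theta> (coeff (\<Theta> (p * q)) e) = (\<Sum>i\<le>e. monom (coeff (\<Theta> p) i) i * monom (coeff (\<Theta> q) (e - i)) (e - i))"
        by (simp add: T.hom_mult coeff_mult T.hom_sum mult.IH)
      also have "\<dots> = (\<Sum>i\<le>e. monom (coeff (\<Theta> p) i * coeff (\<Theta> q) (e - i)) e)"
        by (intro sum.cong) (simp_all add: mult_monom)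
      finally show ?case by (simp add: sum_monom_same T.hom_mult coeff_mult)
    qed (simp_all add: X co T.hom_add add_monom)
    fix g assume g: "g \<in> carrier G"
    interpret pg: comm_ring_hom "pact g" by simp
    show "\<Theta> (pact g p) = map_poly (pact g) (\<Theta> p)" for p
    proof (rule meval_unique[where F = "\<lambda>p. \<Theta> (pact g p)" and G = "\<lambda>p. map_poly (pact g) (\<Theta> p)"])
      show "comm_ring_hom (\<lambda>p. \<Theta> (pact g p))" "comm_ring_hom (\<lambda>p. map_poly (pact g) (\<Theta> p))"
        by (rule comm_ring_hom_compose; simp add: hT comm_ring_hom_map_poly)+
      have "pact g (mC k) = mC k" for k by (simp add: pact_def)
      then show "\<Theta> (pact g (mC k)) = map_poly (pact g) (\<Theta> (mC k))" for k
        by (intro poly_eqI) (simp add: C coeff_map_poly coeff_pCons split: nat.split)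
    qed (simp add: X eq[OF g])
  next
    fix p :: "'k mpoly" and e assume p: "p \<in> polys n"
    have "\<Theta> p \<in> {q. \<forall>e. coeff q e \<in> polys n}"
      unfolding \<Theta>_def
      by (rule meval_closed[OF p])
         (auto simp: coeff_pCons coeff_mult pol intro: polys_add polys_sum polys_mult split: nat.splits)
    then show "coeff (\<Theta> p) e \<in> polys n" by simp
  qed (simp_all add: C)
qed

text \<open>Every variable gets degree 1, and linear substitutions preserve degrees. The component
  of degree 0 is the constant term, hence invariant; later this excludes polynomial leading forms of
  degree 0.\<close>

lemma standard_grading:
  "\<exists>\<Theta>. graded_group G n \<rho> \<Theta> \<and> (\<forall>p. \<forall>g\<in>carrier G. pact g (coeff (\<Theta> p) 0) = coeff (\<Theta> p) 0)"
proof -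
  let ?y = "\<lambda>i. [:0, mX i:] :: 'k mpoly poly"
  define T where "T = meval (\<lambda>k. [:mC k:]) ?y"
  have hc: "comm_ring_hom (\<lambda>k. [:mC k:] :: 'k mpoly poly)" by (rule comm_ring_hom_pCons) simp
  interpret c: comm_ring_hom "\<lambda>k. [:mC k:] :: 'k mpoly poly" by (rule hc)
  interpret T: comm_ring_hom T unfolding T_def by (rule c.comm_ring_hom_meval)
  have C: "T (mC k) = [:mC k:]" and X: "T (mX i) = ?y i" for k i
    unfolding T_def by (simp_all only: meval_mC[OF hc] meval_mX[OF hc])
  have lin: "T (\<Sum>j\<in>J. mC (c j) * mX j) = [:0, \<Sum>j\<in>J. mC (c j) * mX j:]" for c and J :: "nat set"
    by (induction J rule: infinite_finite_induct) (simp_all add: T.hom_add T.hom_mult C X)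
  have "graded_group G n \<rho> T"
    unfolding T_def
  proof (rule graded_groupI, unfold T_def[symmetric])
    fix g i assume "g \<in> carrier G"
    interpret pg: comm_ring_hom "pact g" by simp
    have "T (pact g (mX i)) = [:0, pact g (mX i):]"
      by (simp add: pact_def lin_subst_mX lin_form_def lin X)
    also have "\<dots> = map_poly (pact g) (?y i)"
      by (rule poly_eqI) (simp add: coeff_map_poly coeff_pCons split: nat.split)
    finally show "T (pact g (mX i)) = map_poly (pact g) (?y i)" .
  next
    show "T (coeff (?y i) e) = monom (coeff (?y i) e) e" for i e
      by (auto simp: coeff_pCons X monom_Suc monom_0 split: nat.split)
  qed (auto simp: coeff_pCons split: nat.split)
  moreover have "pact g (coeff (T p) 0) = coeff (T p) 0" for p g
  proof -
    interpret pg: comm_ring_hom "pact g" by simp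
    have "pact g (mC k) = mC k" for k by (simp add: pact_def)
    then show ?thesis
      by (induction p rule: mpoly_induct) (simp_all add: C X T.hom_add T.hom_mult coeff_mult pg.hom_add pg.hom_mult)
  qed
  ultimately show ?thesis by blast
qed

end

section \<open>Grading by the eigenspaces of a central element\<close>

locale central_root = linear_group G n \<rho>
  for G :: "('g, 'b) monoid_scheme" (structure) and n and \<rho> :: "'g \<Rightarrow> 'k::field mat" +
  fixes z :: 'g and p :: nat and \<zeta> :: 'k
  assumes z: "z \<in> carrier G" "\<And>x. x \<in> carrier G \<Longrightarrow> z \<otimes> x = x \<otimes> z" "z [^] p = \<one>"
    and p: "of_nat p \<noteq> (0::'k)"
    and root: "primitive_root_of_unity p \<zeta>"
begin

lemma zeta: "\<zeta> ^ p = 1" "\<zeta> \<noteq> 0"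
proof -
  show "\<zeta> ^ p = 1" using root by (simp add: primitive_root_of_unity_def)
  moreover have "p > 0" using root by (simp add: primitive_root_of_unity_def)
  ultimately show "\<zeta> \<noteq> 0" by (auto simp: power_0_left)
qed

lemma zeta_power_neq: "0 < j \<Longrightarrow> j < p \<Longrightarrow> \<zeta> ^ j \<noteq> 1"
  using root by (simp add: primitive_root_of_unity_def)

lemma character_sum:
  assumes "e < p" "e' < p"
  shows "(\<Sum>j<p. (inverse \<zeta> ^ e' * \<zeta> ^ e) ^ j) = (if e = e' then of_nat p else 0)"
proof (cases "e = e'")
  case True
  have "inverse \<zeta> ^ e' * \<zeta> ^ e = 1" using True zeta(2) by (simp add: power_mult_distrib[symmetric])
  then show ?thesis using True by simp
next
  case False
  have "\<zeta> ^ e \<noteq> \<zeta> ^ e'"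
  proof
    assume eq: "\<zeta> ^ e = \<zeta> ^ e'"
    have *: "\<zeta> ^ (b - a) = 1" if "\<zeta> ^ a = \<zeta> ^ b" "a < b" for a b :: nat
    proof -
      have "\<zeta> ^ b = \<zeta> ^ a * \<zeta> ^ (b - a)" using that(2) by (simp add: power_add[symmetric])
      then show ?thesis using that(1) zeta(2) by simp
    qed
    show False
      using *[of e e'] *[of e' e] eq False assms zeta_power_neq[of "e - e'"] zeta_power_neq[of "e' - e"]
      by (metis diff_le_self linorder_neqE_nat order_le_less_trans zero_less_diff)
  qed
  then have "inverse \<zeta> ^ e' * \<zeta> ^ e \<noteq> 1" using zeta(2) by (simp add: power_inverse field_simps)
  moreover have "(inverse \<zeta> ^ e' * \<zeta> ^ e) ^ p = 1"
    using zeta by (simp add: power_mult_distrib power_inverse power_mult[symmetric] mult.commute[of _ p])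
      (simp add: power_mult zeta)
  ultimately show ?thesis using False sum_powers_root by simp
qed

text \<open>The projection onto the eigenspace of \<open>z\<close> for the eigenvalue
  \<open>\<zeta> ^ e\<close>, by averaging over the powers of \<open>z\<close>. It commutes with the
  group because \<open>z\<close> is central.\<close>

definition proj :: "nat \<Rightarrow> 'k mpoly \<Rightarrow> 'k mpoly" where
  "proj e q = mC (inverse (of_nat p)) * (\<Sum>j<p. mC ((inverse \<zeta> ^ e) ^ j) * pact (z [^] j) q)"

lemma proj_add: "proj e (q + r) = proj e q + proj e r"
proof -
  have "pact g (q + r) = pact g q + pact g r" for g
  proof -
    interpret comm_ring_hom "pact g" by simp
    show ?thesis by (rule hom_add)
  qed
  then show ?thesis by (simp add: proj_def distrib_left sum.distrib)
qed

lemma proj_scale: "proj e (mC c * q) = mC c * proj e q"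
proof -
  have "pact g (mC c * q) = mC c * pact g q" for g
  proof -
    interpret comm_ring_hom "pact g" by simp
    show ?thesis by (simp add: hom_mult) (simp add: pact_def)
  qed
  then show ?thesis by (simp add: proj_def sum_distrib_left mult_ac)
qed

lemma proj_pact:
  assumes g: "g \<in> carrier G" shows "proj e (pact g q) = pact g (proj e q)"
proof -
  interpret comm_ring_hom "pact g" by simp
  have "z [^] j \<otimes> g = g \<otimes> z [^] j" for j :: nat
    using z(1,2) g by (induction j) (simp_all add: m_assoc, metis m_assoc nat_pow_closed)
  then have "pact (z [^] j) (pact g q) = pact g (pact (z [^] j) q)" for j :: nat
    using g z(1) by (simp add: pact_mult)
  moreover have "pact g (mC c) = mC c" for c by (simp add: pact_def)
  ultimately show ?thesis by (simp add: proj_def hom_mult hom_sum)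
qed

lemma pact_proj: "pact z (proj e q) = mC (\<zeta> ^ e) * proj e q"
proof -
  interpret comm_ring_hom "pact z" by simp
  let ?F = "\<lambda>j. mC ((inverse \<zeta> ^ e) ^ j) * pact (z [^] j) q"
  have C: "pact z (mC c) = mC c" for c by (simp add: pact_def)
  have step: "mC ((inverse \<zeta> ^ e) ^ j) * pact z (pact (z [^] j) q) = mC (\<zeta> ^ e) * ?F (Suc j)" for j
  proof -
    have "(inverse \<zeta> ^ e) ^ j = \<zeta> ^ e * (inverse \<zeta> ^ e) ^ Suc j"
      using zeta(2) by (simp add: power_inverse)
    then have "mC ((inverse \<zeta> ^ e) ^ j) = mC (\<zeta> ^ e) * mC ((inverse \<zeta> ^ e) ^ Suc j)"
      by (simp only: mC.hom_mult)
    then show ?thesis using z(1) by (simp only: pact_mult nat_pow_closed nat_pow_Suc mult.assoc)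
  qed
  have "(inverse \<zeta> ^ e) ^ p = 1"
    using zeta by (simp add: power_mult[symmetric] mult.commute[of e p]) (simp add: power_mult power_inverse)
  then have "?F p = ?F 0" using z(3) by simp
  then have "(\<Sum>j<p. ?F (Suc j)) = (\<Sum>j<p. ?F j)"
    using sum.lessThan_Suc_shift[of ?F p] sum.lessThan_Suc[of ?F p] by (simp add: add.commute)
  then show ?thesis
    by (simp only: proj_def hom_mult hom_sum C step sum_distrib_left[symmetric] mult.left_commute)
qed

lemma pact_power_proj: "pact (z [^] j) (proj e q) = mC ((\<zeta> ^ e) ^ j) * proj e q" for j :: nat
proof (induction j)
  case 0
  then show ?case by (simp add: pact_one)
next
  case (Suc j)
  interpret comm_ring_hom "pact z" by simp
  have "pact (z [^] Suc j) (proj e q) = pact z (pact (z [^] j) (proj e q))" using z(1) by (simp add: pact_mult)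
  also have "\<dots> = mC ((\<zeta> ^ e) ^ j) * (mC (\<zeta> ^ e) * proj e q)"
    by (simp only: Suc.IH hom_mult pact_proj) (simp add: pact_def)
  finally show ?case by (simp add: mC.hom_mult mult_ac)
qed

lemma proj_proj:
  assumes "e < p" "e' < p" shows "proj e' (proj e q) = (if e = e' then proj e q else 0)"
proof -
  have "proj e' (proj e q) = mC (inverse (of_nat p)) * mC (\<Sum>j<p. (inverse \<zeta> ^ e' * \<zeta> ^ e) ^ j) * proj e q"
    unfolding proj_def[of e' "proj e q"] pact_power_proj
    by (simp add: mC.hom_sum sum_distrib_left sum_distrib_right mC.hom_mult power_mult_distrib mult_ac)
  also have "\<dots> = (if e = e' then proj e q else 0)"
    using p unfolding character_sum[OF assms] by (simp add: mC.hom_mult[symmetric])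
  finally show ?thesis .
qed

lemma sum_proj: "(\<Sum>e<p. proj e q) = q"
proof -
  have p0: "0 < p" using root by (simp add: primitive_root_of_unity_def)
  have cs: "(\<Sum>e<p. (inverse \<zeta> ^ e) ^ j) = (if j = 0 then of_nat p else 0)" if j: "j < p" for j
  proof -
    have "(\<Sum>e<p. (inverse \<zeta> ^ e) ^ j) = (\<Sum>e<p. (inverse \<zeta> ^ j * \<zeta> ^ 0) ^ e)"
      by (simp add: power_mult[symmetric] mult.commute)
    then show ?thesis using character_sum[OF p0 j] by auto
  qed
  have "(\<Sum>e<p. proj e q) =
      mC (inverse (of_nat p)) * (\<Sum>j<p. mC (\<Sum>e<p. (inverse \<zeta> ^ e) ^ j) * pact (z [^] j) q)"
    unfolding proj_def sum_distrib_left[symmetric] mC.hom_sum sum_distrib_right by (subst sum.swap) (rule refl)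
  also have "\<dots> = mC (inverse (of_nat p)) * (\<Sum>j<p. if j = 0 then mC (of_nat p) * q else 0)"
    by (intro arg_cong2[where f = "(*)"] sum.cong) (simp_all add: cs pact_one)
  also have "\<dots> = mC (inverse (of_nat p) * of_nat p) * q"
    using p0 by (simp only: mC.hom_mult mult.assoc) simp
  also have "\<dots> = q" using p by simp
  finally show ?thesis .
qed

text \<open>A variable is split into eigenvectors of \<open>z\<close>, and the part for the
  eigenvalue \<open>\<zeta> ^ e\<close> with \<open>e < p\<close> gets degree \<open>e\<close>.
  Substituting \<open>\<zeta>\<close> for the parameter of the grading therefore gives back the
  action of \<open>z\<close>.\<close>

lemma root_grading: "\<exists>\<Theta>. graded_group G n \<rho> \<Theta> \<and> (\<forall>q. pact z q = poly (\<Theta> q) (mC \<zeta>))"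
proof -
  let ?L = "\<lambda>q. \<Sum>e<p. monom (proj e q) e"
  let ?y = "\<lambda>i. ?L (mX i)"
  define T where "T = meval (\<lambda>k. [:mC k:]) ?y"
  have hc: "comm_ring_hom (\<lambda>k. [:mC k:] :: 'k mpoly poly)" by (rule comm_ring_hom_pCons) simp
  interpret c: comm_ring_hom "\<lambda>k. [:mC k:] :: 'k mpoly poly" by (rule hc)
  have hT: "comm_ring_hom T" unfolding T_def by (rule c.comm_ring_hom_meval)
  interpret T: comm_ring_hom T by (rule hT)
  interpret pz: comm_ring_hom "pact z" by simp
  have C: "T (mC k) = [:mC k:]" and X: "T (mX i) = ?y i" for k i
    unfolding T_def by (simp_all only: meval_mC[OF hc] meval_mX[OF hc])
  have L_add: "?L (q + r) = ?L q + ?L r" for q r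
    by (simp add: proj_add add_monom[symmetric] sum.distrib)
  have L_scale: "?L (mC c * q) = [:mC c:] * ?L q" for c q
    unfolding proj_scale sum_distrib_left by (intro sum.cong) (simp_all add: smult_monom)
  have L_zero: "?L 0 = 0" using L_scale[of 0 0] by simp
  \<comment> \<open>\<open>T\<close> and \<open>?L\<close> agree on linear forms, the sums of
    multiples of variables. On products they can differ, because exponents in \<open>T\<close> add
    up without reduction modulo \<open>p\<close>.\<close>
  define V where "V = {q. T q = ?L q}"
  have V: "mX i \<in> V" "q \<in> V \<Longrightarrow> r \<in> V \<Longrightarrow> q + r \<in> V" "q \<in> V \<Longrightarrow> mC c * q \<in> V" "0 \<in> V" for q r c i
    unfolding V_def by (simp_all only: mem_Collect_eq X L_add L_scale L_zero T.hom_add T.hom_mult T.hom_zero C)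
  have V_sum: "sum f J \<in> V" if "\<And>j. j \<in> J \<Longrightarrow> f j \<in> V" for f and J :: "nat set"
    using that by (induction J rule: infinite_finite_induct) (simp_all add: V)
  have V_pact: "pact g (mX i) \<in> V" for g i
    unfolding pact_def lin_subst_mX lin_form_def by (auto intro!: V_sum intro: V)
  have V_proj: "proj e (mX i) \<in> V" for e i
    unfolding proj_def by (intro V(3) V_sum V_pact)
  have cy: "coeff (?L q) e = (if e < p then proj e q else 0)" for q e
    by (simp add: coeff_sum)
  have "graded_group G n \<rho> T"
    unfolding T_def
  proof (rule graded_groupI, unfold T_def[symmetric])
    show "poly (?y i) 1 = mX i" for i by (simp add: poly_sum poly_monom sum_proj)
    show "T (coeff (?y i) e) = monom (coeff (?y i) e) e" for i e
    proof (cases "e < p")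
      case True
      have "T (proj e (mX i)) = ?L (proj e (mX i))" using V_proj by (simp add: V_def)
      also have "\<dots> = (\<Sum>e'<p. if e' = e then monom (proj e (mX i)) e else 0)"
        using True by (intro sum.cong) (simp_all add: proj_proj)
      also have "\<dots> = monom (proj e (mX i)) e" using True by simp
      finally show ?thesis using True by (simp only: cy if_True)
    qed (simp add: cy)
    fix g i assume g: "g \<in> carrier G"
    interpret pg: comm_ring_hom "pact g" by simp
    have "T (pact g (mX i)) = ?L (pact g (mX i))" using V_pact by (simp add: V_def)
    also have "\<dots> = map_poly (pact g) (?y i)"
      by (rule poly_eqI) (unfold coeff_map_poly[where f = "pact g", OF pg.hom_zero] cy, simp add: proj_pact[OF g])
    finally show "T (pact g (mX i)) = map_poly (pact g) (?y i)" .
  next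
    fix i e assume "i < n"
    then show "coeff (?y i) e \<in> polys n"
      unfolding cy unfolding proj_def by (auto simp: pact_def intro!: polys_mult polys_sum lin_subst_polys)
  qed
  moreover have "pact z q = poly (T q) (mC \<zeta>)" for q
  proof (rule meval_unique[where F = "pact z" and G = "\<lambda>q. poly (T q) (mC \<zeta>)"])
    show "comm_ring_hom (\<lambda>q. poly (T q) (mC \<zeta>))"
      by unfold_locales (simp_all add: T.hom_add T.hom_mult)
    show "pact z (mC k) = poly (T (mC k)) (mC \<zeta>)" for k by (simp add: C pact_def)
    fix i
    have "poly (?y i) (mC \<zeta>) = (\<Sum>e<p. pact z (proj e (mX i)))"
      by (simp add: poly_sum poly_monom pact_proj mC.hom_power mult.commute)
    also have "\<dots> = pact z (mX i)" by (simp add: pz.hom_sum[symmetric] sum_proj)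
    finally show "pact z (mX i) = poly (T (mX i)) (mC \<zeta>)" by (simp only: X)
  qed simp
  ultimately show ?thesis by blast
qed

end

text \<open>A component of degree \<open>i\<close> is multiplied by \<open>\<zeta> ^ i\<close>, and
  in a quotient of degree 0 the numerator and the denominator have the same degree.\<close>

lemma (in graded_group) act_degree_zero:
  assumes z: "z \<in> carrier G" "\<And>q. pact z q = poly (\<Theta> q) (mC \<zeta>)" "\<zeta> \<noteq> 0"
    and r: "r \<in> degree_zero"
  shows "act z r = r"
proof -
  obtain a b i where a: "b \<noteq> 0" "r = Fract (coeff (\<Theta> a) i) (Polynomial.lead_coeff (\<Theta> b))"
    "0 = int i - int (Polynomial.degree (\<Theta> b))" "Polynomial.lead_coeff (\<Theta> b) \<noteq> 0"
    using r by (auto simp: degree_zero_def elim: leadE)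
  have pz: "pact z (coeff (\<Theta> q) i) = coeff (\<Theta> q) i * mC \<zeta> ^ i" for q
    by (simp add: z(2) Theta_coeff poly_monom)
  have i: "i = Polynomial.degree (\<Theta> b)" using a(3) by simp
  have "mC \<zeta> ^ i \<noteq> 0" using z(3) by (metis lookup_single_eq lookup_zero power_not_zero)
  then show ?thesis
    unfolding a(2) act_Fract[OF z(1) a(4)] unfolding i[symmetric] pz using a(4) i by (simp add: eq_fract)
qed

section \<open>Comparison of the two dimensions\<close>

text \<open>The linear coefficients of the substituted variables recover the matrix
  \<open>\<rho> g\<close>. With \<open>\<sigma>\<close> itself as the source this shows that
  faithful covariants exist.\<close>

lemma (in linear_group) act_faithful:
  assumes inj: "inj_on \<rho> (carrier G)" and g: "g \<in> carrier G" "g \<noteq> \<one>"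
  shows "\<exists>i<n. act g (var_rf i) \<noteq> var_rf i"
proof (rule ccontr)
  assume "\<not> ?thesis"
  then have *: "lin_form n (\<rho> g) i = mX i" if "i < n" for i
    using that by (auto simp: var_rf_to_fract pact_def lin_subst_mX)
  have sg: "Poly_Mapping.single j (1::nat) = Poly_Mapping.single l 1 \<longleftrightarrow> j = l" for j l :: nat
    by (metis lookup_single_eq lookup_single_not_eq zero_neq_one)
  have "\<rho> g = 1\<^sub>m n"
  proof (rule eq_matI)
    fix i l assume il: "i < dim_row (1\<^sub>m n :: 'k mat)" "l < dim_col (1\<^sub>m n :: 'k mat)"
    let ?\<mu> = "Poly_Mapping.single l (1::nat)"
    have X: "Poly_Mapping.lookup (mX j :: 'k mpoly) ?\<mu> = (if j = l then 1 else 0)" for j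
      unfolding mX_def lookup_single sg[of j l] by (simp add: when_def)
    have "\<rho> g $$ (i, l) = (\<Sum>j<n. if j = l then \<rho> g $$ (i, j) else 0)" using il by simp
    also have "\<dots> = (\<Sum>j<n. \<rho> g $$ (i, j) * Poly_Mapping.lookup (mX j :: 'k mpoly) ?\<mu>)"
      unfolding X by (intro sum.cong) simp_all
    also have "\<dots> = Poly_Mapping.lookup (lin_form n (\<rho> g) i) ?\<mu>"
      using il by (simp add: lin_form_def lookup_sum lookup_mC_mult)
    also have "\<dots> = 1\<^sub>m n $$ (i, l)" using il by (simp add: * X del: One_nat_def)
    finally show "\<rho> g $$ (i, l) = 1\<^sub>m n $$ (i, l)" .
  qed (use rho_carrier[OF g(1)] in auto)
  then have "g = \<one>" using inj g(1) rho_one by (metis inj_onD one_closed)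
  then show False using g(2) by blast
qed

lemma rgen_to_fract_polys: "rgen (to_fract ` polys n) \<subseteq> (to_fract ` polys n :: 'k::field ratfun set)"
proof (rule rgen_least)
  interpret tf: comm_ring_hom "to_fract :: 'k mpoly \<Rightarrow> _" by simp
  show "1 \<in> (to_fract ` polys n :: 'k ratfun set)" by (rule image_eqI[of _ _ 1]) simp_all
  fix x :: "'k ratfun" assume "x \<in> to_fract ` polys n"
  then obtain a where a: "x = to_fract a" "a \<in> polys n" by (rule imageE)
  show "- x \<in> to_fract ` polys n"
    by (rule image_eqI[of _ _ "- a"]) (simp_all add: a tf.hom_uminus polys_uminus)
  fix y :: "'k ratfun" assume "y \<in> to_fract ` polys n"
  then obtain b where b: "y = to_fract b" "b \<in> polys n" by (rule imageE)
  show "x + y \<in> to_fract ` polys n"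
    by (rule image_eqI[of _ _ "a + b"]) (simp_all add: a b tf.hom_add polys_add)
  show "x * y \<in> to_fract ` polys n"
    by (rule image_eqI[of _ _ "a * b"]) (simp_all add: a b tf.hom_mult polys_mult)
qed simp

context covariant_setting
begin

lemma compress_dim:
  fixes f :: "'k ratfun vec"
  assumes f: "faithful_covariant G n \<rho> m \<tau> f"
  shows "\<exists>\<psi>. good \<psi> \<and> map_dim n flat_dim (flatten \<psi>) \<le> map_dim n m f \<and>
    (\<forall>h\<in>carrier G - {\<one>}. \<forall>i<N. \<psi> h i \<in> rgen (consts_rf \<union> ($) f ` {..<m}))"
proof -
  obtain \<psi> where psi: "good \<psi>" "\<forall>h\<in>carrier G - {\<one>}. \<forall>i<N. \<psi> h i \<in> rgen (consts_rf \<union> ($) f ` {..<m})"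
    using compress[OF f] by blast
  have "rational_map n m f" using f by (auto simp: covariant_def faithful_covariant_def)
  then have "map_dim n flat_dim (flatten \<psi>) \<le> map_dim n m f"
    using psi(2) rgen_acl by (intro flatten_dim_le[OF psi(1)]) blast+
  then show ?thesis using psi by blast
qed

lemma central_regularise:
  fixes f :: "'k ratfun vec"
  assumes f: "faithful_covariant G n \<rho> m \<tau> f" and center: "x \<in> k_center TYPE('k) G" "x \<noteq> \<one>"
  shows "\<exists>\<chi>. good \<chi> \<and> regular_map n flat_dim (flatten \<chi>) \<and> map_dim n flat_dim (flatten \<chi>) \<le> map_dim n m f"
proof -
  obtain \<psi> where psi: "good \<psi>" "map_dim n flat_dim (flatten \<psi>) \<le> map_dim n m f"
    using compress_dim[OF f] by blast
  obtain \<xi> :: 'k where x: "x \<in> carrier G" "\<And>y. y \<in> carrier G \<Longrightarrow> x \<otimes> y = y \<otimes> x"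
    and xi: "primitive_root_of_unity (ord x) \<xi>"
    using center(1) by (auto simp: k_center_def)
  \<comment> \<open>Passing to a power of prime order makes the characteristic harmless:
    \<open>\<zeta> ^ p = 1\<close> with \<open>\<zeta> \<noteq> 1\<close> excludes characteristic
    \<open>p\<close> by \<open>root_of_unity_char\<close>, so \<open>central_root\<close>
    applies.\<close>
  obtain p k :: nat where pk: "Factorial_Ring.prime p" "k > 0" "ord x = p * k" "ord (x [^] k) = p"
    using prime_order_power[OF fin x(1) center(2)] by blast
  define z where "z = x [^] k"
  define \<zeta> where "\<zeta> = \<xi> ^ k"
  have zG: "z \<in> carrier G" using x(1) by (simp add: z_def)
  have z1: "z \<noteq> \<one>" using pk(1,4) by (metis not_prime_1 ord_id z_def)
  have zp: "z [^] p = \<one>" using zG pk(4) by (metis pow_ord_eq_1 z_def)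
  have zc: "z \<otimes> y = y \<otimes> z" if y: "y \<in> carrier G" for y
  proof -
    have "x [^] j \<otimes> y = y \<otimes> x [^] j" for j :: nat
      using x y by (induction j) (simp_all add: m_assoc, metis m_assoc nat_pow_closed)
    then show ?thesis by (simp add: z_def)
  qed
  have z: "\<zeta> ^ p = 1" using xi pk(3) by (simp add: \<zeta>_def primitive_root_of_unity_def power_mult[symmetric] mult.commute)
  have "k < ord x" using pk(1-3) prime_gt_1_nat[of p] by simp
  then have "\<zeta> \<noteq> 1" using xi pk(2) by (simp add: \<zeta>_def primitive_root_of_unity_def)
  then have root: "primitive_root_of_unity p \<zeta>" and p0: "of_nat p \<noteq> (0::'k)"
    using primitive_root_prime[OF pk(1) z] root_of_unity_char[OF pk(1) _ z] by auto
  interpret central_root G n \<rho> z p \<zeta>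
    by unfold_locales (use zG zc zp p0 root in auto)
  obtain \<Theta> where Theta: "graded_group G n \<rho> \<Theta>" "\<And>q. pact z q = poly (\<Theta> q) (mC \<zeta>)"
    using root_grading by blast
  interpret graded_group G n \<rho> \<Theta> by (rule Theta(1))
  interpret graded_setting where G = G and n = n and \<rho> = \<rho> and N = N and \<sigma> = \<sigma> and Pr = Pr and \<Theta> = \<Theta> ..
  obtain D \<psi>' where hom: "good \<psi>'" "homogeneous D \<psi>'"
    "map_dim n flat_dim (flatten \<psi>') \<le> map_dim n flat_dim (flatten \<psi>)"
    using homogenise[OF psi(1)] by blast
  have zH: "z \<in> carrier G - {\<one>}" using zG z1 by blast
  have "D z \<noteq> 0"
  proof
    assume D0: "D z = 0"
    have "act z (\<psi>' z i) = \<psi>' z i" if "i < N" for i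
    proof (rule act_degree_zero[OF zG Theta(2) zeta(2)])
      have "lead (D z) (\<psi>' z i) (\<psi>' z i)" using hom(2) zH that unfolding homogeneous_def by blast
      then show "\<psi>' z i \<in> degree_zero" by (simp add: degree_zero_def D0)
    qed
    then show False using good_not_fixed[OF hom(1) zG z1] goodD(2)[OF hom(1) zG z1 zG] by metis
  qed
  from regularise_homogeneous[OF hom(1,2) zH this] show ?thesis
    using hom(3) psi(2) by (meson order_trans)
qed

lemma regular_not_minimal:
  fixes f :: "'k ratfun vec"
  assumes f: "faithful_covariant G n \<rho> m \<tau> f" "regular_map n m f"
    and G: "carrier G \<noteq> {\<one>}" and center: "k_center TYPE('k) G = {\<one>}"
  shows "\<exists>\<chi>. good \<chi> \<and> map_dim n flat_dim (flatten \<chi>) + 1 \<le> map_dim n m f"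
proof -
  obtain \<psi> where psi: "good \<psi>" "map_dim n flat_dim (flatten \<psi>) \<le> map_dim n m f"
    "\<And>h i. h \<in> carrier G - {\<one>} \<Longrightarrow> i < N \<Longrightarrow> \<psi> h i \<in> rgen (consts_rf \<union> ($) f ` {..<m})"
    using compress_dim[OF f(1)] by blast
  obtain h where h: "h \<in> carrier G" "h \<noteq> \<one>" using G by blast
  then have hH: "h \<in> carrier G - {\<one>}" by blast
  obtain \<Theta> where Theta: "graded_group G n \<rho> \<Theta>" "\<And>p g. g \<in> carrier G \<Longrightarrow> pact g (coeff (\<Theta> p) 0) = coeff (\<Theta> p) 0"
    using standard_grading by blast
  interpret graded_group G n \<rho> \<Theta> by (rule Theta(1))
  interpret graded_setting where G = G and n = n and \<rho> = \<rho> and N = N and \<sigma> = \<sigma> and Pr = Pr and \<Theta> = \<Theta> ..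
  have "consts_rf \<union> ($) f ` {..<m} \<subseteq> to_fract ` polys n"
    using f(2) by (auto simp: regular_map_def const_rf_to_fract to_fract_def)
  from subset_trans[OF rgen_mono[OF this] rgen_to_fract_polys]
  have sub: "rgen (consts_rf \<union> ($) f ` {..<m}) \<subseteq> to_fract ` polys n" .
  \<comment> \<open>The compressed entries are polynomials in the components of a regular covariant,
    so 1 serves as the denominator of every block.\<close>
  have poly: "1 \<in> polys n \<and> (1::'k mpoly) \<noteq> 0 \<and> (\<forall>i<N. \<exists>a\<in>polys n. \<psi> h i = Fract a 1)"
    if h: "h \<in> carrier G - {\<one>}" for h
  proof -
    have "\<psi> h i \<in> to_fract ` polys n" if "i < N" for i using psi(3)[OF h that] sub by (rule subsetD[rotated])
    then show ?thesis by (auto simp: to_fract_def image_iff)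
  qed
  obtain D \<psi>' where hom: "good \<psi>'" "homogeneous D \<psi>'"
    "map_dim n flat_dim (flatten \<psi>') \<le> map_dim n flat_dim (flatten \<psi>)"
    "\<And>i. i < N \<Longrightarrow> \<exists>a e. \<psi>' h i = to_fract (coeff (\<Theta> a) e) \<and> D h = int e"
    using homogenise_with[OF psi(1) poly] hH by (simp add: to_fract_def) blast
  \<comment> \<open>Polynomial leading forms of degree 0 would be constants, which \<open>h\<close>
    fixes.\<close>
  have "D h \<noteq> 0"
  proof
    assume D0: "D h = 0"
    have "act h (\<psi>' h i) = \<psi>' h i" if "i < N" for i
      using hom(4)[OF that] D0 Theta(2)[OF h(1)] by auto
    then show False using good_not_fixed[OF hom(1) h] goodD(2)[OF hom(1) h h(1)] by metis
  qed
  from trivial_center_family[OF hom(1,2) hH this center] show ?thesis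
    using hom(3) psi(2) by (meson order_trans)
qed

end

lemma Inf_enat_attained: "A \<noteq> {} \<Longrightarrow> Inf A \<in> (A :: enat set)"
  by (auto simp: Inf_enat_def intro: LeastI)

theorem theorem34:
  fixes G :: "('g, 'b) monoid_scheme"
  assumes "group G"
    and "finite (carrier G)"
    and "carrier G \<noteq> {\<one>\<^bsub>G\<^esub>}"
    and "semi_faithful TYPE('k::field) G"
  shows "(covdim TYPE('k) G = edim TYPE('k) G \<longleftrightarrow> k_center TYPE('k) G \<noteq> {\<one>\<^bsub>G\<^esub>}) \<and>
         (k_center TYPE('k) G = {\<one>\<^bsub>G\<^esub>} \<longrightarrow> covdim TYPE('k) G = edim TYPE('k) G + 1)"
proof -
  interpret group G by fact
  obtain N and \<sigma> :: "'g \<Rightarrow> 'k mat" where \<sigma>: "representation G N \<sigma>" "completely_reducible G N \<sigma>" "inj_on \<sigma> (carrier G)"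
    using assms(4) by (auto simp: semi_faithful_def faithful_rep_def)
  have "\<sigma> h \<noteq> 1\<^sub>m N" if "h \<in> carrier G - {\<one>\<^bsub>G\<^esub>}" for h
    using that \<sigma>(1,3) unfolding representation_iff[OF group_axioms] by (metis DiffE inj_onD one_closed singletonI)
  then have "\<forall>h\<in>carrier G - {\<one>\<^bsub>G\<^esub>}. \<exists>P\<in>carrier_mat N N. P \<noteq> 0\<^sub>m N N \<and> P * P = P \<and> (\<forall>g\<in>carrier G. P * \<sigma> g = \<sigma> g * P) \<and>
    (\<forall>u\<in>carrier_vec N. P *\<^sub>v u = u \<longrightarrow>
      (\<forall>l\<in>carrier G. \<sigma> (inv\<^bsub>G\<^esub> l \<otimes>\<^bsub>G\<^esub> h \<otimes>\<^bsub>G\<^esub> l) *\<^sub>v u = u) \<longrightarrow> u = 0\<^sub>v N)"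
    using fixed_complement_projection[OF group_axioms \<sigma>(1,2)] by auto
  then obtain Pr where Pr: "\<forall>h\<in>carrier G - {\<one>\<^bsub>G\<^esub>}. Pr h \<in> carrier_mat N N \<and> Pr h \<noteq> 0\<^sub>m N N \<and>
    Pr h * Pr h = Pr h \<and> (\<forall>g\<in>carrier G. Pr h * \<sigma> g = \<sigma> g * Pr h) \<and>
    (\<forall>u\<in>carrier_vec N. Pr h *\<^sub>v u = u \<longrightarrow>
      (\<forall>l\<in>carrier G. \<sigma> (inv\<^bsub>G\<^esub> l \<otimes>\<^bsub>G\<^esub> h \<otimes>\<^bsub>G\<^esub> l) *\<^sub>v u = u) \<longrightarrow> u = 0\<^sub>v N)"
    unfolding Bex_def bchoice_iff by blast
  \<comment> \<open>The target and its projections are chosen once, because the covariants attaining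
    the two minima may have different sources.\<close>
  have setting: "covariant_setting G n \<rho> N \<sigma> Pr" if "representation G n \<rho>" for n and \<rho> :: "'g \<Rightarrow> 'k mat"
  proof unfold_locales
    show "finite (carrier G)" "representation G n \<rho>" "representation G N \<sigma>" by fact+
    fix h assume "h \<in> carrier G - {\<one>\<^bsub>G\<^esub>}"
    note P = bspec[OF Pr this]
    show "Pr h \<in> carrier_mat N N" "Pr h \<noteq> 0\<^sub>m N N" "Pr h * Pr h = Pr h" using P by simp_all
    show "Pr h * \<sigma> g = \<sigma> g * Pr h" if "g \<in> carrier G" for g using P that by simp
    show "u = 0\<^sub>v N" if "u \<in> carrier_vec N" "Pr h *\<^sub>v u = u"
      "\<And>l. l \<in> carrier G \<Longrightarrow> \<sigma> (inv\<^bsub>G\<^esub> l \<otimes>\<^bsub>G\<^esub> h \<otimes>\<^bsub>G\<^esub> l) *\<^sub>v u = u" for u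
      using P that by simp
  qed
  let ?E = "{map_dim n m f | n (\<rho> :: 'g \<Rightarrow> 'k mat) m \<tau> f. faithful_covariant G n \<rho> m \<tau> f}"
  let ?C = "{map_dim n m f | n (\<rho> :: 'g \<Rightarrow> 'k mat) m \<tau> f. faithful_covariant G n \<rho> m \<tau> f \<and> regular_map n m f}"
  \<comment> \<open>The source is \<open>\<sigma>\<close> itself: the group acts faithfully on its
    coordinates, so a good family exists among all rational functions.\<close>
  have "?E \<noteq> {}"
  proof -
    interpret S: covariant_setting G N \<sigma> N \<sigma> Pr by (rule setting[OF \<sigma>(1)])
    have "\<exists>\<psi>. S.good \<psi> \<and> (\<forall>h\<in>carrier G - {\<one>\<^bsub>G\<^esub>}. \<forall>i<N. \<psi> h i \<in> ratfuns N)"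
    proof (rule S.good_family_exists)
      show "\<exists>r\<in>ratfuns N. S.act h r \<noteq> r" if "h \<in> carrier G" "h \<noteq> \<one>\<^bsub>G\<^esub>" for h
        using S.act_faithful[OF \<sigma>(3) that] ratfuns_var by blast
    qed (simp_all add: ratfuns_add ratfuns_mult S.act_ratfuns)
    then show ?thesis using S.flatten_faithful_covariant by blast
  qed
  then have "edim TYPE('k) G \<in> ?E" unfolding edim_def by (rule Inf_enat_attained)
  then obtain n m f and \<rho> \<tau> :: "'g \<Rightarrow> 'k mat"
    where f: "faithful_covariant G n \<rho> m \<tau> f" "edim TYPE('k) G = map_dim n m f" by auto
  interpret S: covariant_setting G n \<rho> N \<sigma> Pr
    using f(1) by (intro setting) (simp add: faithful_covariant_def covariant_def)
  have C: "covdim TYPE('k) G \<le> map_dim n' m' f'"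
    if "faithful_covariant G n' \<rho>' m' \<tau>' f'" "regular_map n' m' f'" for n' m' f' and \<rho>' \<tau>' :: "'g \<Rightarrow> 'k mat"
    unfolding covdim_def by (rule Inf_lower) (use that in blast)
  have ec: "edim TYPE('k) G \<le> covdim TYPE('k) G"
    unfolding edim_def covdim_def by (rule Inf_superset_mono) blast
  obtain f' where f': "faithful_covariant G n \<rho> m \<tau> f'" "regular_map n m f'" "map_dim n m f' \<le> map_dim n m f + 1"
    using S.regularise[OF f(1)] by blast
  have ce: "covdim TYPE('k) G \<le> edim TYPE('k) G + 1" using C[OF f'(1,2)] f'(3) f(2) by simp
  \<comment> \<open>For an infinite value the two alternatives \<open>edim\<close> and
    \<open>edim + 1\<close> would coincide.\<close>
  have fin: "edim TYPE('k) G \<noteq> \<infinity>"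
  proof -
    have "rational_map n m f" using f(1) by (simp add: faithful_covariant_def covariant_def)
    from map_dim_basis[OF this] show ?thesis unfolding f(2) by auto
  qed
  have "primitive_root_of_unity (ord \<one>\<^bsub>G\<^esub>) (1::'k)" by (auto simp: primitive_root_of_unity_def ord_id)
  then have one: "\<one>\<^bsub>G\<^esub> \<in> k_center TYPE('k) G" unfolding k_center_def using l_one r_one by fastforce
  have nontrivial: "covdim TYPE('k) G = edim TYPE('k) G" if nc: "k_center TYPE('k) G \<noteq> {\<one>\<^bsub>G\<^esub>}"
  proof -
    obtain x where "x \<in> k_center TYPE('k) G" "x \<noteq> \<one>\<^bsub>G\<^esub>" using nc one by blast
    from S.central_regularise[OF f(1) this] obtain \<chi> where chi: "S.good \<chi>"
      "regular_map n S.flat_dim (S.flatten \<chi>)" "map_dim n S.flat_dim (S.flatten \<chi>) \<le> map_dim n m f" by blast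
    show ?thesis using C[OF S.flatten_faithful_covariant[OF chi(1)] chi(2)] chi(3) f(2) ec by simp
  qed
  have trivial: "edim TYPE('k) G + 1 \<le> covdim TYPE('k) G" if kc: "k_center TYPE('k) G = {\<one>\<^bsub>G\<^esub>}"
  proof -
    have "?C \<noteq> {}" using f' by blast
    then have "covdim TYPE('k) G \<in> ?C" unfolding covdim_def by (rule Inf_enat_attained)
    then obtain n' m' f' and \<rho>' \<tau>' :: "'g \<Rightarrow> 'k mat" where c: "faithful_covariant G n' \<rho>' m' \<tau>' f'"
      "regular_map n' m' f'" "covdim TYPE('k) G = map_dim n' m' f'" by auto
    interpret T: covariant_setting G n' \<rho>' N \<sigma> Pr
      using c(1) by (intro setting) (simp add: faithful_covariant_def covariant_def)
    obtain \<chi> where chi: "T.good \<chi>" "map_dim n' T.flat_dim (T.flatten \<chi>) + 1 \<le> map_dim n' m' f'"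
      using T.regular_not_minimal[OF c(1,2) assms(3) kc] by blast
    have "edim TYPE('k) G \<le> map_dim n' T.flat_dim (T.flatten \<chi>)"
      unfolding edim_def by (rule Inf_lower) (use T.flatten_faithful_covariant[OF chi(1)] in blast)
    then show ?thesis using chi(2) c(3) by (metis add_right_mono order_trans)
  qed
  have "edim TYPE('k) G + 1 \<noteq> edim TYPE('k) G" using fin by (cases "edim TYPE('k) G") (auto simp: one_enat_def)
  then show ?thesis using nontrivial trivial ce by (metis order_antisym)
qed

end
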